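(* Let $0<m<1$. For $a>0$ consider the boundary value problem $$f'''+\frac{m+1}{2}ff''-mf'^2=0 \text{ on } [0,\infty),\qquad f(0)=a,\quad f'(0)=-1,\quad f'(\infty)=0.$$ Then there exist real numbers $0<a_1^*<a_2^*$ (depending on $m$) such that this problem admits: (i) no solution for $0<a<a_1^*$; (ii) exactly one solution for $a=a_1^*$; (iii) multiple solutions (i.e. more than one) for $a_1^*<a<a_2^*$; (iv) exactly two solutions for $a=a_2^*$; (v) exactly one solution for $a>a_2^*$. Moreover, all these solutions are convex, decreasing and positive.
   Context: A solution is a three times differentiable function $f:[0,\infty)\to\mathbb{R}$ satisfying the equation on $[0,\infty)$ and the boundary conditions, where $f'(\infty):=\lim_{t\to\infty}f'(t)$. *)

theory Defs
  imports "HOL-Analysis.Analysis"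
begin

(* A solution is a function on the half-line.  It is represented by a total function that is
   arbitrary but fixed ("undefined") on the negative reals, so that equality of elements of
   this set is equality on [0, infinity) and solutions can be counted.  Derivatives are taken
   within [0, infinity), hence are one-sided at 0 and do not depend on the values outside. *)
definition bvp_solutions :: "real \<Rightarrow> real \<Rightarrow> (real \<Rightarrow> real) set" where
  "bvp_solutions m a =
    {f \<in> extensional {0..}.
      \<exists>f1 f2 f3.
        (\<forall>t\<ge>0. (f has_real_derivative f1 t) (at t within {0..})) \<and>
        (\<forall>t\<ge>0. (f1 has_real_derivative f2 t) (at t within {0..})) \<and>
        (\<forall>t\<ge>0. (f2 has_real_derivative f3 t) (at t within {0..})) \<and>
        (\<forall>t\<ge>0. f3 t + (m + 1) / 2 * f t * f2 t - m * (f1 t)\<^sup>2 = 0) \<and>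
        f 0 = a \<and> f1 0 = -1 \<and> (f1 \<longlongrightarrow> 0) at_top}"

end

theory Submission
  imports Defs "HOL-Real_Asymp.Real_Asymp"
begin

text \<open>Put \<open>\<alpha> = (m + 1) / 2\<close> and reverse time by \<open>\<theta> = - \<alpha> t\<close>: the equation becomes
  \<open>Y''' = Y Y'' - \<mu> Y'\<^sup>2\<close> with \<open>\<mu> = m / \<alpha> < 1\<close>, to be solved on \<open>{..0}\<close> with \<open>Y' \<rightarrow> 0\<close> at \<open>-\<infinity>\<close>.
  Up to scaling and translation a solution is an orbit in the plane of the invariants
  \<open>\<rho> = Y' / Y\<^sup>2\<close> and \<open>\<chi> = Y'' / (Y' Y)\<close>, and the initial conditions say \<open>\<rho>(0) = 1 / (\<alpha> a\<^sup>2)\<close>.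

  Solutions with a positive limit at \<open>-\<infinity>\<close> all lie on one orbit, that of the series
  \<open>F(\<theta>) = \<Sum> c\<^sub>k e\<^sup>k\<^sup>\<theta>\<close>. Its coefficients are positive because \<open>\<mu> < 1\<close>, so \<open>F\<close>, \<open>F'\<close>, \<open>F''\<close> are positive as
  far as the series converges, and \<open>F''\<close> is unbounded there. Starting from \<open>\<rho> = 0\<close>, this orbit rises to a maximum \<open>\<rho>\<^sub>1\<close>,
  falls to a minimum \<open>\<rho>\<^sub>2\<close>, and can never reach these two values again, since orbits do not cross:
  it oscillates because the equilibrium \<open>\<rho> = (2 - \<mu>) / 6\<close> is a focus. Solutions with limit \<open>0\<close> oscillate too,
  cannot meet the orbit of \<open>F\<close>, and are therefore trapped in \<open>\<rho>\<^sub>2 < \<rho> < \<rho>\<^sub>1\<close>; whether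
  there are others than the equilibrium is irrelevant for the count. The thresholds are the \<open>a\<close> with \<open>\<alpha> \<rho>\<^sub>i a\<^sup>2 = 1\<close>.\<close>

section \<open>Calculus on real intervals\<close>

text \<open>Two obstacles shape the proof. The natural time of the invariant plane is the integral
  of \<open>Y\<close>, and its total is not known beforehand: the series may stop converging at a
  finite point, and at -\<infinity> a solution may tend to 0 at an unknown rate. Since
  \<open>ln B\<close> grows no faster than the integral of \<open>Y\<close>, unbounded oscillation
  of \<open>ln B\<close> certifies infinite natural time at either end. Each exclusion of a monotone
  or one-sided orbit then exhibits a bounded quantity whose derivative is at least a positive
  multiple of \<open>Y\<close>: an energy, an angle, or the quotient of the two invariants. The
  second obstacle is the end -\<infinity> itself, where uniqueness for initial values says nothing.
  That all solutions with the same positive limit agree up to translation is proved by a contraction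
  estimate on quantities integrated from -\<infinity>. Planar topology is kept elementary: between
  consecutive turning points the orbit of the series is a graph over \<open>rho\<close>, so crossing
  it is a matter of the intermediate value theorem, and no theory of limit sets or limit cycles
  enters.\<close>

lemma deriv_nonneg_mono:
  fixes g g' :: "real \<Rightarrow> real"
  assumes "\<And>x. x \<in> S \<Longrightarrow> (g has_real_derivative g' x) (at x within S)"
    and "{a..b} \<subseteq> S" and "\<And>x. a < x \<Longrightarrow> x < b \<Longrightarrow> 0 \<le> g' x" and "a \<le> b"
  shows "g a \<le> g b"
proof (cases "a = b")
  case False
  then have "a < b" using assms(4) by simp
  have d: "(g has_real_derivative g' x) (at x within {a..b})" if "x \<in> {a..b}" for x
    using has_field_derivative_subset[OF assms(1) assms(2)] that assms(2) by blast
  show ?thesis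
  proof (rule DERIV_nonneg_imp_increasing_open[OF assms(4)])
    show "continuous_on {a..b} g"
      using d by (rule DERIV_continuous_on)
    fix x assume "a < x" "x < b"
    then show "\<exists>y. (g has_real_derivative y) (at x) \<and> 0 \<le> y"
      using d[of x] assms(3)[of x] at_within_Icc_at[of a x b] by auto
  qed
qed simp

lemma deriv_pos_strict_mono:
  fixes g g' :: "real \<Rightarrow> real"
  assumes "\<And>x. x \<in> S \<Longrightarrow> (g has_real_derivative g' x) (at x within S)"
    and "{a..b} \<subseteq> S" and "\<And>x. a < x \<Longrightarrow> x < b \<Longrightarrow> 0 < g' x" and "a < b"
  shows "g a < g b"
proof -
  have d: "(g has_real_derivative g' x) (at x within {a..b})" if "x \<in> {a..b}" for x
    using has_field_derivative_subset[OF assms(1) assms(2)] that assms(2) by blast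
  show ?thesis
  proof (rule DERIV_pos_imp_increasing_open[OF assms(4)])
    show "continuous_on {a..b} g"
      using d by (rule DERIV_continuous_on)
    fix x assume "a < x" "x < b"
    then show "\<exists>y. (g has_real_derivative y) (at x) \<and> 0 < y"
      using d[of x] assms(3)[of x] at_within_Icc_at[of a x b] by auto
  qed
qed

lemma first_zero:
  fixes g :: "real \<Rightarrow> real"
  assumes "continuous_on {a..b} g" "a \<le> b" "0 < g a" "g b \<le> 0"
  obtains c where "a < c" "c \<le> b" "g c = 0" "\<And>x. a \<le> x \<Longrightarrow> x < c \<Longrightarrow> 0 < g x"
proof -
  define Z where "Z = {a..b} \<inter> g -` {..0}"
  have cl: "closed Z"
    unfolding Z_def by (rule continuous_closed_preimage[OF assms(1)]) auto
  have ne: "Z \<noteq> {}" using assms unfolding Z_def by auto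
  have bb: "bdd_below Z" unfolding Z_def by (auto intro: bdd_belowI[of _ a])
  define c where "c = Inf Z"
  have cZ: "c \<in> Z" unfolding c_def by (rule closed_contains_Inf[OF ne bb cl])
  have pos: "0 < g x" if "a \<le> x" "x < c" for x
  proof (rule ccontr)
    assume "\<not> 0 < g x"
    then have "x \<in> Z" using that cZ unfolding Z_def by auto
    then have "c \<le> x" unfolding c_def by (rule cInf_lower[OF _ bb])
    then show False using that by simp
  qed
  have ac: "a < c" using cZ assms(3) unfolding Z_def by (cases "a = c") auto
  have "g c = 0"
  proof (rule ccontr)
    assume "g c \<noteq> 0"
    then have "g c < 0" using cZ unfolding Z_def by auto
    moreover have "continuous_on {a..c} g"
      using assms(1) cZ unfolding Z_def by (auto elim: continuous_on_subset)
    ultimately obtain x where "a \<le> x" "x \<le> c" "g x = 0"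
      using IVT2'[of g c 0 a] assms(3) ac by auto
    then show False using pos[of x] \<open>g c < 0\<close> by (cases "x = c") auto
  qed
  then show ?thesis using that ac cZ pos unfolding Z_def by auto
qed

lemma last_zero:
  fixes g :: "real \<Rightarrow> real"
  assumes "continuous_on {a..b} g" "a \<le> b" "g a \<le> 0" "0 < g b"
  obtains c where "a \<le> c" "c < b" "g c = 0" "\<And>x. c < x \<Longrightarrow> x \<le> b \<Longrightarrow> 0 < g x"
proof -
  have "continuous_on {-b..-a} (\<lambda>x. g (- x))"
    by (intro continuous_on_compose2[OF assms(1)] continuous_intros) auto
  from first_zero[OF this] assms obtain c
    where c: "-b < c" "c \<le> -a" "g (- c) = 0" "\<And>x. -b \<le> x \<Longrightarrow> x < c \<Longrightarrow> 0 < g (- x)"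
    by auto
  show ?thesis
  proof (rule that[of "-c"])
    fix x assume "- c < x" "x \<le> b"
    then show "0 < g x" using c(4)[of "-x"] by simp
  qed (use c in auto)
qed

text \<open>In the plane: a path from one side of the curve \<open>y \<mapsto> (R y, X y)\<close> to the other meets it.\<close>

lemma crossing:
  fixes r x R X :: "real \<Rightarrow> real"
  assumes "continuous_on {u..v} R" "continuous_on {u..v} X" "inj_on R {u..v}"
    and "continuous_on {s..t} r" "continuous_on {s..t} x" "s \<le> t"
    and sub: "r ` {s..t} \<subseteq> R ` {u..v}"
    and left: "\<And>y. y \<in> {u..v} \<Longrightarrow> R y = r s \<Longrightarrow> x s \<le> X y"
    and right: "\<And>y. y \<in> {u..v} \<Longrightarrow> R y = r t \<Longrightarrow> X y \<le> x t"
  obtains z y where "z \<in> {s..t}" "y \<in> {u..v}" "R y = r z" "X y = x z"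
proof -
  define g where "g = the_inv_into {u..v} R"
  have gR: "g (R y) = y" if "y \<in> {u..v}" for y
    unfolding g_def by (rule the_inv_into_f_f[OF assms(3) that])
  have "continuous_on (R ` {u..v}) g"
    by (rule continuous_on_inv[OF assms(1)]) (use gR in auto)
  then have cg: "continuous_on {s..t} (\<lambda>z. g (r z))"
    by (rule continuous_on_compose2[OF _ assms(4) sub])
  have in_uv: "g (r z) \<in> {u..v}" and Rg: "R (g (r z)) = r z" if "z \<in> {s..t}" for z
  proof -
    have "r z \<in> R ` {u..v}" using sub that by (simp only: image_subset_iff)
    then obtain y where y: "y \<in> {u..v}" "r z = R y" by (elim imageE)
    then show "g (r z) \<in> {u..v}" "R (g (r z)) = r z" using gR by auto
  qed
  have "continuous_on {s..t} (\<lambda>z. x z - X (g (r z)))"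
    by (intro continuous_intros assms(5) continuous_on_compose2[OF assms(2) cg]) (use in_uv in auto)
  moreover have "x s - X (g (r s)) \<le> 0" "0 \<le> x t - X (g (r t))"
    using left[of "g (r s)"] right[of "g (r t)"] in_uv Rg assms(6) by auto
  ultimately obtain z where "s \<le> z" "z \<le> t" "x z - X (g (r z)) = 0"
    using IVT'[of "\<lambda>z. x z - X (g (r z))" s 0 t] assms(6) by auto
  then show ?thesis using that[of z "g (r z)"] in_uv Rg by auto
qed

lemma crossing':
  fixes r x R X :: "real \<Rightarrow> real"
  assumes "continuous_on {u..v} R" "continuous_on {u..v} X" "inj_on R {u..v}"
    and "continuous_on {s..t} r" "continuous_on {s..t} x" "s \<le> t"
    and sub: "r ` {s..t} \<subseteq> R ` {u..v}"
    and left: "\<And>y. y \<in> {u..v} \<Longrightarrow> R y = r s \<Longrightarrow> X y \<le> x s"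
    and right: "\<And>y. y \<in> {u..v} \<Longrightarrow> R y = r t \<Longrightarrow> x t \<le> X y"
  obtains z y where "z \<in> {s..t}" "y \<in> {u..v}" "R y = r z" "X y = x z"
proof -
  have c1: "continuous_on {u..v} (\<lambda>y. - X y)" and c2: "continuous_on {s..t} (\<lambda>y. - x y)"
    by (intro continuous_intros assms)+
  show ?thesis
    by (rule crossing[OF assms(1) c1 assms(3,4) c2 assms(6) sub]) (use left right that in auto)
qed

text \<open>Multiplication by \<open>exp (C * x)\<close> makes \<open>E\<close> nondecreasing, and
  by \<open>exp (- C * x)\<close> nonincreasing. The zero at \<open>c\<close>, which may be an
  interior point, therefore spreads to both sides.\<close>

lemma gronwall_zero:
  fixes E E' :: "real \<Rightarrow> real"
  assumes d: "\<And>x. x \<in> {a..b} \<Longrightarrow> (E has_real_derivative E' x) (at x within {a..b})"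
    and nn: "\<And>x. x \<in> {a..b} \<Longrightarrow> 0 \<le> E x"
    and bd: "\<And>x. x \<in> {a..b} \<Longrightarrow> \<bar>E' x\<bar> \<le> C * E x"
    and c: "c \<in> {a..b}" "E c = 0" and x: "x \<in> {a..b}"
  shows "E x = 0"
proof -
  have d1: "((\<lambda>x. exp (C * x) * E x) has_real_derivative exp (C * x) * (E' x + C * E x))
      (at x within {a..b})" if "x \<in> {a..b}" for x
    using d[OF that] by (auto intro!: derivative_eq_intros simp: algebra_simps)
  have d2: "((\<lambda>x. - exp (- C * x) * E x) has_real_derivative exp (- C * x) * (C * E x - E' x))
      (at x within {a..b})" if "x \<in> {a..b}" for x
    using d[OF that] by (auto intro!: derivative_eq_intros simp: algebra_simps)
  show ?thesis
  proof (cases "x \<le> c")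
    case True
    have "exp (C * x) * E x \<le> exp (C * c) * E c"
    proof (rule deriv_nonneg_mono[OF d1 _ _ True])
      fix y assume "x < y" "y < c"
      then have "\<bar>E' y\<bar> \<le> C * E y" using bd c x by auto
      then show "0 \<le> exp (C * y) * (E' y + C * E y)" by simp
    qed (use c x in auto)
    then have "exp (C * x) * E x \<le> 0" using c by simp
    then show ?thesis using nn[OF x] by (simp add: mult_le_0_iff)
  next
    case False
    have "- exp (- C * c) * E c \<le> - exp (- C * x) * E x"
    proof (rule deriv_nonneg_mono[OF d2])
      fix y assume "c < y" "y < x"
      then have "\<bar>E' y\<bar> \<le> C * E y" using bd c x by auto
      then show "0 \<le> exp (- C * y) * (C * E y - E' y)" by simp
    qed (use False c x in auto)
    then have "exp (- C * x) * E x \<le> 0" using c by simp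
    then show ?thesis using nn[OF x] by (simp add: mult_le_0_iff)
  qed
qed

lemma deriv_affine:
  fixes g :: "real \<Rightarrow> real"
  assumes "(g has_real_derivative g') (at (k * x + e) within S)" "\<And>x. x \<in> T \<Longrightarrow> k * x + e \<in> S" "x \<in> T"
  shows "((\<lambda>x. g (k * x + e)) has_real_derivative g' * k) (at x within T)"
proof -
  have "(g has_real_derivative g') (at (k * x + e) within (\<lambda>x. k * x + e) ` T)"
    by (rule has_field_derivative_subset[OF assms(1)]) (use assms(2) in auto)
  moreover have "((\<lambda>x. k * x + e) has_real_derivative k) (at x within T)"
    by (auto intro!: derivative_eq_intros)
  ultimately show ?thesis
    using DERIV_image_chain[of g g' "\<lambda>x. k * x + e" x T k] by (simp add: o_def)
qed

section \<open>The third-order equation as a first-order system: scaling and uniqueness\<close>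

definition sol :: "real \<Rightarrow> real set \<Rightarrow> (real \<Rightarrow> real) \<Rightarrow> (real \<Rightarrow> real) \<Rightarrow> (real \<Rightarrow> real) \<Rightarrow> bool" where
  "sol \<mu> S Y A B \<longleftrightarrow> (\<forall>x\<in>S.
    (Y has_real_derivative A x) (at x within S) \<and>
    (A has_real_derivative B x) (at x within S) \<and>
    (B has_real_derivative Y x * B x - \<mu> * (A x)\<^sup>2) (at x within S))"

lemma solD:
  assumes "sol \<mu> S Y A B" "x \<in> S"
  shows "(Y has_real_derivative A x) (at x within S)"
    and "(A has_real_derivative B x) (at x within S)"
    and "(B has_real_derivative Y x * B x - \<mu> * (A x)\<^sup>2) (at x within S)"
  using assms unfolding sol_def by auto

lemma sol_subset: "sol \<mu> S Y A B \<Longrightarrow> T \<subseteq> S \<Longrightarrow> sol \<mu> T Y A B"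
  unfolding sol_def by (meson has_field_derivative_subset subsetD)

lemma sol_continuous:
  assumes "sol \<mu> S Y A B"
  shows "continuous_on S Y" "continuous_on S A" "continuous_on S B"
proof -
  show "continuous_on S Y" by (rule DERIV_continuous_on) (erule solD(1)[OF assms])
  show "continuous_on S A" by (rule DERIV_continuous_on) (erule solD(2)[OF assms])
  show "continuous_on S B" by (rule DERIV_continuous_on) (erule solD(3)[OF assms])
qed

text \<open>\<open>Y\<close> scales like an inverse time, so every term of the equation has weight
  four. Together with translations this is the two-parameter symmetry group whose invariants are
  \<open>rho\<close> and \<open>chi\<close> below.\<close>

lemma sol_scale:
  assumes "sol \<mu> S Y A B" "\<And>x. x \<in> T \<Longrightarrow> k * x + c \<in> S"
  shows "sol \<mu> T (\<lambda>x. k * Y (k * x + c)) (\<lambda>x. k\<^sup>2 * A (k * x + c)) (\<lambda>x. k ^ 3 * B (k * x + c))"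
proof -
  have ch: "((\<lambda>x. g (k * x + c)) has_real_derivative g' * k) (at x within T)"
    if "x \<in> T" "(g has_real_derivative g') (at (k * x + c) within S)" for g g' x
    by (rule deriv_affine[OF that(2) assms(2) that(1)])
  show ?thesis unfolding sol_def
  proof (intro ballI conjI)
    fix x assume x: "x \<in> T"
    note s = solD[OF assms(1) assms(2)[OF x]]
    show "((\<lambda>x. k * Y (k * x + c)) has_real_derivative k\<^sup>2 * A (k * x + c)) (at x within T)"
      by (rule derivative_eq_intros ch[OF x s(1)] refl)+ (simp add: power2_eq_square)
    show "((\<lambda>x. k\<^sup>2 * A (k * x + c)) has_real_derivative k ^ 3 * B (k * x + c)) (at x within T)"
      by (rule derivative_eq_intros ch[OF x s(2)] refl)+ (simp add: power2_eq_square power3_eq_cube)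
    show "((\<lambda>x. k ^ 3 * B (k * x + c)) has_real_derivative
        k * Y (k * x + c) * (k ^ 3 * B (k * x + c)) - \<mu> * (k\<^sup>2 * A (k * x + c))\<^sup>2) (at x within T)"
      by (rule derivative_eq_intros ch[OF x s(3)] refl)+
        (simp add: power2_eq_square power3_eq_cube algebra_simps)
  qed
qed

lemma sol_unique_Icc:
  assumes s1: "sol \<mu> {a..b} Y1 A1 B1" and s2: "sol \<mu> {a..b} Y2 A2 B2"
    and c: "c \<in> {a..b}" "Y1 c = Y2 c" "A1 c = A2 c" "B1 c = B2 c" and x: "x \<in> {a..b}"
  shows "Y1 x = Y2 x \<and> A1 x = A2 x \<and> B1 x = B2 x"
proof -
  define E where "E x = (Y1 x - Y2 x)\<^sup>2 + (A1 x - A2 x)\<^sup>2 + (B1 x - B2 x)\<^sup>2" for x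
  \<comment> \<open>\<open>P\<close> is the difference of the two right-hand sides, factored so that
    each difference of unknowns is multiplied by a function bounded on the compact interval.\<close>
  define P where "P x = Y1 x * (B1 x - B2 x) + B2 x * (Y1 x - Y2 x) - \<mu> * (A1 x + A2 x) * (A1 x - A2 x)" for x
  define E' where "E' x = 2 * (Y1 x - Y2 x) * (A1 x - A2 x) + 2 * (A1 x - A2 x) * (B1 x - B2 x)
      + 2 * (B1 x - B2 x) * P x" for x
  have dE: "(E has_real_derivative E' x) (at x within {a..b})" if "x \<in> {a..b}" for x
    unfolding E_def E'_def P_def
    using solD[OF s1 that] solD[OF s2 that]
    by (auto intro!: derivative_eq_intros simp: power2_eq_square algebra_simps)
  have "compact (Y1 ` {a..b})" "compact (B2 ` {a..b})" "compact ((\<lambda>x. \<mu> * (A1 x + A2 x)) ` {a..b})"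
    by (intro compact_continuous_image continuous_intros sol_continuous[OF s1] sol_continuous[OF s2]; simp)+
  then have "bounded (Y1 ` {a..b} \<union> B2 ` {a..b} \<union> (\<lambda>x. \<mu> * (A1 x + A2 x)) ` {a..b})"
    by (intro bounded_Un[THEN iffD2] conjI compact_imp_bounded)
  then obtain M where "\<forall>y\<in>Y1 ` {a..b} \<union> B2 ` {a..b} \<union> (\<lambda>x. \<mu> * (A1 x + A2 x)) ` {a..b}. \<bar>y\<bar> \<le> M"
    unfolding bounded_iff by auto
  then have M: "\<bar>Y1 x\<bar> \<le> M \<and> \<bar>B2 x\<bar> \<le> M \<and> \<bar>\<mu> * (A1 x + A2 x)\<bar> \<le> M" if "x \<in> {a..b}" for x
    using that by blast
  have "M \<ge> 0" using M[OF c(1)] by auto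
  have bd: "\<bar>E' x\<bar> \<le> (2 + 4 * M) * E x" if "x \<in> {a..b}" for x
  proof -
    define p q w where "p = Y1 x - Y2 x" "q = A1 x - A2 x" "w = B1 x - B2 x"
    have am: "2 * (\<bar>u\<bar> * \<bar>v\<bar>) \<le> u\<^sup>2 + v\<^sup>2" for u v :: real
      using sum_squares_bound[of "\<bar>u\<bar>" "\<bar>v\<bar>"] by simp
    have "\<bar>P x\<bar> \<le> \<bar>Y1 x\<bar> * \<bar>w\<bar> + \<bar>B2 x\<bar> * \<bar>p\<bar> + \<bar>\<mu> * (A1 x + A2 x)\<bar> * \<bar>q\<bar>"
      unfolding P_def p_q_w_def abs_mult[symmetric] by linarith
    also have "\<dots> \<le> M * \<bar>w\<bar> + M * \<bar>p\<bar> + M * \<bar>q\<bar>"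
      using M[OF that] by (intro add_mono mult_right_mono) auto
    finally have "\<bar>w\<bar> * \<bar>P x\<bar> \<le> \<bar>w\<bar> * (M * \<bar>w\<bar> + M * \<bar>p\<bar> + M * \<bar>q\<bar>)"
      by (rule mult_left_mono) simp
    also have "\<dots> = M * (w\<^sup>2 + \<bar>w\<bar> * \<bar>p\<bar> + \<bar>w\<bar> * \<bar>q\<bar>)"
      by (simp add: algebra_simps power2_eq_square)
    also have "\<dots> \<le> M * (2 * (p\<^sup>2 + q\<^sup>2 + w\<^sup>2))"
    proof (rule mult_left_mono)
      have "0 \<le> p\<^sup>2" "0 \<le> q\<^sup>2" "0 \<le> w\<^sup>2" by simp_all
      then show "w\<^sup>2 + \<bar>w\<bar> * \<bar>p\<bar> + \<bar>w\<bar> * \<bar>q\<bar> \<le> 2 * (p\<^sup>2 + q\<^sup>2 + w\<^sup>2)"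
        using am[of w p] am[of w q] by argo
    qed (use \<open>M \<ge> 0\<close> in simp)
    finally have wP: "\<bar>w\<bar> * \<bar>P x\<bar> \<le> M * (2 * (p\<^sup>2 + q\<^sup>2 + w\<^sup>2))" .
    have "\<bar>E' x\<bar> = \<bar>2 * (p * q) + 2 * (q * w) + 2 * (w * P x)\<bar>"
      unfolding E'_def p_q_w_def by (simp only: mult.assoc)
    also have "\<dots> \<le> 2 * \<bar>p * q\<bar> + 2 * \<bar>q * w\<bar> + 2 * \<bar>w * P x\<bar>"
      by linarith
    also have "\<dots> \<le> (2 + 4 * M) * (p\<^sup>2 + q\<^sup>2 + w\<^sup>2)"
    proof -
      have "0 \<le> p\<^sup>2" "0 \<le> q\<^sup>2" "0 \<le> w\<^sup>2" by simp_all
      moreover have "(2 + 4 * M) * (p\<^sup>2 + q\<^sup>2 + w\<^sup>2) =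
          2 * (p\<^sup>2 + q\<^sup>2 + w\<^sup>2) + 2 * (M * (2 * (p\<^sup>2 + q\<^sup>2 + w\<^sup>2)))"
        by (simp add: algebra_simps)
      ultimately show ?thesis
        using wP am[of p q] am[of q w] unfolding abs_mult by argo
    qed
    finally show ?thesis unfolding E_def p_q_w_def .
  qed
  have "E x = 0"
    by (rule gronwall_zero[OF dE _ bd c(1) _ x]) (auto simp: E_def c)
  then have "(Y1 x - Y2 x)\<^sup>2 = 0 \<and> (A1 x - A2 x)\<^sup>2 = 0 \<and> (B1 x - B2 x)\<^sup>2 = 0"
    unfolding E_def using zero_le_power2[of "Y1 x - Y2 x"] zero_le_power2[of "A1 x - A2 x"]
      zero_le_power2[of "B1 x - B2 x"] by linarith
  then show ?thesis by simp
qed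

lemma sol_unique:
  assumes "sol \<mu> S Y1 A1 B1" "sol \<mu> S Y2 A2 B2" "is_interval S"
    and "c \<in> S" "Y1 c = Y2 c" "A1 c = A2 c" "B1 c = B2 c" "x \<in> S"
  shows "Y1 x = Y2 x" "A1 x = A2 x" "B1 x = B2 x"
proof -
  have mn: "min c x \<in> S" "max c x \<in> S"
    using assms(4,8) by (simp_all add: min_def max_def)
  have sub: "{min c x..max c x} \<subseteq> S"
    using mem_is_interval_1_I[OF assms(3) mn] by auto
  have cx: "c \<in> {min c x..max c x}" "x \<in> {min c x..max c x}"
    by simp_all
  have "Y1 x = Y2 x \<and> A1 x = A2 x \<and> B1 x = B2 x"
    by (rule sol_unique_Icc[OF sol_subset[OF assms(1) sub] sol_subset[OF assms(2) sub] cx(1) assms(5-7) cx(2)])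
  then show "Y1 x = Y2 x" "A1 x = A2 x" "B1 x = B2 x" by auto
qed

section \<open>The phase plane of the rescaled equation\<close>

definition rho :: "(real \<Rightarrow> real) \<Rightarrow> (real \<Rightarrow> real) \<Rightarrow> real \<Rightarrow> real" where
  "rho Y A x = A x / (Y x)\<^sup>2"

definition chi :: "(real \<Rightarrow> real) \<Rightarrow> (real \<Rightarrow> real) \<Rightarrow> (real \<Rightarrow> real) \<Rightarrow> real \<Rightarrow> real" where
  "chi Y A B x = B x / (A x * Y x)"

text \<open>Vertical distance from the line chi = 2 rho in the invariant plane. Where
  \<open>Y\<close> and \<open>A\<close> are positive, its sign is that of the derivative of
  \<open>rho\<close>, so its zeros are the turning points of \<open>rho\<close>.\<close>

definition dlt :: "(real \<Rightarrow> real) \<Rightarrow> (real \<Rightarrow> real) \<Rightarrow> (real \<Rightarrow> real) \<Rightarrow> real \<Rightarrow> real" where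
  "dlt Y A B x = chi Y A B x - 2 * rho Y A x"

lemma rho_deriv:
  assumes "sol \<mu> S Y A B" "x \<in> S" "Y x \<noteq> 0" "A x \<noteq> 0"
  shows "(rho Y A has_real_derivative Y x * rho Y A x * dlt Y A B x) (at x within S)"
  unfolding rho_def[abs_def]
  using solD[OF assms(1,2)] assms(3,4)
  by (auto intro!: derivative_eq_intros
      simp: dlt_def rho_def chi_def field_simps power2_eq_square power3_eq_cube)

lemma chi_deriv:
  assumes "sol \<mu> S Y A B" "x \<in> S" "Y x \<noteq> 0" "A x \<noteq> 0"
  shows "(chi Y A B has_real_derivative
    Y x * (chi Y A B x * (1 - chi Y A B x - rho Y A x) - \<mu> * rho Y A x)) (at x within S)"
  unfolding chi_def[abs_def]
  using solD[OF assms(1,2)] assms(3,4)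
  by (auto intro!: derivative_eq_intros
      simp: rho_def chi_def field_simps power2_eq_square power3_eq_cube)

lemma dlt_deriv:
  assumes "sol \<mu> S Y A B" "x \<in> S" "Y x \<noteq> 0" "A x \<noteq> 0"
  shows "(dlt Y A B has_real_derivative
    Y x * (dlt Y A B x * (1 - dlt Y A B x - 7 * rho Y A x) + 6 * rho Y A x * ((2 - \<mu>) / 6 - rho Y A x)))
    (at x within S)"
proof -
  have "((\<lambda>x. chi Y A B x - 2 * rho Y A x) has_real_derivative
    Y x * (chi Y A B x * (1 - chi Y A B x - rho Y A x) - \<mu> * rho Y A x)
    - 2 * (Y x * rho Y A x * dlt Y A B x)) (at x within S)"
    using rho_deriv[OF assms] chi_deriv[OF assms] by (auto intro!: derivative_eq_intros)
  moreover have "Y x * (chi Y A B x * (1 - chi Y A B x - rho Y A x) - \<mu> * rho Y A x)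
    - 2 * (Y x * rho Y A x * dlt Y A B x) =
    Y x * (dlt Y A B x * (1 - dlt Y A B x - 7 * rho Y A x) + 6 * rho Y A x * ((2 - \<mu>) / 6 - rho Y A x))"
    unfolding dlt_def by (simp add: field_simps)
  ultimately show ?thesis unfolding dlt_def[abs_def] by simp
qed

locale exponent =
  fixes \<mu> :: real
  assumes mu_pos: "0 < \<mu>" and mu_less: "\<mu> < 1"
begin

text \<open>Inserting \<open>Y' = rs * Y^2\<close> into the equation leaves
  \<open>6 * rs = 2 - \<mu>\<close>: this is the value of \<open>rho\<close> on the self-similar
  solution.\<close>

definition rs :: real where "rs = (2 - \<mu>) / 6"

lemma rs_bounds: "1 / 6 < rs" "rs < 1 / 3"
  using mu_pos mu_less unfolding rs_def by auto

end

text \<open>The interval \<open>S\<close> may run towards either end of the orbit; the last assumption says that \<open>ln B\<close>,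
  whose derivative is at most \<open>Y\<close>, has unbounded oscillation on it.\<close>

locale orbit = exponent +
  fixes S :: "real set" and Y A B :: "real \<Rightarrow> real"
  assumes sol: "sol \<mu> S Y A B" and ivl: "is_interval S"
    and Y_pos: "\<And>x. x \<in> S \<Longrightarrow> 0 < Y x"
    and A_pos: "\<And>x. x \<in> S \<Longrightarrow> 0 < A x"
    and B_pos: "\<And>x. x \<in> S \<Longrightarrow> 0 < B x"
    and swing: "\<And>K. \<exists>x\<in>S. \<exists>y\<in>S. x \<le> y \<and> K * B x < B y"
begin

abbreviation "r \<equiv> rho Y A"
abbreviation "X \<equiv> chi Y A B"
abbreviation "dl \<equiv> dlt Y A B"

lemma r_pos: "x \<in> S \<Longrightarrow> 0 < r x"
  using Y_pos[of x] A_pos[of x] unfolding rho_def by simp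

lemma X_pos: "x \<in> S \<Longrightarrow> 0 < X x"
  using Y_pos[of x] A_pos[of x] B_pos[of x] unfolding chi_def by simp

lemma r': "x \<in> S \<Longrightarrow> (r has_real_derivative Y x * r x * dl x) (at x within S)"
  using rho_deriv[OF sol, of x] Y_pos[of x] A_pos[of x] by force

lemma dl': "x \<in> S \<Longrightarrow> (dl has_real_derivative
    Y x * (dl x * (1 - dl x - 7 * r x) + 6 * r x * (rs - r x))) (at x within S)"
  unfolding rs_def using dlt_deriv[OF sol, of x] Y_pos[of x] A_pos[of x] by force

lemma X': "x \<in> S \<Longrightarrow> (X has_real_derivative Y x * (X x * (1 - X x - r x) - \<mu> * r x)) (at x within S)"
  using chi_deriv[OF sol, of x] Y_pos[of x] A_pos[of x] by force

text \<open>The logarithmic derivative of \<open>B\<close> is \<open>Y\<close> minus a nonnegative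
  term, so \<open>c * ln B\<close> cannot grow faster than \<open>G\<close>. A bounded
  \<open>G\<close> would thus bound the growth of \<open>ln B\<close>, against
  \<open>swing\<close>.\<close>

lemma clock:
  assumes G: "\<And>x. x \<in> S \<Longrightarrow> (G has_real_derivative G' x) (at x within S)"
    and c: "0 < c" "\<And>x. x \<in> S \<Longrightarrow> c * Y x \<le> G' x" and M: "\<And>x. x \<in> S \<Longrightarrow> \<bar>G x\<bar> \<le> M"
  shows False
proof -
  \<comment> \<open>The factor makes \<open>c * (ln (B y) - ln (B x))\<close> exceed
    \<open>2 * M\<close>, the largest possible increase of \<open>G\<close>, by the margin
    \<open>c\<close>.\<close>
  obtain x y where xy: "x \<in> S" "y \<in> S" "x \<le> y" "exp (2 * M / c + 1) * B x < B y"
    using swing by blast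
  have "{x..y} \<subseteq> S"
    using mem_is_interval_1_I[OF ivl xy(1,2)] by auto
  have "G x - c * ln (B x) \<le> G y - c * ln (B y)"
  proof (rule deriv_nonneg_mono[where S = S and g = "\<lambda>z. G z - c * ln (B z)"])
    fix z assume z: "z \<in> S"
    show "((\<lambda>z. G z - c * ln (B z)) has_real_derivative
        G' z - c * ((Y z * B z - \<mu> * (A z)\<^sup>2) / B z)) (at z within S)"
      using G[OF z] solD(3)[OF sol z] B_pos[OF z] by (auto intro!: derivative_eq_intros)
  next
    fix z assume "x < z" "z < y"
    then have z: "z \<in> S" using \<open>{x..y} \<subseteq> S\<close> by auto
    have "0 \<le> c * (\<mu> * (A z)\<^sup>2 / B z)"
      using B_pos[OF z] mu_pos c(1) by simp
    moreover have "G' z - c * ((Y z * B z - \<mu> * (A z)\<^sup>2) / B z) =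
        G' z - c * Y z + c * (\<mu> * (A z)\<^sup>2 / B z)"
      using B_pos[OF z] by (simp add: field_simps)
    ultimately show "0 \<le> G' z - c * ((Y z * B z - \<mu> * (A z)\<^sup>2) / B z)"
      using c(2)[OF z] by linarith
  qed (use xy \<open>{x..y} \<subseteq> S\<close> in auto)
  then have "c * (ln (B y) - ln (B x)) \<le> 2 * M"
    using M[OF xy(1)] M[OF xy(2)] by (auto simp: algebra_simps)
  moreover have "ln (exp (2 * M / c + 1) * B x) < ln (B y)"
    using xy(4) B_pos[OF xy(1)] B_pos[OF xy(2)] by (subst ln_less_cancel_iff) auto
  then have "2 * M / c + 1 < ln (B y) - ln (B x)"
    using B_pos[OF xy(1)] by (simp add: ln_mult)
  then have "c * (2 * M / c + 1) < c * (ln (B y) - ln (B x))"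
    using c(1) by (rule mult_strict_left_mono)
  moreover have "c * (2 * M / c + 1) = 2 * M + c" using c(1) by (simp add: field_simps)
  ultimately show False using c(1) by linarith
qed

text \<open>\<open>r * dl\<close> is the derivative of \<open>r\<close> in the natural time. In the
  variables \<open>r\<close> and \<open>r * dl\<close> the flow is a Lienard equation with damping
  \<open>1 - 7 * r\<close> and a restoring force of the sign of \<open>rs - r\<close>.\<close>

lemma p': "x \<in> S \<Longrightarrow> ((\<lambda>x. r x * dl x) has_real_derivative
    Y x * ((1 - 7 * r x) * (r x * dl x) + 6 * (r x)\<^sup>2 * (rs - r x))) (at x within S)"
  by (rule derivative_eq_intros r' dl' refl | assumption)+
    (simp add: algebra_simps power2_eq_square)

text \<open>The damping term is an exact derivative; subtracting its antiderivative
  \<open>r - 7 / 2 * r^2\<close> leaves the restoring force alone.\<close>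

lemma energy':
  assumes "x \<in> S"
  shows "((\<lambda>x. r x * dl x - r x + 7 / 2 * (r x)\<^sup>2) has_real_derivative
    6 * Y x * (r x)\<^sup>2 * (rs - r x)) (at x within S)"
  by (rule derivative_eq_intros p'[OF assms] r'[OF assms] refl)+
    (simp add: algebra_simps power2_eq_square)

lemma energy_bound:
  assumes "x \<in> S" "r x \<le> M" "X x < 1"
  shows "\<bar>r x * dl x - r x + 7 / 2 * (r x)\<^sup>2\<bar> \<le> M * (1 + 2 * M) + M + 7 / 2 * M\<^sup>2"
proof -
  have "\<bar>dl x\<bar> \<le> 1 + 2 * M"
    using X_pos[OF assms(1)] r_pos[OF assms(1)] assms unfolding dlt_def by linarith
  then have "\<bar>r x * dl x\<bar> \<le> M * (1 + 2 * M)"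
    unfolding abs_mult using assms r_pos[OF assms(1)] by (intro mult_mono) auto
  moreover have "(r x)\<^sup>2 \<le> M\<^sup>2"
    using assms r_pos[OF assms(1)] by (intro power_mono) auto
  ultimately show ?thesis using assms r_pos[OF assms(1)]
    using zero_le_power2[of "r x"] by linarith
qed

text \<open>Away from 0 and from \<open>rs\<close> the restoring force has a fixed sign and a
  positive lower bound, so the bounded energy would be a clock.\<close>

lemma not_below:
  assumes "\<And>x. x \<in> S \<Longrightarrow> r x \<le> M" "\<And>x. x \<in> S \<Longrightarrow> X x < 1"
    and "0 < e" "\<And>x. x \<in> S \<Longrightarrow> e \<le> r x" "\<And>x. x \<in> S \<Longrightarrow> r x \<le> rs - e"
  shows False
proof (rule clock[OF energy', where c = "6 * e ^ 3"])
  fix x assume x: "x \<in> S"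
  have "e\<^sup>2 * e \<le> (r x)\<^sup>2 * (rs - r x)"
    using assms(3) assms(4,5)[OF x] by (intro mult_mono power_mono) auto
  then have "6 * Y x * (e\<^sup>2 * e) \<le> 6 * Y x * ((r x)\<^sup>2 * (rs - r x))"
    using Y_pos[OF x] by (intro mult_left_mono) auto
  then show "6 * e ^ 3 * Y x \<le> 6 * Y x * (r x)\<^sup>2 * (rs - r x)"
    by (simp add: power2_eq_square power3_eq_cube algebra_simps)
qed (use energy_bound assms in auto)

lemma not_above:
  assumes "\<And>x. x \<in> S \<Longrightarrow> r x \<le> M" "\<And>x. x \<in> S \<Longrightarrow> X x < 1"
    and "0 < e" "\<And>x. x \<in> S \<Longrightarrow> rs + e \<le> r x"
  shows False
proof (rule clock[where c = "6 * e ^ 3"])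
  fix x assume x: "x \<in> S"
  show "((\<lambda>x. - (r x * dl x - r x + 7 / 2 * (r x)\<^sup>2)) has_real_derivative
    - (6 * Y x * (r x)\<^sup>2 * (rs - r x))) (at x within S)"
    by (rule derivative_eq_intros energy'[OF x] refl)+
  have "e\<^sup>2 * e \<le> (r x)\<^sup>2 * (r x - rs)"
    using assms(3) assms(4)[OF x] rs_bounds by (intro mult_mono power_mono) auto
  then have "6 * Y x * (e\<^sup>2 * e) \<le> 6 * Y x * ((r x)\<^sup>2 * (r x - rs))"
    using Y_pos[OF x] by (intro mult_left_mono) auto
  then show "6 * e ^ 3 * Y x \<le> - (6 * Y x * (r x)\<^sup>2 * (rs - r x))"
    by (simp add: power2_eq_square power3_eq_cube algebra_simps)
  show "\<bar>- (r x * dl x - r x + 7 / 2 * (r x)\<^sup>2)\<bar> \<le> M * (1 + 2 * M) + M + 7 / 2 * M\<^sup>2"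
    unfolding abs_minus_cancel by (rule energy_bound[OF x assms(1,2)[OF x]])
qed (use assms in auto)

text \<open>The equilibrium \<open>(rs, 2 rs)\<close> is a focus: the slope \<open>r dl / (rs - r)\<close> seen from it obeys a Riccati
  equation without real equilibria.\<close>

lemma not_one_sided:
  assumes "\<And>x. x \<in> S \<Longrightarrow> 1 / 7 \<le> r x" "\<And>x. x \<in> S \<Longrightarrow> r x \<le> 2 / 5"
    and "\<And>x. x \<in> S \<Longrightarrow> r x \<noteq> rs"
  shows False
proof (rule clock[where c = "1 / 20" and M = 2])
  fix x assume x: "x \<in> S"
  define h K where "h = rs - r x" and "K = r x * dl x / h"
  have h: "h \<noteq> 0" using assms(3)[OF x] unfolding h_def by simp
  define D where "D = Y x * (K\<^sup>2 + (1 - 7 * r x) * K + 6 * (r x)\<^sup>2)"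
  have "((\<lambda>x. r x * dl x / (rs - r x)) has_real_derivative
      (Y x * ((1 - 7 * r x) * (r x * dl x) + 6 * (r x)\<^sup>2 * (rs - r x)) * (rs - r x)
        - (r x * dl x) * (0 - Y x * r x * dl x)) / ((rs - r x) * (rs - r x))) (at x within S)"
    by (rule derivative_eq_intros p'[OF x] r'[OF x] refl)+ (use h in \<open>auto simp: h_def\<close>)
  also have "(Y x * ((1 - 7 * r x) * (r x * dl x) + 6 * (r x)\<^sup>2 * (rs - r x)) * (rs - r x)
        - (r x * dl x) * (0 - Y x * r x * dl x)) / ((rs - r x) * (rs - r x)) = D"
    unfolding D_def K_def h_def[symmetric] using h by (simp add: field_simps power2_eq_square)
  finally have K': "((\<lambda>x. r x * dl x / (rs - r x)) has_real_derivative D) (at x within S)" .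
  \<comment> \<open>The Riccati variable itself may be unbounded; its arctangent, the angle around
    the equilibrium, is a bounded clock.\<close>
  show "((\<lambda>x. arctan (r x * dl x / (rs - r x))) has_real_derivative inverse (1 + (r x * dl x / (rs - r x))\<^sup>2) *
      (Y x * ((r x * dl x / (rs - r x))\<^sup>2 + (1 - 7 * r x) * (r x * dl x / (rs - r x)) + 6 * (r x)\<^sup>2)))
      (at x within S)"
    using DERIV_chain2[OF DERIV_arctan K'] unfolding D_def K_def h_def .
  \<comment> \<open>The discriminant condition for the quadratic in \<open>K\<close> to dominate
    \<open>(1 + K^2) / 20\<close> follows from this product. The range from 1/7 to 2/5 contains a
    neighbourhood of every possible \<open>rs\<close>, because 1/6 < \<open>rs\<close> <
    1/3.\<close>
  have "0 \<le> (r x - 1 / 7) * (2 / 5 - r x)"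
    using assms(1,2)[OF x] by simp
  then have "100 * (1 - 7 * r x)\<^sup>2 \<le> 19 * (120 * (r x)\<^sup>2 - 1)"
    using assms(1,2)[OF x] unfolding power2_eq_square by (simp add: algebra_simps)
  moreover have "19 * (19 * K\<^sup>2 + 20 * (1 - 7 * r x) * K + 120 * (r x)\<^sup>2 - 1) =
      (19 * K + 10 * (1 - 7 * r x))\<^sup>2 + 19 * (120 * (r x)\<^sup>2 - 1) - 100 * (1 - 7 * r x)\<^sup>2"
    by (simp add: power2_eq_square algebra_simps)
  ultimately have "0 \<le> 19 * (19 * K\<^sup>2 + 20 * (1 - 7 * r x) * K + 120 * (r x)\<^sup>2 - 1)"
    using zero_le_power2[of "19 * K + 10 * (1 - 7 * r x)"] by argo
  then have "0 \<le> 19 * K\<^sup>2 + 20 * (1 - 7 * r x) * K + 120 * (r x)\<^sup>2 - 1"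
    by (simp only: zero_le_mult_iff) simp
  then have "1 / 20 * (1 + K\<^sup>2) \<le> K\<^sup>2 + (1 - 7 * r x) * K + 6 * (r x)\<^sup>2"
    by (simp add: field_simps)
  then have "1 / 20 \<le> inverse (1 + K\<^sup>2) * (K\<^sup>2 + (1 - 7 * r x) * K + 6 * (r x)\<^sup>2)"
    using zero_le_power2[of K] by (simp add: field_simps add_pos_nonneg)
  then have "1 / 20 * Y x \<le> inverse (1 + K\<^sup>2) * (K\<^sup>2 + (1 - 7 * r x) * K + 6 * (r x)\<^sup>2) * Y x"
    using Y_pos[OF x] by (intro mult_right_mono) auto
  then show "1 / 20 * Y x \<le> inverse (1 + (r x * dl x / (rs - r x))\<^sup>2) *
      (Y x * ((r x * dl x / (rs - r x))\<^sup>2 + (1 - 7 * r x) * (r x * dl x / (rs - r x)) + 6 * (r x)\<^sup>2))"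
    unfolding K_def h_def by (simp add: mult_ac)
  show "\<bar>arctan (r x * dl x / (rs - r x))\<bar> \<le> 2"
    using arctan_lbound[of "r x * dl x / (rs - r x)"] arctan_ubound[of "r x * dl x / (rs - r x)"]
      pi_less_4 by linarith
qed auto

text \<open>As \<open>r\<close> may tend to 0, neither the energy nor the angle has a uniform rate
  here. The quotient \<open>X / r\<close> stays between 1 and 2, and for small \<open>r\<close> its
  rate in the natural time is about \<open>X / r - \<mu>\<close>, which is at least
  \<open>1 - \<mu> > 0\<close>.\<close>

lemma not_near_origin:
  assumes "\<And>x. x \<in> S \<Longrightarrow> r x \<le> (1 - \<mu>) / 4" "\<And>x. x \<in> S \<Longrightarrow> r x \<le> X x"
    and "\<And>x. x \<in> S \<Longrightarrow> dl x \<le> 0"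
  shows False
proof (rule clock[where c = "(1 - \<mu>) / 2" and M = 2])
  fix x assume x: "x \<in> S"
  define e where "e = X x / r x"
  have rp: "0 < r x" using r_pos[OF x] .
  have Xe: "X x = e * r x" using rp unfolding e_def by simp
  have ex: "X x / r x = e" unfolding e_def ..
  have e: "1 \<le> e" "e \<le> 2"
    using assms(2,3)[OF x] rp unfolding e_def dlt_def by (simp_all add: field_simps)
  have "((\<lambda>x. X x / r x) has_real_derivative
      (Y x * (X x * (1 - X x - r x) - \<mu> * r x) * r x - X x * (Y x * r x * dl x)) / (r x * r x)) (at x within S)"
    by (rule derivative_eq_intros X'[OF x] r'[OF x] refl)+ (use rp in auto)
  also have "(Y x * (X x * (1 - X x - r x) - \<mu> * r x) * r x - X x * (Y x * r x * dl x)) / (r x * r x) =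
      Y x * (X x / r x * (1 - 2 * X x + r x) - \<mu>)"
    using rp unfolding dlt_def by (simp add: field_simps)
  finally show "((\<lambda>x. X x / r x) has_real_derivative
      Y x * (X x / r x * (1 - 2 * X x + r x) - \<mu>)) (at x within S)" .
  \<comment> \<open>The rate is a concave quadratic in \<open>e\<close>, hence at least the linear
    interpolation of its values \<open>1 - r - \<mu>\<close> at \<open>e = 1\<close> and
    \<open>2 - 6 r - \<mu>\<close> at \<open>e = 2\<close>; this product measures the
    surplus.\<close>
  have "0 \<le> (e - 1) * (2 - e)" using e by simp
  then have "0 \<le> r x * ((e - 1) * (2 - e))" using rp by simp
  moreover have "(2 - e) * (3 / 4 * (1 - \<mu>)) \<le> (2 - e) * (1 - r x - \<mu>)"
    using assms(1)[OF x] e by (intro mult_left_mono) auto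
  moreover have "(e - 1) * ((1 - \<mu>) / 2) \<le> (e - 1) * (2 - 6 * r x - \<mu>)"
    using assms(1)[OF x] e mu_pos by (intro mult_left_mono) auto
  moreover have "(1 - \<mu>) / 2 \<le> (2 - e) * (3 / 4 * (1 - \<mu>)) + (e - 1) * ((1 - \<mu>) / 2)"
  proof -
    have "0 \<le> (2 - e) * (1 - \<mu>)" using e mu_less by simp
    then show ?thesis by (simp add: field_simps)
  qed
  moreover have "e * (1 - 2 * (e * r x) + r x) - \<mu> =
      (2 - e) * (1 - r x - \<mu>) + (e - 1) * (2 - 6 * r x - \<mu>) + 2 * (r x * ((e - 1) * (2 - e)))"
    by (simp add: algebra_simps)
  ultimately have "(1 - \<mu>) / 2 \<le> e * (1 - 2 * (e * r x) + r x) - \<mu>" by linarith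
  then have "Y x * ((1 - \<mu>) / 2) \<le> Y x * (e * (1 - 2 * (e * r x) + r x) - \<mu>)"
    using Y_pos[OF x] by (intro mult_left_mono) auto
  then show "(1 - \<mu>) / 2 * Y x \<le> Y x * (X x / r x * (1 - 2 * X x + r x) - \<mu>)"
    unfolding ex unfolding Xe by (simp only: mult.commute)
  show "\<bar>X x / r x\<bar> \<le> 2" using e unfolding e_def by simp
qed (use mu_less in auto)

end

section \<open>The solution given by an exponential series\<close>

text \<open>Comparison of coefficients in the equation. The product with the constant term
  contributes \<open>k^2 c_k\<close>, which moved to the left gives the factor
  \<open>k^2 (k - 1)\<close>. It vanishes at \<open>k = 1\<close>, so \<open>c_1\<close> is free: it
  is set to 1 by translation, as \<open>c_0\<close> is by scaling.\<close>

fun coef :: "real \<Rightarrow> nat \<Rightarrow> real" where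
  "coef \<mu> k = (if k \<le> 1 then 1 else
    (\<Sum>i\<in>{1..<k}. ((real (k - i))\<^sup>2 - \<mu> * real i * real (k - i)) * coef \<mu> i * coef \<mu> (k - i))
      / ((real k)\<^sup>2 * (real k - 1)))"

declare coef.simps [simp del]

context exponent
begin

abbreviation c :: "nat \<Rightarrow> real" where "c \<equiv> coef \<mu>"

lemma c_0 [simp]: "c 0 = 1" and c_1 [simp]: "c (Suc 0) = 1"
  by (simp_all add: coef.simps)

lemma c_rec:
  assumes "2 \<le> k"
  shows "(real k)\<^sup>2 * (real k - 1) * c k =
    (\<Sum>i\<in>{1..<k}. ((real (k - i))\<^sup>2 - \<mu> * real i * real (k - i)) * c i * c (k - i))"
proof -
  have "(real k)\<^sup>2 * (real k - 1) \<noteq> 0" using assms by auto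
  then show ?thesis using assms by (subst coef.simps) simp
qed

text \<open>Single summands of the recursion can be negative. Pairing \<open>i\<close> with
  \<open>j = k - i\<close> gives the weight
  \<open>i^2 + j^2 - 2 \<mu> i j = (i - j)^2 + 2 (1 - \<mu>) i j\<close>, which is positive.\<close>

lemma c_pos: "0 < c k"
proof (induction k rule: less_induct)
  case (less k)
  show ?case
  proof (cases "k \<le> 1")
    case True
    then show ?thesis by (simp add: coef.simps)
  next
    case False
    define g where "g i = ((real (k - i))\<^sup>2 - \<mu> * real i * real (k - i)) * c i * c (k - i)" for i
    have "sum g {1..<k} = (\<Sum>i\<in>{1..<k}. g (k - i))"
      by (rule sum.reindex_bij_witness[of _ "\<lambda>i. k - i" "\<lambda>i. k - i"]) auto
    then have "2 * sum g {1..<k} = (\<Sum>i\<in>{1..<k}. g i + g (k - i))"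
      by (simp add: sum.distrib)
    also have "\<dots> > 0"
    proof (rule sum_pos)
      fix i assume i: "i \<in> {1..<k}"
      then have "0 < c i" "0 < c (k - i)" "k - (k - i) = i" using less.IH by auto
      moreover have "0 < (real i - real (k - i))\<^sup>2 + 2 * (1 - \<mu>) * real i * real (k - i)"
        using i mu_less by (intro add_nonneg_pos mult_pos_pos) auto
      moreover have "g i + g (k - i) =
        ((real i - real (k - i))\<^sup>2 + 2 * (1 - \<mu>) * real i * real (k - i)) * (c i * c (k - i))"
        unfolding g_def \<open>k - (k - i) = i\<close> by (simp add: power2_eq_square algebra_simps)
      ultimately show "0 < g i + g (k - i)" by simp
    qed (use False in auto)
    finally have "0 < (real k)\<^sup>2 * (real k - 1) * c k"
      using c_rec[of k] False unfolding g_def by simp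
    moreover have "0 < (real k)\<^sup>2 * (real k - 1)" using False by simp
    ultimately show ?thesis by (rule zero_less_mult_pos)
  qed
qed

lemma c_rec_le:
  "(real k)\<^sup>2 * (real k - 1) * c k \<le> (\<Sum>i\<in>{1..<k}. (real (k - i))\<^sup>2 * c i * c (k - i))"
proof (cases "2 \<le> k")
  case True
  then show ?thesis unfolding c_rec[OF True]
  proof (intro sum_mono mult_right_mono)
    fix i
    have "0 \<le> \<mu> * real i * real (k - i)" using mu_pos by simp
    then show "(real (k - i))\<^sup>2 - \<mu> * real i * real (k - i) \<le> (real (k - i))\<^sup>2" by linarith
  qed (use c_pos less_imp_le in auto)
next
  case False
  then have "k = 0 \<or> k = 1" by auto
  then show ?thesis by auto
qed

lemma c_le_sq: "1 \<le> k \<Longrightarrow> c k \<le> (real k)\<^sup>2 * c k"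
  using c_pos[of k] by simp

text \<open>Under the induction hypothesis each of the \<open>k - 1\<close> summands of the
  recursion is at most 1, which matches the factor \<open>k - 1\<close> on the left. Consequently
  the series converges at least for negative arguments.\<close>

lemma sq_c_le: "1 \<le> k \<Longrightarrow> (real k)\<^sup>2 * c k \<le> 1"
proof (induction k rule: less_induct)
  case (less k)
  show ?case
  proof (cases "k = 1")
    case False
    then have k: "2 \<le> k" using less.prems by simp
    have "(real k)\<^sup>2 * (real k - 1) * c k \<le> (\<Sum>i\<in>{1..<k}. (real (k - i))\<^sup>2 * c i * c (k - i))"
      by (rule c_rec_le)
    also have "\<dots> \<le> (\<Sum>i\<in>{1..<k}. 1)"
    proof (rule sum_mono)
      fix i assume i: "i \<in> {1..<k}"
      have "c i \<le> (real i)\<^sup>2 * c i" by (rule c_le_sq) (use i in simp)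
      also have "\<dots> \<le> 1" by (rule less.IH) (use i in auto)
      finally have "((real (k - i))\<^sup>2 * c (k - i)) * c i \<le> 1 * 1"
        using less.IH[of "k - i"] i c_pos[of i] by (intro mult_mono) auto
      then show "(real (k - i))\<^sup>2 * c i * c (k - i) \<le> 1" by (simp add: mult_ac)
    qed
    also have "\<dots> = real k - 1" using k by simp
    finally have "(real k - 1) * ((real k)\<^sup>2 * c k) \<le> (real k - 1) * 1" by (simp add: mult_ac)
    then show ?thesis by (rule mult_left_le_imp_le) (use k in simp)
  qed simp
qed

section \<open>The series and its derivatives on the interval of convergence\<close>

definition T :: "nat \<Rightarrow> real \<Rightarrow> real" where
  "T j x = (\<Sum>k. real k ^ j * c k * exp x ^ k)"

text \<open>Summability is asked at order two because the size of \<open>T 2\<close> is what decides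
  how far the interval can be prolonged.\<close>

definition I :: "real set" where
  "I = {x. summable (\<lambda>k. (real k)\<^sup>2 * c k * exp x ^ k)}"

lemma powser_summable:
  assumes "y \<in> I" "norm z < exp y"
  shows "summable (\<lambda>k. real k ^ j * c k * z ^ k)"
  using assms(2)
proof (induction j arbitrary: z)
  case 0
  have s: "summable (\<lambda>k. (real k)\<^sup>2 * c k * exp y ^ k)" using assms(1) unfolding I_def by simp
  have "summable (\<lambda>k. c k * exp y ^ k)"
  proof (rule summable_comparison_test'[OF s, of 1])
    fix k :: nat assume "1 \<le> k"
    then show "norm (c k * exp y ^ k) \<le> (real k)\<^sup>2 * c k * exp y ^ k"
      using c_le_sq[of k] c_pos[of k] by (simp add: mult_right_mono)
  qed
  then show ?case using powser_inside[of c "exp y" z] 0 by simp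
next
  case (Suc j)
  have "summable (\<lambda>n. diffs (\<lambda>k. real k ^ j * c k) n * z ^ n)"
    by (rule termdiff_converges[OF Suc.prems]) (rule Suc.IH)
  then have "summable (\<lambda>n. z * (diffs (\<lambda>k. real k ^ j * c k) n * z ^ n))"
    by (rule summable_mult)
  moreover have "(\<lambda>n. z * (diffs (\<lambda>k. real k ^ j * c k) n * z ^ n)) =
      (\<lambda>n. real (Suc n) ^ Suc j * c (Suc n) * z ^ Suc n)"
    by (auto simp: diffs_def algebra_simps)
  ultimately show ?case using summable_Suc_iff[of "\<lambda>k. real k ^ Suc j * c k * z ^ k"] by simp
qed

lemma T_summable: "y \<in> I \<Longrightarrow> x < y \<Longrightarrow> summable (\<lambda>k. real k ^ j * c k * exp x ^ k)"
  by (rule powser_summable[of y]) auto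

lemma T_deriv:
  assumes "y \<in> I" "x < y"
  shows "(T j has_real_derivative T (Suc j) x) (at x)"
proof -
  let ?a = "\<lambda>k. real k ^ j * c k"
  have "((\<lambda>z. \<Sum>k. ?a k * z ^ k) has_real_derivative (\<Sum>k. diffs ?a k * exp x ^ k)) (at (exp x))"
    by (rule termdiffs_strong'[of "exp y"]) (use assms powser_summable in auto)
  then have "((\<lambda>x. \<Sum>k. ?a k * exp x ^ k) has_real_derivative (\<Sum>k. diffs ?a k * exp x ^ k) * exp x) (at x)"
    by (rule DERIV_chain2) (rule DERIV_exp)
  moreover have "(\<Sum>k. diffs ?a k * exp x ^ k) * exp x = T (Suc j) x"
  proof -
    have s: "summable (\<lambda>k. diffs ?a k * exp x ^ k)"
      by (rule termdiff_converges[of _ "exp y"]) (use assms powser_summable in auto)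
    have "(\<Sum>k. diffs ?a k * exp x ^ k) * exp x = (\<Sum>k. diffs ?a k * exp x ^ k * exp x)"
      by (rule suminf_mult2[OF s])
    also have "\<dots> = (\<Sum>k. real (Suc k) ^ Suc j * c (Suc k) * exp x ^ Suc k)"
      by (simp add: diffs_def algebra_simps)
    also have "\<dots> = T (Suc j) x"
      using suminf_split_head[OF T_summable[OF assms, of "Suc j"]] unfolding T_def by simp
    finally show ?thesis .
  qed
  ultimately show ?thesis unfolding T_def[abs_def] by simp
qed

lemma I_down: "y \<in> I \<Longrightarrow> x \<le> y \<Longrightarrow> x \<in> I"
  using T_summable[of y x 2] unfolding I_def by (cases "x = y") auto

lemma neg_in_I: "x < 0 \<Longrightarrow> x \<in> I"
  unfolding I_def mem_Collect_eq
proof (rule summable_comparison_test'[of "\<lambda>k. exp x ^ k" 1])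
  fix k :: nat assume "1 \<le> k"
  then show "norm ((real k)\<^sup>2 * c k * exp x ^ k) \<le> exp x ^ k"
    using sq_c_le[of k] c_pos[of k] by (simp add: abs_mult mult_left_le_one_le)
qed (simp add: summable_geometric)

lemma I_interval: "is_interval I"
  unfolding is_interval_1 using I_down by blast

section \<open>Prolonging the interval of convergence; unboundedness of the second
  derivative\<close>

definition H :: "nat \<Rightarrow> real \<Rightarrow> real" where
  "H N x = (\<Sum>k\<le>N. (real k)\<^sup>2 * c k * exp x ^ k)"

lemma H_nonneg: "0 \<le> H N x"
  unfolding H_def using c_pos by (intro sum_nonneg) (simp add: less_imp_le)

lemma H_deriv: "(H N has_real_derivative (\<Sum>k\<le>N. real k ^ 3 * c k * exp x ^ k)) (at x)"
proof -
  have e: "((\<lambda>x. exp x ^ k) has_real_derivative real k * exp x ^ k) (at x)" for k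
  proof -
    have "((\<lambda>x. exp (real k * x)) has_real_derivative real k * exp (real k * x)) (at x)"
      by (auto intro!: derivative_eq_intros)
    then show ?thesis by (simp add: exp_of_nat_mult)
  qed
  show ?thesis unfolding H_def[abs_def]
    by (rule derivative_eq_intros e refl)+
      (simp add: power3_eq_cube power2_eq_square mult_ac)
qed

text \<open>Since \<open>k^3 - k^2 = k^2 (k - 1)\<close>, the recursion turns the difference of the
  two sums into convolutions of the terms of \<open>H\<close>. All terms are nonnegative, so the
  triangle \<open>i + j \<le> N\<close> may be enlarged to a square, and the inequality holds for
  truncated sums without any convergence.\<close>

lemma H_deriv_le: "(\<Sum>k\<le>N. real k ^ 3 * c k * exp x ^ k) \<le> H N x + (H N x)\<^sup>2"
proof -
  define b where "b i = (real i)\<^sup>2 * c i * exp x ^ i" for i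
  have b: "0 \<le> b i" for i unfolding b_def using c_pos[of i] by simp
  have t: "real k ^ 3 * c k * exp x ^ k - b k \<le> (\<Sum>i\<le>k. b i * b (k - i))" for k
  proof -
    have "real k ^ 3 * c k * exp x ^ k - b k = ((real k)\<^sup>2 * (real k - 1) * c k) * exp x ^ k"
      unfolding b_def by (simp add: power2_eq_square power3_eq_cube algebra_simps)
    also have "\<dots> \<le> (\<Sum>i\<in>{1..<k}. (real (k - i))\<^sup>2 * c i * c (k - i)) * exp x ^ k"
      by (intro mult_right_mono c_rec_le) simp
    also have "\<dots> = (\<Sum>i\<in>{1..<k}. c i * exp x ^ i * b (k - i))"
      unfolding sum_distrib_right b_def
    proof (rule sum.cong[OF refl])
      fix i assume "i \<in> {1..<k}"
      then have "exp x ^ k = exp x ^ i * exp x ^ (k - i)" by (simp flip: power_add)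
      then show "(real (k - i))\<^sup>2 * c i * c (k - i) * exp x ^ k =
          c i * exp x ^ i * ((real (k - i))\<^sup>2 * c (k - i) * exp x ^ (k - i))" by simp
    qed
    also have "\<dots> \<le> (\<Sum>i\<in>{1..<k}. b i * b (k - i))"
    proof (rule sum_mono)
      fix i assume "i \<in> {1..<k}"
      then have "c i * exp x ^ i \<le> b i"
        unfolding b_def using c_le_sq[of i] by (intro mult_right_mono) auto
      then show "c i * exp x ^ i * b (k - i) \<le> b i * b (k - i)"
        using b by (rule mult_right_mono)
    qed
    also have "\<dots> \<le> (\<Sum>i\<le>k. b i * b (k - i))"
      by (rule sum_mono2) (use b in auto)
    finally show ?thesis .
  qed
  have "(\<Sum>k\<le>N. real k ^ 3 * c k * exp x ^ k) - H N x =
      (\<Sum>k\<le>N. real k ^ 3 * c k * exp x ^ k - b k)"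
    unfolding H_def b_def by (simp add: sum_subtractf)
  also have "\<dots> \<le> (\<Sum>k\<le>N. \<Sum>i\<le>k. b i * b (k - i))"
    by (rule sum_mono) (rule t)
  also have "\<dots> = (\<Sum>(i, j)\<in>{(i, j). i + j \<le> N}. b i * b j)"
    by (rule sum.triangle_reindex_eq[symmetric])
  also have "\<dots> \<le> (\<Sum>(i, j)\<in>{..N} \<times> {..N}. b i * b j)"
    by (rule sum_mono2) (use b in auto)
  also have "\<dots> = (H N x)\<^sup>2"
    unfolding H_def b_def power2_eq_square sum_product sum.cartesian_product ..
  finally show ?thesis by linarith
qed

text \<open>Since \<open>H' \<le> H + H\<^sup>2\<close>, the function \<open>e\<^sup>-\<^sup>x H / (1 + H)\<close> decreases: a bound on the partial sums
  at \<open>x\<close> persists, uniformly in their length, on an interval whose length depends on the bound only.\<close>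

lemma I_extend:
  assumes x: "x \<in> I" "T 2 x \<le> M" and M: "1 \<le> M"
  shows "x + ln (1 + 1 / (2 * M)) \<in> I"
proof -
  define y where "y = x + ln (1 + 1 / (2 * M))"
  have xy: "x \<le> y" unfolding y_def using M by simp
  have HM: "H N y \<le> 2 * M + 1" for N
  proof -
    define g where "g x = - (exp (- x) * (H N x / (1 + H N x)))" for x
    define g' where "g' x = exp (- x) * (H N x + (H N x)\<^sup>2 - (\<Sum>k\<le>N. real k ^ 3 * c k * exp x ^ k)) / (1 + H N x)\<^sup>2" for x
    have nz: "1 + H N z \<noteq> 0" for z using H_nonneg[of N z] by linarith
    have "(g has_real_derivative g' z) (at z within UNIV)" for z
    proof -
      define D where "D = (\<Sum>k\<le>N. real k ^ 3 * c k * exp z ^ k)"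
      have Hz: "(H N has_real_derivative D) (at z)"
        unfolding D_def by (rule H_deriv)
      define Q where "Q x = H N x / (1 + H N x)" for x
      have "(Q has_real_derivative D / (1 + H N z)\<^sup>2) (at z)"
        unfolding Q_def[abs_def] using Hz nz[of z]
        by (auto intro!: derivative_eq_intros simp: field_simps power2_eq_square)
      then have "((\<lambda>x. - (exp (- x) * Q x)) has_real_derivative exp (- z) * (Q z - D / (1 + H N z)\<^sup>2)) (at z)"
        by (auto intro!: derivative_eq_intros simp: algebra_simps)
      then have "(g has_real_derivative exp (- z) * (H N z / (1 + H N z) - D / (1 + H N z)\<^sup>2)) (at z)"
        unfolding g_def[abs_def] Q_def .
      also have "H N z / (1 + H N z) - D / (1 + H N z)\<^sup>2 = (H N z + (H N z)\<^sup>2 - D) / (1 + H N z)\<^sup>2"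
      proof -
        have "h / w - D / w\<^sup>2 = (h * w - D) / w\<^sup>2" if "w \<noteq> 0" for h w :: real
          using that by (simp add: diff_divide_distrib power2_eq_square)
        from this[OF nz[of z], of "H N z"] show ?thesis by (simp add: algebra_simps power2_eq_square)
      qed
      finally show ?thesis unfolding g'_def D_def by simp
    qed
    moreover have "0 \<le> g' z" for z
      unfolding g'_def using H_deriv_le[of z N] by simp
    ultimately have "g x \<le> g y"
      by (intro deriv_nonneg_mono[of UNIV g g']) (use xy in auto)
    then have "exp (- y) * (H N y / (1 + H N y)) \<le> exp (- x) * (H N x / (1 + H N x))"
      unfolding g_def by simp
    then have "exp y * (exp (- y) * (H N y / (1 + H N y))) \<le> exp y * (exp (- x) * (H N x / (1 + H N x)))"
      by (rule mult_left_mono) simp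
    then have "H N y / (1 + H N y) \<le> exp (y - x) * (H N x / (1 + H N x))"
      by (simp only: mult.assoc[symmetric] mult_exp_exp) simp
    moreover have "H N x / (1 + H N x) \<le> M / (1 + M)"
    proof -
      have "H N x \<le> T 2 x"
        unfolding H_def T_def
        using x(1) c_pos by (intro sum_le_suminf) (auto simp: I_def less_imp_le)
      then have "H N x \<le> M" using x(2) by simp
      then show ?thesis using H_nonneg[of N x] M by (simp add: field_simps)
    qed
    \<comment> \<open>The length of the step is chosen so that the bound on
      \<open>H / (1 + H)\<close> at \<open>y\<close> becomes \<open>(M + 1/2) / (M + 1)\<close>,
      still below 1; solving for \<open>H\<close> gives \<open>2 * M + 1\<close>.\<close>
    moreover have "exp (y - x) = 1 + 1 / (2 * M)"
      unfolding y_def using M by (simp add: add_pos_nonneg)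
    ultimately have "H N y / (1 + H N y) \<le> (1 + 1 / (2 * M)) * (M / (1 + M))"
      using M mult_left_mono[of "H N x / (1 + H N x)" "M / (1 + M)" "1 + 1 / (2 * M)"] by simp
    also have "\<dots> = (1 + 1 / (2 * M)) * M / (1 + M)" by simp
    also have "(1 + 1 / (2 * M)) * M = M + 1 / 2"
      using M by (simp add: field_simps)
    finally have "H N y * (1 + M) \<le> (M + 1 / 2) * (1 + H N y)"
      using H_nonneg[of N y] M by (simp add: pos_divide_le_eq pos_le_divide_eq mult_ac)
    then show ?thesis by (simp add: algebra_simps)
  qed
  have "summable (\<lambda>k. (real k)\<^sup>2 * c k * exp y ^ k)"
  proof (rule summableI_nonneg_bounded)
    show nn: "0 \<le> (real k)\<^sup>2 * c k * exp y ^ k" for k using c_pos[of k] by simp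
    show "(\<Sum>k<n. (real k)\<^sup>2 * c k * exp y ^ k) \<le> 2 * M + 1" for n
      using sum_mono2[of "{..n}" "{..<n}" "\<lambda>k. (real k)\<^sup>2 * c k * exp y ^ k"] nn HM[of n]
      unfolding H_def by fastforce
  qed
  then show ?thesis unfolding I_def y_def by simp
qed

lemma I_open: "x \<in> I \<Longrightarrow> \<exists>y\<in>I. x < y"
  using I_extend[of x "max 1 (T 2 x)"] ln_gt_zero[of "1 + 1 / (2 * max 1 (T 2 x))"]
  by (intro bexI[of _ "x + ln (1 + 1 / (2 * max 1 (T 2 x)))"]) auto

lemma T_summable': "x \<in> I \<Longrightarrow> summable (\<lambda>k. real k ^ j * c k * exp x ^ k)"
  using I_open T_summable by blast

lemma T_mono_le:
  assumes "x \<in> I" "\<And>k. real k ^ i \<le> real k ^ j"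
  shows "T i x \<le> T j x"
  unfolding T_def
  using assms(2) c_pos
  by (intro suminf_le T_summable' assms(1) mult_right_mono) (auto simp: less_imp_le)

lemma T_pos: "x \<in> I \<Longrightarrow> 0 < T j x"
  unfolding T_def
  by (rule suminf_pos2[OF T_summable', of _ _ 1]) (auto simp: c_pos less_imp_le[OF c_pos])

lemma T2_ge: "x \<in> I \<Longrightarrow> exp x \<le> T 2 x"
  using sum_le_suminf[OF T_summable'[of x 2], of "{1}"] c_pos unfolding T_def
  by (auto simp: less_imp_le)

text \<open>A bound on \<open>T 2\<close> would allow prolongation by a fixed length again and
  again, so that \<open>I\<close> would contain arbitrarily large points, where
  \<open>T 2 x \<ge> exp x\<close> breaks the bound. Whether \<open>I\<close> is bounded above never
  has to be decided.\<close>

lemma T2_unbounded: "\<exists>x\<in>I. M < T 2 x"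
proof (rule ccontr)
  assume "\<not> ?thesis"
  then have b: "T 2 x \<le> max 1 M" if "x \<in> I" for x using that by (meson le_max_iff_disj not_less)
  define d where "d = ln (1 + 1 / (2 * max 1 M))"
  have d: "0 < d" unfolding d_def by (rule ln_gt_zero) simp
  have step: "-1 + real n * d \<in> I" for n
  proof (induction n)
    case 0
    then show ?case using neg_in_I by simp
  next
    case (Suc n)
    then have "(-1 + real n * d) + d \<in> I"
      using I_extend[OF Suc b[OF Suc]] unfolding d_def by simp
    then show ?case by (simp add: algebra_simps)
  qed
  obtain n where "ln (max 1 M) + 2 < real n * d" using reals_Archimedean3[OF d] by blast
  then have "ln (max 1 M) < -1 + real n * d" by linarith
  then have "exp (ln (max 1 M)) < exp (-1 + real n * d)" by (simp only: exp_less_cancel_iff)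
  then have "max 1 M < exp (-1 + real n * d)" by simp
  then show False using T2_ge[OF step[of n]] b[OF step[of n]] by linarith
qed

lemma T_ode:
  assumes "x \<in> I"
  shows "T 3 x = T 0 x * T 2 x - \<mu> * (T 1 x)\<^sup>2"
proof -
  define a where "a j k = real k ^ j * c k * exp x ^ k" for j k
  have s: "summable (\<lambda>k. norm (a j k))" for j
    using T_summable'[OF assms, of j] c_pos unfolding a_def by (simp add: abs_mult less_imp_le)
  have 02: "(\<lambda>k. \<Sum>i\<le>k. a 0 i * a 2 (k - i)) sums (T 0 x * T 2 x)"
    using Cauchy_product_sums[OF s s] unfolding T_def a_def .
  have 11: "(\<lambda>k. \<Sum>i\<le>k. a 1 i * a 1 (k - i)) sums (T 1 x * T 1 x)"
    using Cauchy_product_sums[OF s s] unfolding T_def a_def .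
  have "(\<lambda>k. (\<Sum>i\<le>k. a 0 i * a 2 (k - i)) - \<mu> * (\<Sum>i\<le>k. a 1 i * a 1 (k - i))) sums
      (T 0 x * T 2 x - \<mu> * (T 1 x * T 1 x))"
    by (intro sums_diff sums_mult 02 11)
  moreover have "(\<Sum>i\<le>k. a 0 i * a 2 (k - i)) - \<mu> * (\<Sum>i\<le>k. a 1 i * a 1 (k - i)) = a 3 k" for k
  proof -
    define q where "q i = ((real (k - i))\<^sup>2 - \<mu> * real i * real (k - i)) * c i * c (k - i)" for i
    have "(\<Sum>i\<le>k. a 0 i * a 2 (k - i)) - \<mu> * (\<Sum>i\<le>k. a 1 i * a 1 (k - i)) =
        (\<Sum>i\<le>k. q i * exp x ^ k)"
      unfolding sum_distrib_left sum_subtractf[symmetric]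
    proof (rule sum.cong[OF refl])
      fix i assume "i \<in> {..k}"
      then have "exp x ^ k = exp x ^ i * exp x ^ (k - i)" by (simp flip: power_add)
      then show "a 0 i * a 2 (k - i) - \<mu> * (a 1 i * a 1 (k - i)) = q i * exp x ^ k"
        unfolding a_def q_def by (simp add: algebra_simps)
    qed
    also have "\<dots> = (\<Sum>i\<le>k. q i) * exp x ^ k" by (simp add: sum_distrib_right)
    also have "(\<Sum>i\<le>k. q i) = real k ^ 3 * c k"
    proof (cases "2 \<le> k")
      case True
      \<comment> \<open>The term \<open>i = 0\<close> contributes \<open>k^2 c_k\<close> and the
        term \<open>i = k\<close> contributes 0, which completes \<open>k^2 (k - 1) c_k\<close> to
        \<open>k^3 c_k\<close>.\<close>
      have "{..k} = insert 0 (insert k {1..<k})" using True by auto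
      then have "(\<Sum>i\<le>k. q i) = q 0 + (q k + sum q {1..<k})" using True by simp
      also have "sum q {1..<k} = (real k)\<^sup>2 * (real k - 1) * c k"
        unfolding q_def by (rule c_rec[OF True, symmetric])
      finally show ?thesis unfolding q_def by (simp add: power2_eq_square power3_eq_cube algebra_simps)
    next
      case False
      then have "k = 0 \<or> k = 1" by auto
      then show ?thesis unfolding q_def by auto
    qed
    finally show ?thesis unfolding a_def by simp
  qed
  ultimately have "a 3 sums (T 0 x * T 2 x - \<mu> * (T 1 x * T 1 x))" by simp
  then show ?thesis unfolding T_def[of 3] a_def[abs_def] power2_eq_square by (rule sums_unique[symmetric])
qed

abbreviation "F \<equiv> T 0"
abbreviation "FA \<equiv> T 1"
abbreviation "FB \<equiv> T 2"

section \<open>The series as a solution: inequalities and limits\<close>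

lemma F_sol: "sol \<mu> I F FA FB"
  unfolding sol_def
proof (intro ballI conjI)
  fix x assume x: "x \<in> I"
  then obtain y where y: "y \<in> I" "x < y" using I_open by blast
  note d = T_deriv[OF y, THEN has_field_derivative_at_within]
  show "(F has_real_derivative FA x) (at x within I)" using d[of 0] by simp
  show "(FA has_real_derivative FB x) (at x within I)" using d[of 1] by (simp add: numeral_2_eq_2)
  show "(FB has_real_derivative F x * FB x - \<mu> * (FA x)\<^sup>2) (at x within I)"
    using d[of 2] T_ode[OF x] by (simp add: numeral_3_eq_3 numeral_2_eq_2)
qed

lemma FA_le_FB: "x \<in> I \<Longrightarrow> FA x \<le> FB x"
proof (rule T_mono_le)
  show "real k ^ 1 \<le> real k ^ 2" for k by (cases "k = 0") (auto simp: power2_eq_square)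
qed

lemma F_gt_1: "x \<in> I \<Longrightarrow> 1 < F x"
  using sum_le_suminf[OF T_summable'[of x 0], of "{0, 1}"] c_pos unfolding T_def
  by (auto simp: less_imp_le intro: less_le_trans[rotated])

lemma F_le: "x \<in> I \<Longrightarrow> F x \<le> 1 + FA x"
proof -
  assume x: "x \<in> I"
  have "F x = 1 + (\<Sum>k. c (Suc k) * exp x ^ Suc k)"
    using suminf_split_head[OF T_summable'[OF x, of 0]] unfolding T_def by simp
  also have "\<dots> \<le> 1 + (\<Sum>k. real (Suc k) * c (Suc k) * exp x ^ Suc k)"
  proof (intro add_left_mono suminf_le)
    show "summable (\<lambda>k. c (Suc k) * exp x ^ Suc k)"
      using T_summable'[OF x, of 0] summable_Suc_iff[of "\<lambda>k. c k * exp x ^ k"] by simp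
    show "summable (\<lambda>k. real (Suc k) * c (Suc k) * exp x ^ Suc k)"
      using T_summable'[OF x, of 1] summable_Suc_iff[of "\<lambda>k. real k * c k * exp x ^ k"] by simp
    fix k show "c (Suc k) * exp x ^ Suc k \<le> real (Suc k) * c (Suc k) * exp x ^ Suc k"
      using c_pos[of "Suc k"] by (intro mult_right_mono) auto
  qed
  also have "(\<Sum>k. real (Suc k) * c (Suc k) * exp x ^ Suc k) = FA x"
    using suminf_split_head[OF T_summable'[OF x, of 1]] unfolding T_def by simp
  finally show ?thesis .
qed

text \<open>Cauchy-Schwarz for the weights \<open>c k * exp x ^ k\<close>: with \<open>l\<close> the
  weighted mean of \<open>k\<close>, the sum of \<open>(k - l)^2\<close> times the weights is
  nonnegative.\<close>

lemma FA_sq_le: "x \<in> I \<Longrightarrow> (FA x)\<^sup>2 \<le> F x * FB x"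
proof -
  assume x: "x \<in> I"
  define l where "l = FA x / F x"
  have Fp: "0 < F x" using T_pos[OF x] .
  have s: "(\<lambda>k. real k ^ j * c k * exp x ^ k) sums T j x" for j
    unfolding T_def by (rule summable_sums[OF T_summable'[OF x]])
  have q: "(\<lambda>k. real k ^ 2 * c k * exp x ^ k - 2 * l * (real k ^ 1 * c k * exp x ^ k)
      + l\<^sup>2 * (real k ^ 0 * c k * exp x ^ k)) sums (FB x - 2 * l * FA x + l\<^sup>2 * F x)"
    by (intro sums_add sums_diff sums_mult s)
  have nn: "0 \<le> real k ^ 2 * c k * exp x ^ k - 2 * l * (real k ^ 1 * c k * exp x ^ k)
      + l\<^sup>2 * (real k ^ 0 * c k * exp x ^ k)" for k
  proof -
    have "0 \<le> (real k - l)\<^sup>2 * (c k * exp x ^ k)" using c_pos[of k] by simp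
    then show ?thesis by (simp add: power2_eq_square algebra_simps)
  qed
  have "0 \<le> FB x - 2 * l * FA x + l\<^sup>2 * F x"
    by (rule sums_le[OF nn sums_zero q])
  then have "0 \<le> F x * (FB x - 2 * l * FA x + l\<^sup>2 * F x)"
    using Fp by simp
  also have "\<dots> = F x * FB x - (FA x)\<^sup>2"
    unfolding l_def using Fp by (simp add: field_simps power2_eq_square)
  finally show ?thesis by simp
qed

text \<open>The factor \<open>k^2\<close> removes the constant term, and every other term gains at
  least one factor \<open>exp (x - y)\<close>.\<close>

lemma FB_le_exp:
  assumes "x \<le> y" "y \<in> I"
  shows "FB x \<le> exp (x - y) * FB y"
proof -
  have x: "x \<in> I" using I_down[OF assms(2,1)] .
  have "FB x \<le> (\<Sum>k. exp (x - y) * ((real k)\<^sup>2 * c k * exp y ^ k))"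
    unfolding T_def
  proof (intro suminf_le T_summable' x summable_mult assms(2))
    fix k
    show "(real k)\<^sup>2 * c k * exp x ^ k \<le> exp (x - y) * ((real k)\<^sup>2 * c k * exp y ^ k)"
    proof (cases k)
      case (Suc n)
      have "exp x ^ k = exp (x - y) ^ k * exp y ^ k"
        by (simp add: power_mult_distrib[symmetric] exp_diff)
      also have "\<dots> \<le> exp (x - y) * exp y ^ k"
        using assms(1) Suc by (intro mult_right_mono) (auto simp: mult_left_le power_le_one)
      finally have "(real k)\<^sup>2 * c k * exp x ^ k \<le> (real k)\<^sup>2 * c k * (exp (x - y) * exp y ^ k)"
        using c_pos[of k] by (intro mult_left_mono) auto
      then show ?thesis by (simp add: mult_ac)
    qed simp
  qed
  also have "\<dots> = exp (x - y) * FB y"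
    unfolding T_def by (rule suminf_mult[OF T_summable'[OF assms(2)]])
  finally show ?thesis .
qed

lemma eventually_in_I: "eventually (\<lambda>x. x \<in> I) at_bot"
  using eventually_gt_at_bot eventually_le_at_bot[of "-1"] by eventually_elim (rule neg_in_I, simp)

lemma FB_lim: "(FB \<longlongrightarrow> 0) at_bot"
proof (rule tendsto_sandwich[where f = "\<lambda>_. 0"])
  have n: "-1 \<in> I" by (rule neg_in_I) simp
  show "\<forall>\<^sub>F x in at_bot. 0 \<le> FB x"
    using eventually_in_I by eventually_elim (simp add: T_pos less_imp_le)
  show "\<forall>\<^sub>F x in at_bot. FB x \<le> exp (x - -1) * FB (-1)"
    using eventually_le_at_bot[of "-1"] by eventually_elim (rule FB_le_exp[OF _ n])
  have "((\<lambda>x::real. exp x) \<longlongrightarrow> 0) at_bot" by (rule exp_at_bot)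
  then have "((\<lambda>x::real. exp x * (exp 1 * FB (-1))) \<longlongrightarrow> 0) at_bot"
    by (rule tendsto_mult_left_zero)
  then show "((\<lambda>x. exp (x - -1) * FB (-1)) \<longlongrightarrow> 0) at_bot"
    by (simp add: exp_add mult_ac)
qed simp

lemma FA_lim: "(FA \<longlongrightarrow> 0) at_bot"
proof (rule tendsto_sandwich[OF _ _ tendsto_const FB_lim])
  show "\<forall>\<^sub>F x in at_bot. 0 \<le> FA x"
    using eventually_in_I by eventually_elim (simp add: T_pos less_imp_le)
  show "\<forall>\<^sub>F x in at_bot. FA x \<le> FB x"
    using eventually_in_I by eventually_elim (rule FA_le_FB)
qed

lemma F_lim: "(F \<longlongrightarrow> 1) at_bot"
proof (rule tendsto_sandwich[where f = "\<lambda>_. 1" and h = "\<lambda>x. 1 + FA x"])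
  show "\<forall>\<^sub>F x in at_bot. 1 \<le> F x"
    using eventually_in_I by eventually_elim (simp add: F_gt_1 less_imp_le)
  show "\<forall>\<^sub>F x in at_bot. F x \<le> 1 + FA x"
    using eventually_in_I by eventually_elim (rule F_le)
  show "((\<lambda>x. 1 + FA x) \<longlongrightarrow> 1) at_bot"
    using tendsto_add[OF tendsto_const FA_lim, of 1] by simp
qed simp

lemma F_strict_mono: "x \<in> I \<Longrightarrow> y \<in> I \<Longrightarrow> x < y \<Longrightarrow> F x < F y"
proof (rule deriv_pos_strict_mono[OF solD(1)[OF F_sol]])
  assume xy: "x \<in> I" "y \<in> I" "x < y"
  show "{x..y} \<subseteq> I" using I_down[OF xy(2)] by auto
  show "0 < FA z" if "x < z" "z < y" for z
    using I_down[OF xy(2)] that by (intro T_pos) auto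
qed auto

lemma FB_mono:
  assumes "x \<in> I" "y \<in> I" "x \<le> y"
  shows "FB x \<le> FB y"
proof -
  have "FB x \<le> exp (x - y) * FB y" by (rule FB_le_exp[OF assms(3,2)])
  also have "\<dots> \<le> 1 * FB y"
    using assms(3) T_pos[OF assms(2)] by (intro mult_right_mono) (auto simp: less_imp_le)
  finally show ?thesis by simp
qed

end

declare One_nat_def [simp del]

section \<open>Orbits and the arc of the series solution\<close>

lemma less_left:
  fixes g :: "real \<Rightarrow> real"
  assumes "(g has_real_derivative l) (at x within S)" "0 < l"
  obtains d where "0 < d" "\<And>y. y \<in> S \<Longrightarrow> x - d < y \<Longrightarrow> y < x \<Longrightarrow> g y < g x"
proof -
  obtain d where "0 < d \<and> (\<forall>h>0. x - h \<in> S \<longrightarrow> h < d \<longrightarrow> g (x - h) < g x)"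
    using has_real_derivative_pos_inc_left[OF assms] by (elim exE)
  then have d: "0 < d" "\<And>h. 0 < h \<Longrightarrow> x - h \<in> S \<Longrightarrow> h < d \<Longrightarrow> g (x - h) < g x"
    by simp_all
  show ?thesis
  proof (rule that[OF d(1)])
    fix y assume "y \<in> S" "x - d < y" "y < x"
    then show "g y < g x" using d(2)[of "x - y"] by simp
  qed
qed

lemma greater_right:
  fixes g :: "real \<Rightarrow> real"
  assumes "(g has_real_derivative l) (at x within S)" "0 < l"
  obtains d where "0 < d" "\<And>y. y \<in> S \<Longrightarrow> x < y \<Longrightarrow> y < x + d \<Longrightarrow> g x < g y"
proof -
  obtain d where "0 < d \<and> (\<forall>h>0. x + h \<in> S \<longrightarrow> h < d \<longrightarrow> g x < g (x + h))"
    using has_real_derivative_pos_inc_right[OF assms] by (elim exE)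
  then have d: "0 < d" "\<And>h. 0 < h \<Longrightarrow> x + h \<in> S \<Longrightarrow> h < d \<Longrightarrow> g x < g (x + h)"
    by simp_all
  show ?thesis
  proof (rule that[OF d(1)])
    fix y assume "y \<in> S" "x < y" "y < x + d"
    then show "g x < g y" using d(2)[of "y - x"] by simp
  qed
qed

lemma greater_left:
  fixes g :: "real \<Rightarrow> real"
  assumes "(g has_real_derivative l) (at x within S)" "l < 0"
  obtains d where "0 < d" "\<And>y. y \<in> S \<Longrightarrow> x - d < y \<Longrightarrow> y < x \<Longrightarrow> g x < g y"
proof (rule less_left[OF DERIV_minus[OF assms(1)]])
  show "0 < - l" using assms(2) by simp
  fix d assume "0 < d" "\<And>y. y \<in> S \<Longrightarrow> x - d < y \<Longrightarrow> y < x \<Longrightarrow> - g y < - g x"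
  then show ?thesis by (intro that[of d]) simp_all
qed

lemma less_right:
  fixes g :: "real \<Rightarrow> real"
  assumes "(g has_real_derivative l) (at x within S)" "l < 0"
  obtains d where "0 < d" "\<And>y. y \<in> S \<Longrightarrow> x < y \<Longrightarrow> y < x + d \<Longrightarrow> g y < g x"
proof (rule greater_right[OF DERIV_minus[OF assms(1)]])
  show "0 < - l" using assms(2) by simp
  fix d assume "0 < d" "\<And>y. y \<in> S \<Longrightarrow> x < y \<Longrightarrow> y < x + d \<Longrightarrow> - g x < - g y"
  then show ?thesis by (intro that[of d]) simp_all
qed

lemma at_bot_le:
  fixes g :: "real \<Rightarrow> real"
  assumes "(g \<longlongrightarrow> L) at_bot" "\<And>y. y \<le> x \<Longrightarrow> g y \<le> g x"
  shows "L \<le> g x"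
proof (rule tendsto_upperbound[OF assms(1)])
  show "\<forall>\<^sub>F y in at_bot. g y \<le> g x"
    using eventually_le_at_bot[of x] by eventually_elim (rule assms(2))
qed simp

lemma deriv_at_bot_le:
  fixes g g' :: "real \<Rightarrow> real"
  assumes "(g \<longlongrightarrow> L) at_bot"
    and "\<And>y. y \<in> S \<Longrightarrow> (g has_real_derivative g' y) (at y within S)"
    and "{..x} \<subseteq> S" and "\<And>y. y < x \<Longrightarrow> 0 \<le> g' y"
  shows "L \<le> g x"
proof (rule at_bot_le[OF assms(1)])
  fix y assume "y \<le> x"
  then show "g y \<le> g x"
    by (intro deriv_nonneg_mono[OF assms(2)]) (use assms(3,4) in auto)
qed

lemma deriv_at_bot_less:
  fixes g g' :: "real \<Rightarrow> real"
  assumes "(g \<longlongrightarrow> L) at_bot"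
    and "\<And>y. y \<in> S \<Longrightarrow> (g has_real_derivative g' y) (at y within S)"
    and "{..x} \<subseteq> S" and "\<And>y. y < x \<Longrightarrow> 0 < g' y"
  shows "L < g x"
proof -
  have "L \<le> g (x - 1)"
    by (rule deriv_at_bot_le[OF assms(1,2)]) (use assms(3,4) in \<open>auto intro: less_imp_le\<close>)
  also have "g (x - 1) < g x"
    by (rule deriv_pos_strict_mono[OF assms(2)]) (use assms(3,4) in auto)
  finally show ?thesis .
qed

lemma affine_at_bot: "0 < k \<Longrightarrow> LIM z at_bot. k * z + e :> at_bot" for k e :: real
  by real_asymp

lemma rho_less:
  assumes "sol \<mu> S Y A B" "{a..b} \<subseteq> S" "a < b"
    and "\<And>x. x \<in> S \<Longrightarrow> 0 < Y x" "\<And>x. x \<in> S \<Longrightarrow> 0 < A x"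
    and "\<And>x. a < x \<Longrightarrow> x < b \<Longrightarrow> 0 < dlt Y A B x"
  shows "rho Y A a < rho Y A b"
proof (rule deriv_pos_strict_mono[OF _ assms(2) _ assms(3)])
  fix x assume "x \<in> S"
  then show "(rho Y A has_real_derivative Y x * rho Y A x * dlt Y A B x) (at x within S)"
    by (rule rho_deriv[OF assms(1)]) (use assms(4,5)[OF \<open>x \<in> S\<close>] in auto)
next
  fix x assume x: "a < x" "x < b"
  then have "x \<in> S" using assms(2) by auto
  then show "0 < Y x * rho Y A x * dlt Y A B x"
    using assms(4,5)[OF \<open>x \<in> S\<close>] assms(6)[OF x] by (simp add: rho_def)
qed

lemma rho_greater:
  assumes "sol \<mu> S Y A B" "{a..b} \<subseteq> S" "a < b"
    and "\<And>x. x \<in> S \<Longrightarrow> 0 < Y x" "\<And>x. x \<in> S \<Longrightarrow> 0 < A x"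
    and "\<And>x. a < x \<Longrightarrow> x < b \<Longrightarrow> dlt Y A B x < 0"
  shows "rho Y A b < rho Y A a"
proof -
  have "- rho Y A a < - rho Y A b"
  proof (rule deriv_pos_strict_mono[where g = "\<lambda>x. - rho Y A x", OF _ assms(2) _ assms(3)])
    fix x assume "x \<in> S"
    then show "((\<lambda>x. - rho Y A x) has_real_derivative - (Y x * rho Y A x * dlt Y A B x)) (at x within S)"
      by (intro DERIV_minus rho_deriv[OF assms(1)]) (use assms(4,5)[OF \<open>x \<in> S\<close>] in auto)
  next
    fix x assume x: "a < x" "x < b"
    then have "x \<in> S" using assms(2) by auto
    then have "0 < Y x * rho Y A x"
      using assms(4,5)[OF \<open>x \<in> S\<close>] by (simp add: rho_def)
    then show "0 < - (Y x * rho Y A x * dlt Y A B x)"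
      using mult_pos_neg[OF _ assms(6)[OF x]] by fastforce
  qed
  then show ?thesis by simp
qed

lemma rho_chi_continuous:
  assumes "sol \<mu> S Y A B" "\<And>x. x \<in> S \<Longrightarrow> 0 < Y x" "\<And>x. x \<in> S \<Longrightarrow> 0 < A x"
  shows "continuous_on S (rho Y A)" "continuous_on S (chi Y A B)" "continuous_on S (dlt Y A B)"
proof -
  show r: "continuous_on S (rho Y A)"
    unfolding rho_def[abs_def]
    by (intro continuous_intros sol_continuous[OF assms(1)]) (use assms(2) in force)
  show c: "continuous_on S (chi Y A B)"
    unfolding chi_def[abs_def]
    by (intro continuous_intros sol_continuous[OF assms(1)]) (use assms(2,3) in force)
  show "continuous_on S (dlt Y A B)"
    unfolding dlt_def[abs_def] by (intro continuous_intros r c)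
qed

section \<open>Turning points of \<open>rho\<close>, and why the series orbit keeps turning\<close>

context exponent
begin

lemma dlt_deriv_zero:
  assumes "sol \<mu> S Y A B" "x \<in> S" "0 < Y x" "0 < A x" "dlt Y A B x = 0"
  shows "(dlt Y A B has_real_derivative 6 * Y x * rho Y A x * (rs - rho Y A x)) (at x within S)"
  using dlt_deriv[OF assms(1,2)] assms(3-5) unfolding rs_def by (simp add: mult_ac)

text \<open>At a zero of \<open>dlt\<close> only the restoring force is left in its derivative.
  Hence \<open>rho\<close> can turn only at a minimum below \<open>rs\<close>, and in
  \<open>dlt_zero_high\<close> only at a maximum above it.\<close>

lemma dlt_zero_low:
  assumes "sol \<mu> S Y A B" "x \<in> S" "0 < Y x" "0 < A x" "dlt Y A B x = 0" "rho Y A x < rs"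
  obtains d where "0 < d"
    "\<And>y. y \<in> S \<Longrightarrow> x - d < y \<Longrightarrow> y < x \<Longrightarrow> dlt Y A B y < 0"
    "\<And>y. y \<in> S \<Longrightarrow> x < y \<Longrightarrow> y < x + d \<Longrightarrow> 0 < dlt Y A B y"
proof -
  have "0 < 6 * Y x * rho Y A x * (rs - rho Y A x)"
    using assms by (simp add: rho_def)
  note d = dlt_deriv_zero[OF assms(1-5)] this
  obtain d1 where d1: "0 < d1" "\<And>y. y \<in> S \<Longrightarrow> x - d1 < y \<Longrightarrow> y < x \<Longrightarrow> dlt Y A B y < dlt Y A B x"
    using less_left[OF d] by blast
  obtain d2 where d2: "0 < d2" "\<And>y. y \<in> S \<Longrightarrow> x < y \<Longrightarrow> y < x + d2 \<Longrightarrow> dlt Y A B x < dlt Y A B y"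
    using greater_right[OF d] by blast
  show ?thesis
    by (rule that[of "min d1 d2"]) (use d1 d2 assms(5) in auto)
qed

lemma dlt_zero_high:
  assumes "sol \<mu> S Y A B" "x \<in> S" "0 < Y x" "0 < A x" "dlt Y A B x = 0" "rs < rho Y A x"
  obtains d where "0 < d"
    "\<And>y. y \<in> S \<Longrightarrow> x - d < y \<Longrightarrow> y < x \<Longrightarrow> 0 < dlt Y A B y"
    "\<And>y. y \<in> S \<Longrightarrow> x < y \<Longrightarrow> y < x + d \<Longrightarrow> dlt Y A B y < 0"
proof -
  have "0 < 6 * Y x * rho Y A x"
    using assms by (simp add: rho_def)
  then have "6 * Y x * rho Y A x * (rs - rho Y A x) < 0"
    by (rule mult_pos_neg) (use assms(6) in simp)
  note d = dlt_deriv_zero[OF assms(1-5)] this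
  obtain d1 where d1: "0 < d1" "\<And>y. y \<in> S \<Longrightarrow> x - d1 < y \<Longrightarrow> y < x \<Longrightarrow> dlt Y A B x < dlt Y A B y"
    using greater_left[OF d] by blast
  obtain d2 where d2: "0 < d2" "\<And>y. y \<in> S \<Longrightarrow> x < y \<Longrightarrow> y < x + d2 \<Longrightarrow> dlt Y A B y < dlt Y A B x"
    using less_right[OF d] by blast
  show ?thesis
    by (rule that[of "min d1 d2"]) (use d1 d2 assms(5) in auto)
qed

abbreviation "R \<equiv> rho F FA"
abbreviation "X \<equiv> chi F FA FB"
abbreviation "dl \<equiv> dlt F FA FB"

lemma FYA_pos: "x \<in> I \<Longrightarrow> 0 < F x" "x \<in> I \<Longrightarrow> 0 < FA x" "x \<in> I \<Longrightarrow> 0 < FB x"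
  by (rule T_pos, assumption)+

lemma RX_continuous: "continuous_on I R" "continuous_on I X" "continuous_on I dl"
  using rho_chi_continuous[OF F_sol] FYA_pos by auto

lemma I_Icc: "b \<in> I \<Longrightarrow> {a..b} \<subseteq> I" and I_Iic: "b \<in> I \<Longrightarrow> {..b} \<subseteq> I"
  using I_down by auto

lemma R_pos: "x \<in> I \<Longrightarrow> 0 < R x"
  using FYA_pos[of x] unfolding rho_def by simp

lemma X_pos: "x \<in> I \<Longrightarrow> 0 < X x"
  using FYA_pos[of x] unfolding chi_def by simp

lemma R_lim: "(R \<longlongrightarrow> 0) at_bot"
proof -
  have "(R \<longlongrightarrow> 0 / 1\<^sup>2) at_bot"
    unfolding rho_def[abs_def] by (intro tendsto_intros FA_lim F_lim) simp
  then show ?thesis by simp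
qed

lemma R_le_X: "x \<in> I \<Longrightarrow> R x \<le> X x"
  using FYA_pos[of x] FA_sq_le[of x] unfolding rho_def chi_def
  by (simp add: field_simps power2_eq_square)

text \<open>\<open>Z\<close> vanishes at -\<infinity> and its derivative collapses to two positive
  terms. With \<open>X < 1\<close> alone a rising point would only satisfy \<open>R < 1/2\<close>;
  the extra \<open>R / 2\<close> brings the bound down to 2/5, the upper end of the range used in
  \<open>not_one_sided\<close>.\<close>

lemma X_less:
  assumes "x \<in> I"
  shows "X x < 1 - R x / 2"
proof -
  define Z where "Z x = FA x - FB x / F x - (FA x)\<^sup>2 / (2 * (F x)\<^sup>2)" for x
  have "((\<lambda>x. FA x - FB x / F x - (FA x)\<^sup>2 / (2 * (F x)\<^sup>2)) \<longlongrightarrow> 0 - 0 / 1 - 0\<^sup>2 / (2 * 1\<^sup>2)) at_bot"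
    by (intro tendsto_intros FA_lim FB_lim F_lim) auto
  then have lim: "(Z \<longlongrightarrow> 0) at_bot" unfolding Z_def by simp
  have d: "(Z has_real_derivative \<mu> * (FA y)\<^sup>2 / F y + FA y ^ 3 / F y ^ 3) (at y within I)" if y: "y \<in> I" for y
    unfolding Z_def
    using solD[OF F_sol y] FYA_pos[OF y]
    by (auto intro!: derivative_eq_intros simp: field_simps power2_eq_square power3_eq_cube)
  have "0 < Z x"
  proof (rule deriv_at_bot_less[OF lim d I_Iic[OF assms]])
    fix y assume "y < x"
    then have "y \<in> I" using I_down[OF assms, of y] by simp
    then show "0 < \<mu> * (FA y)\<^sup>2 / F y + FA y ^ 3 / F y ^ 3"
      using FYA_pos[of y] mu_pos by (intro add_pos_pos divide_pos_pos mult_pos_pos) auto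
  qed
  moreover have "Z x = FA x * (1 - R x / 2 - X x)"
    unfolding Z_def rho_def chi_def using FYA_pos[OF assms]
    by (simp add: field_simps power2_eq_square)
  ultimately show ?thesis using FYA_pos[OF assms] by (simp add: zero_less_mult_iff)
qed

lemma R_less_of_rising: "x \<in> I \<Longrightarrow> 0 \<le> dl x \<Longrightarrow> R x < 2 / 5"
  using X_less[of x] unfolding dlt_def by linarith

lemma upper_orbit:
  assumes "x \<in> I"
  shows "orbit \<mu> (I \<inter> {x..}) F FA FB"
proof
  show "sol \<mu> (I \<inter> {x..}) F FA FB" by (rule sol_subset[OF F_sol]) simp
  show "is_interval (I \<inter> {x..})" by (intro is_interval_Int I_interval is_interval_ci)
  fix K
  obtain y where y: "y \<in> I" "max (K * FB x) (FB x) < FB y" using T2_unbounded by blast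
  then have "x < y" using FB_mono[OF y(1) assms] by (cases "x < y") auto
  then show "\<exists>z\<in>I \<inter> {x..}. \<exists>y\<in>I \<inter> {x..}. z \<le> y \<and> K * FB z < FB y"
    using y assms by (intro bexI[of _ x] bexI[of _ y]) auto
qed (use FYA_pos in auto)

text \<open>An increasing \<open>R\<close> eventually stays above \<open>rs\<close> by a margin, or
  lies between 1/7 and \<open>rs\<close>, or never exceeds 1/7. The energy excludes the outer cases
  and the angle the middle one.\<close>

lemma not_always_rising:
  assumes x0: "x0 \<in> I" and dl: "\<And>x. x \<in> I \<Longrightarrow> x0 \<le> x \<Longrightarrow> 0 < dl x"
  shows False
proof -
  have X1: "X x < 1" if "x \<in> I" for x using X_less[OF that] R_pos[OF that] by linarith
  have inc: "R x < R y" if "x \<in> I" "y \<in> I" "x0 \<le> x" "x < y" for x y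
    by (rule rho_less[OF F_sol I_Icc[OF that(2)] that(4)])
      (use FYA_pos dl I_down[OF that(2)] that in auto)
  have inc': "R x \<le> R y" if "x \<in> I" "y \<in> I" "x0 \<le> x" "x \<le> y" for x y
    using inc[of x y] that by (cases "x = y") auto
  have up: "R x \<le> 2 / 5" if "x \<in> I" "x0 \<le> x" for x
    using R_less_of_rising[OF that(1)] dl[OF that] by simp
  consider (hi) x' where "x' \<in> I" "x0 \<le> x'" "rs < R x'"
    | (mid) x' where "x' \<in> I" "x0 \<le> x'" "1 / 7 \<le> R x'" "\<And>x. x \<in> I \<Longrightarrow> x0 \<le> x \<Longrightarrow> R x \<le> rs"
    | (lo) "\<And>x. x \<in> I \<Longrightarrow> x0 \<le> x \<Longrightarrow> R x \<le> 1 / 7"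
    by (meson not_less less_imp_le)
  then show False
  proof cases
    case hi
    interpret o: orbit \<mu> "I \<inter> {x'..}" F FA FB by (rule upper_orbit[OF hi(1)])
    show False
      by (rule o.not_above[of "2 / 5" "R x' - rs"]) (use hi up X1 inc'[of x'] in auto)
  next
    case mid
    interpret o: orbit \<mu> "I \<inter> {x'..}" F FA FB by (rule upper_orbit[OF mid(1)])
    have ne: "R x < rs" if x: "x \<in> I" "x0 \<le> x" for x
    proof -
      obtain y where "y \<in> I" "x < y" using I_open[OF x(1)] by blast
      then show ?thesis using inc[of x y] mid(4)[of y] x by auto
    qed
    have "1 / 7 \<le> R x" if "x \<in> I" "x' \<le> x" for x
      using inc'[of x' x] mid that by linarith
    then show False
      by (intro o.not_one_sided) (use mid(2) up in \<open>auto dest!: ne\<close>)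
  next
    case lo
    interpret o: orbit \<mu> "I \<inter> {x0..}" F FA FB by (rule upper_orbit[OF x0])
    show False
    proof (rule o.not_below[of "2 / 5" "min (R x0) (1 / 42)"])
      fix x assume x: "x \<in> I \<inter> {x0..}"
      \<comment> \<open>1/42 is the gap between 1/7 and the lower bound 1/6 of
        \<open>rs\<close>.\<close>
      show "R x \<le> rs - min (R x0) (1 / 42)" using lo[of x] x rs_bounds by auto
      show "min (R x0) (1 / 42) \<le> R x" using inc'[of x0 x] x x0 by auto
    qed (use up X1 R_pos[OF x0] in auto)
  qed
qed

text \<open>Besides the cases of a monotone \<open>R\<close> bounded away from 0 there is the
  approach to the origin. There \<open>R \<le> X\<close>, which is Cauchy-Schwarz, together with the
  falling of \<open>R\<close> confines \<open>X / R\<close> to the interval from 1 to 2, as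
  \<open>not_near_origin\<close> requires.\<close>

lemma not_always_falling:
  assumes x0: "x0 \<in> I" "R x0 \<le> 2 / 5" and dl: "\<And>x. x \<in> I \<Longrightarrow> x0 \<le> x \<Longrightarrow> dl x < 0"
  shows False
proof -
  have X1: "X x < 1" if "x \<in> I" for x using X_less[OF that] R_pos[OF that] by linarith
  have dec: "R y < R x" if "x \<in> I" "y \<in> I" "x0 \<le> x" "x < y" for x y
    by (rule rho_greater[OF F_sol I_Icc[OF that(2)] that(4)])
      (use FYA_pos dl I_down[OF that(2)] that in auto)
  have dec': "R y \<le> R x" if "x \<in> I" "y \<in> I" "x0 \<le> x" "x \<le> y" for x y
    using dec[of x y] that by (cases "x = y") auto
  have up: "R x \<le> 2 / 5" if "x \<in> I" "x0 \<le> x" for x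
    using dec'[OF x0(1) that(1) order_refl that(2)] x0(2) by simp
  consider (lo) x' where "x' \<in> I" "x0 \<le> x'" "R x' < (1 - \<mu>) / 4"
    | (mid) x' where "x' \<in> I" "x0 \<le> x'" "R x' < rs" "\<And>x. x \<in> I \<Longrightarrow> x0 \<le> x \<Longrightarrow> (1 - \<mu>) / 4 \<le> R x"
    | (hi) "\<And>x. x \<in> I \<Longrightarrow> x0 \<le> x \<Longrightarrow> rs \<le> R x"
    by (meson not_less)
  then show False
  proof cases
    case lo
    interpret o: orbit \<mu> "I \<inter> {x'..}" F FA FB by (rule upper_orbit[OF lo(1)])
    have "R x \<le> (1 - \<mu>) / 4" if "x \<in> I" "x' \<le> x" for x
      using dec'[of x' x] lo that by linarith
    moreover have "dl x \<le> 0" if "x \<in> I" "x' \<le> x" for x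
      using dl[OF that(1)] that lo(2) by simp
    ultimately show False
      by (intro o.not_near_origin) (use R_le_X in auto)
  next
    case mid
    interpret o: orbit \<mu> "I \<inter> {x'..}" F FA FB by (rule upper_orbit[OF mid(1)])
    show False
    proof (rule o.not_below[of "2 / 5" "min ((1 - \<mu>) / 4) (rs - R x')"])
      fix x assume x: "x \<in> I \<inter> {x'..}"
      then show "R x \<le> 2 / 5" "X x < 1" using up X1 mid(2) by auto
      show "min ((1 - \<mu>) / 4) (rs - R x') \<le> R x" using mid(4)[of x] mid(2) x by (simp add: min.coboundedI1)
      show "R x \<le> rs - min ((1 - \<mu>) / 4) (rs - R x')" using dec'[of x' x] x mid(1,2) by auto
    qed (use mu_less mid(3) in auto)
  next
    case hi
    interpret o: orbit \<mu> "I \<inter> {x0..}" F FA FB by (rule upper_orbit[OF x0(1)])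
    have ne: "rs < R x" if x: "x \<in> I" "x0 \<le> x" for x
    proof -
      obtain y where "y \<in> I" "x < y" using I_open[OF x(1)] by blast
      then show ?thesis using dec[of x y] hi[of y] x by auto
    qed
    have "1 / 7 \<le> R x" if "x \<in> I" "x0 \<le> x" for x
      using ne[OF that] rs_bounds by linarith
    then show False
      by (intro o.not_one_sided) (use up in \<open>auto dest!: ne\<close>)
  qed
qed

text \<open>An orbit meeting that of \<open>F\<close> is a rescaled piece of it, and its limit at \<open>-\<infinity>\<close> is the scaling factor.\<close>

lemma meets_F:
  assumes s: "sol \<mu> {..t} Y A B" and pos: "0 < Y t" "0 < A t" and x: "x \<in> I"
    and eq: "rho Y A t = R x" "chi Y A B t = X x"
  shows "(Y \<longlongrightarrow> Y t / F x) at_bot"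
proof -
  define k where "k = Y t / F x"
  have k: "0 < k" unfolding k_def using pos FYA_pos[OF x] by simp
  define e where "e = x - k * t"
  have "sol \<mu> {..t} (\<lambda>z. k * F (k * z + e)) (\<lambda>z. k\<^sup>2 * FA (k * z + e)) (\<lambda>z. k ^ 3 * FB (k * z + e))"
  proof (rule sol_scale[OF F_sol])
    fix z assume "z \<in> {..t}"
    then have "k * z \<le> k * t" using k by simp
    then have "k * z + e \<le> x" unfolding e_def by simp
    then show "k * z + e \<in> I" by (rule I_down[OF x])
  qed
  moreover have xe: "k * t + e = x" unfolding e_def by simp
  have Yt: "Y t = k * F x" unfolding k_def using FYA_pos[OF x] by simp
  have At: "A t = k\<^sup>2 * FA x"
    using eq(1) pos FYA_pos[OF x] unfolding rho_def Yt by (simp add: field_simps k[THEN less_imp_neq, symmetric])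
  have Bt: "B t = k ^ 3 * FB x"
  proof -
    have "B t = chi Y A B t * (A t * Y t)" unfolding chi_def using pos by simp
    also have "\<dots> = X x * (k\<^sup>2 * FA x * (k * F x))" using eq(2) At Yt by simp
    also have "\<dots> = k ^ 3 * FB x"
      unfolding chi_def using FYA_pos[OF x] by (simp add: power2_eq_square power3_eq_cube)
    finally show ?thesis .
  qed
  ultimately have "Y z = k * F (k * z + e)" if "z \<le> t" for z
    using sol_unique(1)[OF s, of _ _ _ t z] that Yt At Bt xe by (simp add: is_interval_ic)
  then have "\<forall>\<^sub>F z in at_bot. k * F (k * z + e) = Y z"
    by (intro eventually_mono[OF eventually_le_at_bot[of t]]) simp
  moreover have "LIM z at_bot. k * z + e :> at_bot"
    by (rule affine_at_bot[OF k])
  then have "((\<lambda>z. F (k * z + e)) \<longlongrightarrow> 1) at_bot"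
    by (rule filterlim_compose[OF F_lim])
  then have "((\<lambda>z. k * F (k * z + e)) \<longlongrightarrow> k) at_bot"
    using tendsto_mult_left[of "\<lambda>z. F (k * z + e)" 1 at_bot k] by simp
  ultimately show ?thesis
    unfolding k_def[symmetric] by (rule Lim_transform_eventually[rotated])
qed

text \<open>A self-crossing would make \<open>F\<close> a rescaled copy of itself with factor
  \<open>F x / F y\<close>; the limit 1 at -\<infinity> forces this factor to be 1.\<close>

lemma F_orbit_inj:
  assumes "x \<in> I" "y \<in> I" "R x = R y" "X x = X y"
  shows "x = y"
proof -
  have "(F \<longlongrightarrow> F x / F y) at_bot"
    by (rule meets_F[OF sol_subset[OF F_sol I_Iic[OF assms(1)]]]) (use assms FYA_pos in auto)
  then have "F x / F y = 1" by (rule tendsto_unique[OF trivial_limit_at_bot_linorder _ F_lim])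
  then have "F x = F y" using FYA_pos[OF assms(2)] by simp
  then show ?thesis using F_strict_mono[OF assms(1,2)] F_strict_mono[OF assms(2,1)] by linarith
qed

text \<open>The equilibrium is the orbit of the explicit solution \<open>1 / (rs * (e - z))\<close>,
  which tends to 0 at -\<infinity>, whereas \<open>F\<close> tends to 1. The pole \<open>e\<close>
  is placed so that the two solutions have the same value at \<open>x\<close>.\<close>

lemma F_not_equilibrium:
  assumes x: "x \<in> I" and eq: "dl x = 0" "R x = rs"
  shows False
proof -
  define e where "e = x + 1 / (rs * F x)"
  have rsp: "0 < rs" using rs_bounds by simp
  have Fp: "0 < F x" using FYA_pos[OF x] by simp
  have ex: "0 < 1 / (rs * F x)" using rsp Fp by simp
  define Y where "Y z = 1 / (rs * (e - z))" for z
  have "sol \<mu> {..x} Y (\<lambda>z. rs * (Y z)\<^sup>2) (\<lambda>z. 2 * rs\<^sup>2 * Y z ^ 3)"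
    unfolding sol_def
  proof (intro ballI conjI)
    fix z assume "z \<in> {..x}"
    then have z: "rs * (e - z) \<noteq> 0" using ex rsp unfolding e_def by auto
    have Y': "(Y has_real_derivative rs * (Y z)\<^sup>2) (at z within {..x})"
      unfolding Y_def[abs_def] using z
      by (auto intro!: derivative_eq_intros simp: power2_eq_square divide_simps)
    show "(Y has_real_derivative rs * (Y z)\<^sup>2) (at z within {..x})" by (rule Y')
    show "((\<lambda>z. rs * (Y z)\<^sup>2) has_real_derivative 2 * rs\<^sup>2 * Y z ^ 3) (at z within {..x})"
      by (rule derivative_eq_intros Y' refl)+ (simp add: power2_eq_square power3_eq_cube)
    have "((\<lambda>z. 2 * rs\<^sup>2 * Y z ^ 3) has_real_derivative 6 * rs * rs\<^sup>2 * Y z ^ 4) (at z within {..x})"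
      by (rule derivative_eq_intros Y' refl)+ (simp add: power2_eq_square power4_eq_xxxx)
    moreover have "6 * rs * rs\<^sup>2 * Y z ^ 4 = Y z * (2 * rs\<^sup>2 * Y z ^ 3) - \<mu> * (rs * (Y z)\<^sup>2)\<^sup>2"
    proof -
      have "6 * r * r\<^sup>2 * w ^ 4 = w * (2 * r\<^sup>2 * w ^ 3) - m * (r * w\<^sup>2)\<^sup>2" if "m = 2 - 6 * r" for m r w :: real
        unfolding that by (simp add: power2_eq_square power3_eq_cube power4_eq_xxxx algebra_simps)
      moreover have "\<mu> = 2 - 6 * rs" unfolding rs_def by (simp add: field_simps)
      ultimately show ?thesis by blast
    qed
    ultimately show "((\<lambda>z. 2 * rs\<^sup>2 * Y z ^ 3) has_real_derivative
        Y z * (2 * rs\<^sup>2 * Y z ^ 3) - \<mu> * (rs * (Y z)\<^sup>2)\<^sup>2) (at z within {..x})" by simp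
  qed
  moreover have "F x = Y x" unfolding Y_def e_def using Fp rsp by simp
  moreover have "FA x = rs * (Y x)\<^sup>2"
    using eq(2) Fp unfolding rho_def \<open>F x = Y x\<close>[symmetric] by (simp add: field_simps)
  moreover have "FB x = 2 * rs\<^sup>2 * Y x ^ 3"
  proof -
    have "FB x = X x * (FA x * F x)" unfolding chi_def using FYA_pos[OF x] by simp
    also have "X x = 2 * rs" using eq unfolding dlt_def by simp
    finally show ?thesis using \<open>FA x = rs * (Y x)\<^sup>2\<close> \<open>F x = Y x\<close>
      by (simp add: power2_eq_square power3_eq_cube)
  qed
  ultimately have "F z = Y z" if "z \<le> x" for z
    using sol_unique(1)[OF sol_subset[OF F_sol I_Iic[OF x]], of _ _ _ x z] that
    by (simp add: is_interval_ic)
  then have "\<forall>\<^sub>F z in at_bot. Y z = F z"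
    by (intro eventually_mono[OF eventually_le_at_bot[of x]]) simp
  moreover have "(Y \<longlongrightarrow> 0) at_bot"
    unfolding Y_def[abs_def] using rsp by real_asymp
  ultimately have "(F \<longlongrightarrow> 0) at_bot" by (simp add: tendsto_cong[of Y])
  then show False using tendsto_unique[OF trivial_limit_at_bot_linorder _ F_lim] by force
qed

end

section \<open>The spiral\<close>

context exponent
begin

text \<open>\<open>t1\<close> and \<open>t2\<close> are the first maximum and the following minimum of \<open>R\<close>.\<close>

definition turns :: "real \<Rightarrow> real \<Rightarrow> bool" where
  "turns t1 t2 \<longleftrightarrow> t1 \<in> I \<and> t2 \<in> I \<and> t1 < t2 \<and>
    (\<forall>x<t1. 0 < dl x) \<and> dl t1 = 0 \<and> (\<forall>x. t1 < x \<and> x < t2 \<longrightarrow> dl x < 0) \<and> dl t2 = 0 \<and>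
    rs < R t1 \<and> R t2 < rs"

lemma turnsD:
  assumes "turns t1 t2"
  shows "t1 \<in> I" "t2 \<in> I" "t1 < t2" "\<And>x. x < t1 \<Longrightarrow> 0 < dl x" "dl t1 = 0"
    "\<And>x. t1 < x \<Longrightarrow> x < t2 \<Longrightarrow> dl x < 0" "dl t2 = 0" "rs < R t1" "R t2 < rs"
  using assms unfolding turns_def by auto

lemma ex_turns: "\<exists>t1 t2. turns t1 t2"
proof -
  have "\<forall>\<^sub>F x in at_bot. x \<in> I \<and> FA x < 1 / 2"
    using eventually_in_I order_tendstoD(2)[OF FA_lim, of "1 / 2"] by (simp add: eventually_conj_iff)
  then obtain a where a: "\<And>x. x \<le> a \<Longrightarrow> x \<in> I \<and> FA x < 1 / 2"
    unfolding eventually_at_bot_linorder by blast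
  \<comment> \<open>Towards -\<infinity> the orbit starts near (0, 1), well above the line chi = 2
    rho: \<open>X\<close> is at least \<open>1 / F\<close>, while \<open>R\<close> is small.\<close>
  have start: "0 < dl x" if "x \<le> a" for x
  proof -
    have x: "x \<in> I" "FA x < 1 / 2" using a[OF that] by auto
    have "1 / F x \<le> X x"
      using FA_le_FB[OF x(1)] FYA_pos[OF x(1)] unfolding chi_def by (simp add: field_simps)
    moreover have "1 / F x - 2 * R x = (F x - 2 * FA x) / (F x)\<^sup>2"
      using FYA_pos[OF x(1)] unfolding rho_def by (simp add: field_simps power2_eq_square)
    moreover have "0 < (F x - 2 * FA x) / (F x)\<^sup>2"
      using F_gt_1[OF x(1)] x(2) by simp
    ultimately show ?thesis unfolding dlt_def by linarith
  qed
  have aI: "a \<in> I" using a by simp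
  obtain b where b: "b \<in> I" "a \<le> b" "dl b \<le> 0"
    using not_always_rising[OF aI] by (meson not_less)
  obtain t1 where t1: "a < t1" "t1 \<le> b" "dl t1 = 0" "\<And>x. a \<le> x \<Longrightarrow> x < t1 \<Longrightarrow> 0 < dl x"
    by (rule first_zero[OF continuous_on_subset[OF RX_continuous(3) I_Icc[OF b(1)]] b(2) start[OF order_refl] b(3)])
      (rule that; assumption)
  have t1I: "t1 \<in> I" using I_down[OF b(1) t1(2)] .
  have before: "0 < dl x" if "x < t1" for x
    using start[of x] t1(4)[of x] that by (cases "x \<le> a") auto
  \<comment> \<open>A zero of \<open>dl\<close> reached from positive values cannot be a minimum of
    \<open>R\<close>, so it does not lie below \<open>rs\<close>; equality would be the
    equilibrium.\<close>
  have R1: "rs < R t1"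
  proof (rule ccontr)
    assume "\<not> rs < R t1"
    then have lt: "R t1 < rs" using F_not_equilibrium[OF t1I t1(3)] by force
    obtain d where d: "0 < d" "\<And>y. y \<in> I \<Longrightarrow> t1 - d < y \<Longrightarrow> y < t1 \<Longrightarrow> dl y < 0"
      using dlt_zero_low[OF F_sol t1I FYA_pos(1,2)[OF t1I] t1(3) lt] by metis
    have "t1 - d / 2 \<in> I" using I_down[OF t1I, of "t1 - d / 2"] d(1) by simp
    then show False using d(2)[of "t1 - d / 2"] before[of "t1 - d / 2"] d(1) by auto
  qed
  obtain d where d: "0 < d" "\<And>y. y \<in> I \<Longrightarrow> t1 < y \<Longrightarrow> y < t1 + d \<Longrightarrow> dl y < 0"
    using dlt_zero_high[OF F_sol t1I FYA_pos(1,2)[OF t1I] t1(3) R1] by metis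
  obtain u where u: "u \<in> I" "t1 < u" using I_open[OF t1I] by blast
  define v where "v = min u (t1 + d / 2)"
  have v: "t1 < v" "v \<in> I" using u d(1) I_down[OF u(1), of v] unfolding v_def by auto
  have after: "dl x < 0" if "t1 < x" "x \<le> v" for x
    using d(2)[of x] that I_down[OF v(2) that(2)] d(1) unfolding v_def by auto
  have "R v < R t1"
    by (rule rho_greater[OF F_sol I_Icc[OF v(2)] v(1)]) (use FYA_pos after in auto)
  \<comment> \<open>The bound 2/5 at the maximum, where \<open>dl = 0\<close>, passes to the points
    after it and provides the starting condition of \<open>not_always_falling\<close>.\<close>
  then have "R v \<le> 2 / 5" using R_less_of_rising[OF t1I] t1(3) by simp
  then obtain w where w: "w \<in> I" "v \<le> w" "0 \<le> dl w"
    using not_always_falling[OF v(2)] by (meson not_less)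
  have "continuous_on {v..w} (\<lambda>x. - dl x)"
    by (intro continuous_intros continuous_on_subset[OF RX_continuous(3) I_Icc[OF w(1)]])
  then obtain t2 where t2: "v < t2" "t2 \<le> w" "- dl t2 = 0" "\<And>x. v \<le> x \<Longrightarrow> x < t2 \<Longrightarrow> 0 < - dl x"
    by (rule first_zero[OF _ w(2)]) (use w(3) after[OF v(1) order_refl] that in auto)
  have t2I: "t2 \<in> I" using I_down[OF w(1) t2(2)] .
  have t2z: "dl t2 = 0" using t2(3) by simp
  have between: "dl x < 0" if "t1 < x" "x < t2" for x
    using after[of x] t2(4)[of x] that by (cases "x \<le> v") auto
  have R2: "R t2 < rs"
  proof (rule ccontr)
    assume "\<not> R t2 < rs"
    then have lt: "rs < R t2" using F_not_equilibrium[OF t2I t2z] by force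
    obtain e where e: "0 < e" "\<And>y. y \<in> I \<Longrightarrow> t2 - e < y \<Longrightarrow> y < t2 \<Longrightarrow> 0 < dl y"
      using dlt_zero_high[OF F_sol t2I FYA_pos(1,2)[OF t2I] t2z lt] by metis
    define y where "y = max v (t2 - e / 2)"
    have y: "v \<le> y" "t2 - e < y" "y < t2" unfolding y_def using e(1) t2(1) by auto
    then have "y \<in> I" using I_down[OF t2I, of y] by simp
    then show False using e(2)[of y] t2(4)[of y] y by auto
  qed
  show ?thesis
    unfolding turns_def using t1I t2I v(1) t2(1) before t1(3) between t2z R1 R2 by force
qed

section \<open>Crossing the rising and the falling arc of the series orbit\<close>

context
  fixes t1 t2 :: real
  assumes tt: "turns t1 t2"
begin

lemmas t = turnsD[OF tt]

lemma R_inc: "x < y \<Longrightarrow> y \<le> t1 \<Longrightarrow> R x < R y"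
proof (rule rho_less[OF F_sol])
  assume "x < y" "y \<le> t1"
  then show "{x..y} \<subseteq> I" using I_Icc[OF I_down[OF t(1)]] by blast
qed (use FYA_pos t(4) in auto)

lemma R_dec: "t1 \<le> x \<Longrightarrow> x < y \<Longrightarrow> y \<le> t2 \<Longrightarrow> R y < R x"
proof (rule rho_greater[OF F_sol])
  assume "y \<le> t2"
  then show "{x..y} \<subseteq> I" using I_Icc[OF I_down[OF t(2)]] by blast
qed (use FYA_pos t(6) in auto)

lemma R_inj_up: "inj_on R {u..t1}"
  by (rule linorder_inj_onI) (use R_inc in force)+

lemma R_inj_down: "inj_on R {t1..t2}"
  by (rule linorder_inj_onI) (use R_dec in force)+

lemma R_cover_up:
  assumes "0 < e"
  obtains u where "u \<le> t1" "{e..R t1} \<subseteq> R ` {u..t1}"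
proof -
  have "\<forall>\<^sub>F x in at_bot. R x < e \<and> x \<le> t1"
    using order_tendstoD(2)[OF R_lim assms] eventually_le_at_bot[of t1] by (rule eventually_conj)
  from eventually_happens'[OF trivial_limit_at_bot_linorder this]
  obtain u where u: "R u < e" "u \<le> t1" by (elim exE conjE)
  have "{e..R t1} \<subseteq> R ` {u..t1}"
  proof
    fix y assume y: "y \<in> {e..R t1}"
    have "continuous_on {u..t1} R"
      by (rule continuous_on_subset[OF RX_continuous(1) I_Icc[OF t(1)]])
    then obtain x where "u \<le> x" "x \<le> t1" "R x = y"
      using IVT'[of R u y t1] u y by auto
    then show "y \<in> R ` {u..t1}" by auto
  qed
  then show ?thesis using that u by blast
qed

lemma R_cover_down: "{R t2..R t1} \<subseteq> R ` {t1..t2}"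
proof
  fix y assume y: "y \<in> {R t2..R t1}"
  have "continuous_on {t1..t2} R"
    by (rule continuous_on_subset[OF RX_continuous(1) I_Icc[OF t(2)]])
  then obtain x where "t1 \<le> x" "x \<le> t2" "R x = y"
    using IVT2'[of R t2 y t1] t(3) y by auto
  then show "y \<in> R ` {t1..t2}" by auto
qed

lemma dl_up: "x \<le> t1 \<Longrightarrow> 0 \<le> dl x"
  using t(4)[of x] t(5) by (cases "x = t1") auto

lemma dl_down: "t1 \<le> x \<Longrightarrow> x \<le> t2 \<Longrightarrow> dl x \<le> 0"
  using t(5,7) t(6)[of x] by (cases "x = t1"; cases "x = t2") auto

text \<open>The rising arc lies on or above the line chi = 2 rho and ends on it over
  \<open>R t1\<close>. One end of the path lies over \<open>R t1\<close> at or above this tip, the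
  other on or below the line, so the path changes sides of the arc. Both orientations occur in the
  disjunction.\<close>

lemma cross_up:
  fixes a b :: real and r x :: "real \<Rightarrow> real"
  assumes "continuous_on {a..b} r" "continuous_on {a..b} x" "a \<le> b"
    and r: "\<And>z. z \<in> {a..b} \<Longrightarrow> 0 < r z \<and> r z \<le> R t1"
    and "r a = R t1 \<and> 2 * R t1 \<le> x a \<and> x b \<le> 2 * r b \<or>
      r b = R t1 \<and> 2 * R t1 \<le> x b \<and> x a \<le> 2 * r a"
  obtains z y where "z \<in> {a..b}" "y \<in> I" "y \<le> t1" "R y = r z" "X y = x z"
proof -
  \<comment> \<open>The arc covers only positive values of \<open>r\<close>, without attaining 0.
    Compactness gives the path a positive minimum, so a compact piece of the arc suffices.\<close>
  have "compact (r ` {a..b})" "r ` {a..b} \<noteq> {}"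
    using compact_continuous_image[OF assms(1)] assms(3) by simp_all
  from compact_attains_inf[OF this] obtain m
    where m: "m \<in> r ` {a..b}" "\<forall>y\<in>r ` {a..b}. m \<le> y" by (elim bexE)
  have "0 < m" using m(1) r by (elim imageE) simp
  then obtain u where u: "u \<le> t1" "{m..R t1} \<subseteq> R ` {u..t1}" using R_cover_up by blast
  have sub: "r ` {a..b} \<subseteq> R ` {u..t1}"
  proof
    fix y assume "y \<in> r ` {a..b}"
    then have "y \<in> {m..R t1}" using m(2) r by auto
    then show "y \<in> R ` {u..t1}" using u(2) by blast
  qed
  note cont = continuous_on_subset[OF RX_continuous(1) I_Icc[OF t(1)], of u]
    continuous_on_subset[OF RX_continuous(2) I_Icc[OF t(1)], of u]
  have top: "y = t1" if "y \<in> {u..t1}" "R y = R t1" for y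
    using R_inj_up[of u] that u(1) unfolding inj_on_def by auto
  have X1: "X t1 = 2 * R t1" using t(5) unfolding dlt_def by simp
  have Xge: "2 * R y \<le> X y" if "y \<in> {u..t1}" for y
    using dl_up[of y] that unfolding dlt_def by simp
  from assms(5) show ?thesis
  proof
    assume *: "r a = R t1 \<and> 2 * R t1 \<le> x a \<and> x b \<le> 2 * r b"
    show ?thesis
    proof (rule crossing'[OF cont R_inj_up assms(1-3) sub])
      show "X y \<le> x a" if "y \<in> {u..t1}" "R y = r a" for y
        using top[OF that(1)] that(2) * X1 by simp
      show "x b \<le> X y" if "y \<in> {u..t1}" "R y = r b" for y
        using Xge[OF that(1)] that(2) * by simp
      show ?thesis if "z \<in> {a..b}" "y \<in> {u..t1}" "R y = r z" "X y = x z" for z y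
        using that \<open>\<And>z y. z \<in> {a..b} \<Longrightarrow> y \<in> I \<Longrightarrow> y \<le> t1 \<Longrightarrow> R y = r z \<Longrightarrow> X y = x z \<Longrightarrow> thesis\<close>[of z y]
          I_down[OF t(1), of y] by auto
    qed
  next
    assume *: "r b = R t1 \<and> 2 * R t1 \<le> x b \<and> x a \<le> 2 * r a"
    show ?thesis
    proof (rule crossing[OF cont R_inj_up assms(1-3) sub])
      show "X y \<le> x b" if "y \<in> {u..t1}" "R y = r b" for y
        using top[OF that(1)] that(2) * X1 by simp
      show "x a \<le> X y" if "y \<in> {u..t1}" "R y = r a" for y
        using Xge[OF that(1)] that(2) * by simp
      show ?thesis if "z \<in> {a..b}" "y \<in> {u..t1}" "R y = r z" "X y = x z" for z y
        using that \<open>\<And>z y. z \<in> {a..b} \<Longrightarrow> y \<in> I \<Longrightarrow> y \<le> t1 \<Longrightarrow> R y = r z \<Longrightarrow> X y = x z \<Longrightarrow> thesis\<close>[of z y]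
          I_down[OF t(1), of y] by auto
    qed
  qed
qed

text \<open>The falling arc lies on or below the line chi = 2 rho, keeps chi positive, and ends on
  the line over \<open>R t2\<close>. A path coming from the line or above must cross it before
  reaching chi \<le> 0 or passing under the tip. The first kind of end will give convexity, the
  second the lower bound on \<open>rho\<close>.\<close>

lemma cross_down:
  fixes a b :: real and r x :: "real \<Rightarrow> real"
  assumes "continuous_on {a..b} r" "continuous_on {a..b} x" "a \<le> b"
    and r: "\<And>z. z \<in> {a..b} \<Longrightarrow> R t2 \<le> r z \<and> r z \<le> R t1"
    and "2 * r a \<le> x a \<and> (x b \<le> 0 \<or> r b = R t2 \<and> x b \<le> 2 * R t2)"
  obtains z y where "z \<in> {a..b}" "y \<in> I" "t1 \<le> y" "y \<le> t2" "R y = r z" "X y = x z"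
proof -
  have sub: "r ` {a..b} \<subseteq> R ` {t1..t2}"
    using R_cover_down r by (auto simp: subset_iff)
  note cont = continuous_on_subset[OF RX_continuous(1) I_Icc[OF t(2)], of t1]
    continuous_on_subset[OF RX_continuous(2) I_Icc[OF t(2)], of t1]
  have bot: "y = t2" if "y \<in> {t1..t2}" "R y = R t2" for y
    using R_inj_down that t(3) unfolding inj_on_def by auto
  have X2: "X t2 = 2 * R t2" using t(7) unfolding dlt_def by simp
  show ?thesis
  proof (rule crossing'[OF cont R_inj_down assms(1-3) sub])
    show "X y \<le> x a" if "y \<in> {t1..t2}" "R y = r a" for y
      using dl_down[of y] that assms(5) unfolding dlt_def by simp
    show "x b \<le> X y" if y: "y \<in> {t1..t2}" "R y = r b" for y
    proof (cases "x b \<le> 0")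
      case True
      have "y \<in> I" using I_down[OF t(2)] y(1) by simp
      then show ?thesis using X_pos[of y] True by simp
    next
      case False
      then have *: "r b = R t2" "x b \<le> 2 * R t2" using assms(5) by simp_all
      then have "y = t2" using bot[OF y(1)] y(2) by simp
      then show ?thesis using *(2) X2 by simp
    qed
    show ?thesis if "z \<in> {a..b}" "y \<in> {t1..t2}" "R y = r z" "X y = x z" for z y
      using that \<open>\<And>z y. z \<in> {a..b} \<Longrightarrow> y \<in> I \<Longrightarrow> t1 \<le> y \<Longrightarrow> y \<le> t2 \<Longrightarrow> R y = r z \<Longrightarrow> X y = x z \<Longrightarrow> thesis\<close>[of z y]
        I_down[OF t(2), of y] by auto
  qed
qed

text \<open>At a first exit through either level the direction of motion determines the side of the
  line chi = 2 rho. The piece of orbit since \<open>t2\<close> must then have crossed an earlier arc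
  of the same orbit, which contradicts injectivity.\<close>

lemma R_trapped:
  assumes x: "x \<in> I" "t2 < x"
  shows "R t2 < R x \<and> R x < R t1"
proof (rule ccontr)
  assume bad: "\<not> ?thesis"
  have R12: "R t2 < R t1" using t(8,9) by linarith
  obtain d where d: "0 < d" "\<And>y. y \<in> I \<Longrightarrow> t2 < y \<Longrightarrow> y < t2 + d \<Longrightarrow> 0 < dl y"
    using dlt_zero_low[OF F_sol t(2) FYA_pos(1,2)[OF t(2)] t(7,9)] by metis
  have cR: "continuous_on {a..x} R" for a
    by (rule continuous_on_subset[OF RX_continuous(1) I_Icc[OF x(1)]])
  \<comment> \<open>Observation starts slightly after \<open>t2\<close>. At \<open>t2\<close> the
    orbit lies on the falling arc itself, so a crossing found there would be no contradiction, and
    the gap \<open>g\<close> used for the first exit would vanish.\<close>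
  have "\<exists>s. t2 < s \<and> s \<le> x \<and> s < t2 + d \<and> R s < R t1"
  proof (rule ccontr)
    assume "\<not> ?thesis"
    then have ge: "R t1 \<le> R s" if "t2 < s" "s \<le> x" "s < t2 + d" for s
      using that by (meson not_less)
    define s where "s = min x (t2 + d / 2)"
    have s: "t2 < s" "s \<le> x" "s < t2 + d" unfolding s_def using x(2) d(1) by auto
    have "continuous_on {t2..s} R"
      by (rule continuous_on_subset[OF cR[of t2]]) (use s in auto)
    then obtain z where z: "t2 \<le> z" "z \<le> s" "R z = (R t1 + R t2) / 2"
      using IVT'[of R t2 "(R t1 + R t2) / 2" s] R12 ge[OF s] s(1) by force
    show False using ge[of z] z s R12 by (cases "z = t2") auto
  qed
  then obtain s where s: "t2 < s" "s \<le> x" "s < t2 + d" "R s < R t1" by blast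
  have sI: "s \<in> I" using I_down[OF x(1) s(2)] .
  have dls: "0 < dl y" if "t2 < y" "y \<le> s" for y
    using d(2)[of y] I_down[OF sI that(2)] that s(3) by simp
  have Rs: "R t2 < R y" if "t2 < y" "y \<le> s" for y
    by (rule rho_less[OF F_sol I_Icc[OF sI, THEN subset_trans[rotated]] that(1)])
      (use FYA_pos dls that in auto)
  have Rs': "R y < R t1" if "t2 \<le> y" "y \<le> s" for y
  proof (cases "y = s")
    case False
    have "R y < R s"
      by (rule rho_less[OF F_sol I_Icc[OF sI]]) (use FYA_pos dls that False in auto)
    then show ?thesis using s(4) by simp
  qed (use s(4) in simp)
  define g where "g y = min (R t1 - R y) (R y - R t2)" for y
  have "continuous_on {s..x} g" unfolding g_def[abs_def] by (intro continuous_intros cR)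
  then obtain e where e: "s < e" "e \<le> x" "g e = 0" "\<And>y. s \<le> y \<Longrightarrow> y < e \<Longrightarrow> 0 < g y"
    by (rule first_zero[OF _ s(2)])
      (use s Rs[OF s(1)] bad that in \<open>auto simp: g_def min_def split: if_splits\<close>)
  have eI: "e \<in> I" using I_down[OF x(1) e(2)] .
  have ins: "R t2 < R y \<and> R y < R t1" if "t2 < y" "y < e" for y
    using e(4)[of y] Rs[of y] Rs'[of y] that unfolding g_def by (cases "y \<le> s") auto
  have sub: "{t2..e} \<subseteq> I" "{s..e} \<subseteq> I" using I_Icc[OF eI] by auto
  have Re: "R e = R t1 \<or> R e = R t2" using e(3) unfolding g_def by (auto simp: min_def split: if_splits)
  have R': "(R has_real_derivative F e * R e * dl e) (at e within I)"
    by (rule rho_deriv[OF F_sol eI]) (use FYA_pos[OF eI] in auto)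
  have FR: "0 < F e * R e" using FYA_pos[OF eI] R_pos[OF eI] by simp
  \<comment> \<open>A point strictly between \<open>t2\<close> and \<open>e\<close> at distance less
    than \<open>h\<close> from \<open>e\<close>, used to contradict a wrong sign of
    \<open>dl e\<close>.\<close>
  define y where "y h = max ((t2 + e) / 2) (e - h / 2)" for h
  have y: "t2 < y h" "y h < e" "e - h < y h" "y h \<in> I" if "0 < h" for h
  proof -
    have "t2 < e" using e(1) s(1) by simp
    then show y: "t2 < y h" "y h < e" "e - h < y h"
      using that unfolding y_def by (auto simp: max_def)
    show "y h \<in> I" using I_down[OF eI, of "y h"] y(2) by simp
  qed
  from Re show False
  proof
    assume Re: "R e = R t1"
    have "0 \<le> dl e"
    proof (rule ccontr)
      assume "\<not> 0 \<le> dl e"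
      then have "F e * R e * dl e < 0" using mult_pos_neg[OF FR] by simp
      from greater_left[OF R' this] obtain h where h: "0 < h"
        "\<And>y. y \<in> I \<Longrightarrow> e - h < y \<Longrightarrow> y < e \<Longrightarrow> R e < R y" by blast
      show False using h(2)[OF y(4,3,2)[OF h(1)]] ins[OF y(1,2)[OF h(1)]] Re by simp
    qed
    then have "2 * R t1 \<le> X e" unfolding dlt_def Re by simp
    moreover have bd: "0 < R z \<and> R z \<le> R t1" if "z \<in> {t2..e}" for z
    proof (cases "z = t2 \<or> z = e")
      case True
      then show ?thesis using R_pos[OF t(2)] R_pos[OF eI] Re R12 by auto
    next
      case False
      then show ?thesis using ins[of z] R_pos[of z] sub(1) that by auto
    qed
    moreover have "X t2 \<le> 2 * R t2" using t(7) unfolding dlt_def by simp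
    ultimately have ends: "R t2 = R t1 \<and> 2 * R t1 \<le> X t2 \<and> X e \<le> 2 * R e \<or>
        R e = R t1 \<and> 2 * R t1 \<le> X e \<and> X t2 \<le> 2 * R t2"
      using Re by simp
    have "t2 \<le> e" using e(1) s(1) by simp
    show False
    proof (rule cross_up[OF continuous_on_subset[OF RX_continuous(1) sub(1)]
          continuous_on_subset[OF RX_continuous(2) sub(1)] \<open>t2 \<le> e\<close> bd ends])
      fix z w assume zw: "z \<in> {t2..e}" "w \<in> I" "w \<le> t1" "R w = R z" "X w = X z"
      have "z \<in> I" using sub(1) zw(1) by (rule subsetD)
      from F_orbit_inj[OF zw(2) this zw(4,5)] show False using t(3) zw(1,3) by simp
    qed
  next
    assume Re: "R e = R t2"
    have "dl e \<le> 0"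
    proof (rule ccontr)
      assume "\<not> dl e \<le> 0"
      then have "0 < F e * R e * dl e" using FR by simp
      from less_left[OF R' this] obtain h where h: "0 < h"
        "\<And>y. y \<in> I \<Longrightarrow> e - h < y \<Longrightarrow> y < e \<Longrightarrow> R y < R e" by blast
      show False using h(2)[OF y(4,3,2)[OF h(1)]] ins[OF y(1,2)[OF h(1)]] Re by simp
    qed
    then have "X e \<le> 2 * R t2" unfolding dlt_def Re by simp
    moreover have bd: "R t2 \<le> R z \<and> R z \<le> R t1" if "z \<in> {s..e}" for z
      using ins[of z] that s(1) Re R12 by (cases "z = e") auto
    moreover have "2 * R s \<le> X s" using dls[OF s(1) order_refl] unfolding dlt_def by simp
    ultimately have ends: "2 * R s \<le> X s \<and> (X e \<le> 0 \<or> R e = R t2 \<and> X e \<le> 2 * R t2)"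
      using Re by simp
    have "s \<le> e" using e(1) by simp
    show False
    proof (rule cross_down[OF continuous_on_subset[OF RX_continuous(1) sub(2)]
          continuous_on_subset[OF RX_continuous(2) sub(2)] \<open>s \<le> e\<close> bd ends])
      fix z w assume zw: "z \<in> {s..e}" "w \<in> I" "t1 \<le> w" "w \<le> t2" "R w = R z" "X w = X z"
      have "z \<in> I" using sub(2) zw(1) by (rule subsetD)
      from F_orbit_inj[OF zw(2) this zw(5,6)] show False using s(1) zw(1,4) by simp
    qed
  qed
qed

end

end

section \<open>Solutions on a half-line\<close>

text \<open>Read backwards from \<open>T\<close>, the term \<open>s * d\<close> damps. If
  \<open>d\<close> exceeded \<open>z / l\<close> somewhere, it would be nondecreasing from there
  until it returned to that level, so it could never come down to its value 0 at
  \<open>T\<close>.\<close>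

lemma drift_bound:
  fixes d p s :: "real \<Rightarrow> real"
  assumes d: "\<And>x. x \<in> {..T} \<Longrightarrow> (d has_real_derivative p x + s x * d x) (at x within {..T})"
    and p: "\<And>x. x \<le> T \<Longrightarrow> \<bar>p x\<bar> \<le> z" and s: "\<And>x. x \<le> T \<Longrightarrow> l \<le> s x" and l: "0 < l"
    and "d T = 0" "x \<le> T"
  shows "d x \<le> z / l"
proof (rule ccontr)
  assume "\<not> d x \<le> z / l"
  then have gx: "0 < d x - z / l" by simp
  have z: "0 \<le> z" using p[of T] by simp
  have "continuous_on {..T} d" by (rule DERIV_continuous_on) (erule d)
  then have "continuous_on {x..T} (\<lambda>y. d y - z / l)"
    by (intro continuous_intros) (auto elim: continuous_on_subset)
  then obtain c where c: "x < c" "c \<le> T" "d c - z / l = 0" "\<And>y. x \<le> y \<Longrightarrow> y < c \<Longrightarrow> 0 < d y - z / l"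
    by (rule first_zero[OF _ assms(6)]) (use gx z l assms(5) that in auto)
  have "d x \<le> d c"
  proof (rule deriv_nonneg_mono[OF d])
    fix y assume y: "x < y" "y < c"
    then have yT: "y \<le> T" using c(2) by simp
    have "l * (z / l) \<le> s y * d y"
      using c(4)[of y] y s[OF yT] l z by (intro mult_mono) auto
    then show "0 \<le> p y + s y * d y" using p[OF yT] l by simp
  qed (use c in auto)
  then show False using gx c(3) by simp
qed

lemma zero_if_halving:
  fixes g :: "'a \<Rightarrow> real"
  assumes bd: "\<And>x. x \<in> S \<Longrightarrow> \<bar>g x\<bar> \<le> M"
    and half: "\<And>W. (\<And>x. x \<in> S \<Longrightarrow> \<bar>g x\<bar> \<le> W) \<Longrightarrow> (\<And>x. x \<in> S \<Longrightarrow> \<bar>g x\<bar> \<le> W / 2)"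
    and x: "x \<in> S"
  shows "g x = 0"
proof -
  define W where "W = (SUP x\<in>S. \<bar>g x\<bar>)"
  have bdd: "bdd_above ((\<lambda>x. \<bar>g x\<bar>) ` S)" by (rule bdd_aboveI2) (rule bd)
  have le: "\<bar>g y\<bar> \<le> W" if "y \<in> S" for y
    unfolding W_def by (rule cSUP_upper[OF that bdd])
  have "(SUP x\<in>S. \<bar>g x\<bar>) \<le> W / 2"
  proof (rule cSUP_least)
    show "S \<noteq> {}" using x by blast
    show "\<bar>g y\<bar> \<le> W / 2" if "y \<in> S" for y by (rule half[OF le that])
  qed
  then have "W \<le> W / 2" by (simp only: W_def)
  then show ?thesis using le[OF x] by simp
qed

text \<open>The common value at \<open>T\<close> fixes the translation. Any bound \<open>W\<close>
  on the difference of the first derivatives is then halved: \<open>J\<close> and \<open>P\<close>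
  vanish at -\<infinity> and are estimated by integration against \<open>Y1 + Y2 - 2 * l\<close>,
  whose derivative is \<open>A1 + A2\<close>; \<open>drift_bound\<close> recovers the difference of
  the functions from \<open>P\<close>.\<close>

lemma asymptotic_unique:
  fixes Y1 Y2 A1 A2 B1 B2 :: "real \<Rightarrow> real"
  assumes mu: "0 \<le> \<mu>" "\<mu> \<le> 1" and l: "0 < l"
    and s1: "sol \<mu> {..T} Y1 A1 B1" and s2: "sol \<mu> {..T} Y2 A2 B2"
    and A1: "\<And>x. x \<le> T \<Longrightarrow> 0 < A1 x" and A2: "\<And>x. x \<le> T \<Longrightarrow> 0 < A2 x"
    and B1: "\<And>x. x \<le> T \<Longrightarrow> l / 2 * A1 x \<le> B1 x" and B2: "\<And>x. x \<le> T \<Longrightarrow> l / 2 * A2 x \<le> B2 x"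
    and Y1l: "(Y1 \<longlongrightarrow> l) at_bot" and Y2l: "(Y2 \<longlongrightarrow> l) at_bot"
    and A1l: "(A1 \<longlongrightarrow> 0) at_bot" and A2l: "(A2 \<longlongrightarrow> 0) at_bot"
    and B1l: "(B1 \<longlongrightarrow> 0) at_bot" and B2l: "(B2 \<longlongrightarrow> 0) at_bot"
    and eq: "Y1 T = Y2 T" and close: "Y1 T - l \<le> l / 40"
    and x: "x \<le> T"
  shows "Y1 x = Y2 x \<and> A1 x = A2 x \<and> B1 x = B2 x"
proof -
  note d1 = solD[OF s1] and d2 = solD[OF s2]
  have low: "l \<le> Y x \<and> Y x \<le> Y T \<and> l / 2 * (Y x - l) \<le> A x \<and> A x \<le> A T"
    if s: "sol \<mu> {..T} Y A B" and A: "\<And>x. x \<le> T \<Longrightarrow> 0 < A x" and B: "\<And>x. x \<le> T \<Longrightarrow> l / 2 * A x \<le> B x"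
      and Yl: "(Y \<longlongrightarrow> l) at_bot" and Al: "(A \<longlongrightarrow> 0) at_bot" and x: "x \<le> T" for Y A B x
  proof (intro conjI)
    show "l \<le> Y x"
      by (rule deriv_at_bot_le[OF Yl solD(1)[OF s]]) (use A x in \<open>auto intro: less_imp_le\<close>)
    show "Y x \<le> Y T"
      by (rule deriv_nonneg_mono[OF solD(1)[OF s]]) (use A x in \<open>auto intro: less_imp_le\<close>)
    have "0 \<le> B y" if "y \<le> T" for y
    proof -
      have "0 \<le> l / 2 * A y" using A[OF that] l by simp
      then show ?thesis using B[OF that] by (rule order_trans)
    qed
    then show "A x \<le> A T"
      by (intro deriv_nonneg_mono[OF solD(2)[OF s]]) (use x in auto)
    have "((\<lambda>x. A x - l / 2 * (Y x - l)) \<longlongrightarrow> 0 - l / 2 * (l - l)) at_bot"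
      by (intro tendsto_intros Yl Al)
    then have "0 - l / 2 * (l - l) \<le> A x - l / 2 * (Y x - l)"
    proof (rule deriv_at_bot_le)
      show "((\<lambda>x. A x - l / 2 * (Y x - l)) has_real_derivative B y - l / 2 * (A y - 0)) (at y within {..T})"
        if "y \<in> {..T}" for y
        by (rule derivative_eq_intros solD[OF s that] refl)+ simp
    qed (use B x in auto)
    then show "l / 2 * (Y x - l) \<le> A x" by simp
  qed
  have low1: "l \<le> Y1 x \<and> Y1 x \<le> Y1 T \<and> l / 2 * (Y1 x - l) \<le> A1 x \<and> A1 x \<le> A1 T" if "x \<le> T" for x
    by (rule low[OF s1 A1 B1 Y1l A1l that])
  have low2: "l \<le> Y2 x \<and> Y2 x \<le> Y2 T \<and> l / 2 * (Y2 x - l) \<le> A2 x \<and> A2 x \<le> A2 T" if "x \<le> T" for x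
    by (rule low[OF s2 A2 B2 Y2l A2l that])
  define J where "J x = (Y1 x * A1 x - B1 x) - (Y2 x * A2 x - B2 x)" for x
  \<comment> \<open>For a single solution \<open>Y A - B\<close> has derivative
    \<open>(1 + \<mu>) A^2\<close>, and \<open>A - Y^2 / 2\<close> has derivative minus the former.
    The differences form a triangular chain that can be integrated from -\<infinity> one after the
    other.\<close>
  define P where "P x = (A1 x - A2 x) - 1 / 2 * ((Y1 x)\<^sup>2 - (Y2 x)\<^sup>2)" for x
  have J': "(J has_real_derivative (1 + \<mu>) * ((A1 x + A2 x) * (A1 x - A2 x))) (at x within {..T})"
    if "x \<in> {..T}" for x
    unfolding J_def[abs_def]
    by (rule derivative_eq_intros d1[OF that] d2[OF that] refl)+ (simp add: power2_eq_square algebra_simps)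
  have P': "(P has_real_derivative - J x) (at x within {..T})" if "x \<in> {..T}" for x
    unfolding P_def[abs_def] J_def
    by (rule derivative_eq_intros d1[OF that] d2[OF that] refl)+ (simp add: power2_eq_square algebra_simps)
  have "(J \<longlongrightarrow> (l * 0 - 0) - (l * 0 - 0)) at_bot"
    unfolding J_def[abs_def] by (intro tendsto_intros Y1l Y2l A1l A2l B1l B2l)
  then have Jl: "(J \<longlongrightarrow> 0) at_bot" by simp
  have "(P \<longlongrightarrow> (0 - 0) - 1 / 2 * (l\<^sup>2 - l\<^sup>2)) at_bot"
    unfolding P_def[abs_def] by (intro tendsto_intros Y1l Y2l A1l A2l)
  then have Pl: "(P \<longlongrightarrow> 0) at_bot" by simp
  have "((\<lambda>x. Y1 x + Y2 x - 2 * l) \<longlongrightarrow> l + l - 2 * l) at_bot"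
    by (intro tendsto_intros Y1l Y2l)
  then have Sl: "((\<lambda>x. Y1 x + Y2 x - 2 * l) \<longlongrightarrow> 0) at_bot" by simp
  have S': "((\<lambda>x. Y1 x + Y2 x - 2 * l) has_real_derivative A1 x + A2 x) (at x within {..T})"
    if "x \<in> {..T}" for x
    by (rule derivative_eq_intros d1[OF that] d2[OF that] refl)+ simp
  have dominate: "\<bar>g x\<bar> \<le> K * (Y1 x + Y2 x - 2 * l)"
    if g: "(g \<longlongrightarrow> 0) at_bot" "\<And>x. x \<in> {..T} \<Longrightarrow> (g has_real_derivative g' x) (at x within {..T})"
      and K: "\<And>x. x \<le> T \<Longrightarrow> \<bar>g' x\<bar> \<le> K * (A1 x + A2 x)" and x: "x \<le> T" for g g' K x
  proof -
    have "((\<lambda>x. K * (Y1 x + Y2 x - 2 * l) - g x) \<longlongrightarrow> K * 0 - 0) at_bot"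
      by (intro tendsto_intros Sl g(1))
    then have "K * 0 - 0 \<le> K * (Y1 x + Y2 x - 2 * l) - g x"
    proof (rule deriv_at_bot_le)
      show "((\<lambda>x. K * (Y1 x + Y2 x - 2 * l) - g x) has_real_derivative K * (A1 y + A2 y) - g' y) (at y within {..T})"
        if "y \<in> {..T}" for y
        by (intro DERIV_diff DERIV_cmult S'[OF that] g(2)[OF that])
      show "0 \<le> K * (A1 y + A2 y) - g' y" if "y < x" for y using K[of y] that x by simp
    qed (use x in auto)
    moreover have "((\<lambda>x. K * (Y1 x + Y2 x - 2 * l) + g x) \<longlongrightarrow> K * 0 + 0) at_bot"
      by (intro tendsto_intros Sl g(1))
    then have "K * 0 + 0 \<le> K * (Y1 x + Y2 x - 2 * l) + g x"
    proof (rule deriv_at_bot_le)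
      show "((\<lambda>x. K * (Y1 x + Y2 x - 2 * l) + g x) has_real_derivative K * (A1 y + A2 y) + g' y) (at y within {..T})"
        if "y \<in> {..T}" for y
        by (intro DERIV_add DERIV_cmult S'[OF that] g(2)[OF that])
      show "0 \<le> K * (A1 y + A2 y) + g' y" if "y < x" for y using K[of y] that x by simp
    qed (use x in auto)
    ultimately show ?thesis by simp
  qed
  have bounds: "\<bar>J x\<bar> \<le> (1 + \<mu>) * W * (Y1 x + Y2 x - 2 * l)
      \<and> \<bar>P x\<bar> \<le> W / 5 \<and> \<bar>Y1 x - Y2 x\<bar> \<le> W / 5 / l"
    if W: "\<And>x. x \<in> {..T} \<Longrightarrow> \<bar>A1 x - A2 x\<bar> \<le> W" and x: "x \<le> T" for W x
  proof -
    have W0: "0 \<le> W" using W[of T] by simp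
    have J_le: "\<bar>J x\<bar> \<le> (1 + \<mu>) * W * (Y1 x + Y2 x - 2 * l)" if "x \<le> T" for x
    proof (rule dominate[OF Jl J' _ that])
      fix x assume x: "x \<le> T"
      have "\<bar>(1 + \<mu>) * ((A1 x + A2 x) * (A1 x - A2 x))\<bar> = (1 + \<mu>) * ((A1 x + A2 x) * \<bar>A1 x - A2 x\<bar>)"
        using mu A1[OF x] A2[OF x] by (simp add: abs_mult)
      also have "\<dots> \<le> (1 + \<mu>) * ((A1 x + A2 x) * W)"
        using mu A1[OF x] A2[OF x] W[of x] x by (intro mult_left_mono) auto
      finally show "\<bar>(1 + \<mu>) * ((A1 x + A2 x) * (A1 x - A2 x))\<bar> \<le> (1 + \<mu>) * W * (A1 x + A2 x)"
        by (simp add: mult_ac)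
    qed auto
    have P_le: "\<bar>P x\<bar> \<le> W / 5" if x: "x \<le> T" for x
    proof -
      have "\<bar>P x\<bar> \<le> 4 * W / l * (Y1 x + Y2 x - 2 * l)"
      proof (rule dominate[OF Pl P' _ x])
        fix x assume x: "x \<le> T"
        have "0 \<le> Y1 x + Y2 x - 2 * l" using low1[OF x] low2[OF x] by simp
        then have "(1 + \<mu>) * W * (Y1 x + Y2 x - 2 * l) \<le> 2 * W * (Y1 x + Y2 x - 2 * l)"
          using mu W0 by (intro mult_right_mono) auto
        also have "\<dots> \<le> 2 * W * (2 / l * (A1 x + A2 x))"
        proof (rule mult_left_mono)
          have "l / 2 * (Y1 x + Y2 x - 2 * l) \<le> A1 x + A2 x"
            using low1[OF x] low2[OF x] by (simp add: algebra_simps)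
          then show "Y1 x + Y2 x - 2 * l \<le> 2 / l * (A1 x + A2 x)"
            using l by (simp add: field_simps)
        qed (use W0 in simp)
        also have "\<dots> = 4 * W / l * (A1 x + A2 x)" by simp
        finally show "\<bar>- J x\<bar> \<le> 4 * W / l * (A1 x + A2 x)"
          using J_le[OF x] unfolding abs_minus_cancel by linarith
      qed auto
      \<comment> \<open>Both functions are within \<open>l / 40\<close> of their limit, so
        \<open>Y1 + Y2 - 2 * l\<close> is at most \<open>l / 20\<close>.\<close>
      also have "\<dots> \<le> 4 * W / l * (l / 20)"
        using low1[OF x] low2[OF x] eq close W0 l by (intro mult_left_mono) auto
      also have "\<dots> = W / 5" using l by simp
      finally show ?thesis .
    qed
    define s where "s x = (Y1 x + Y2 x) / 2" for x
    have s: "l \<le> s x" if "x \<le> T" for x unfolding s_def using low1[OF that] low2[OF that] by simp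
    have D1: "Y1 x - Y2 x \<le> W / 5 / l"
    proof (rule drift_bound[where T = T and p = P and s = s and d = "\<lambda>x. Y1 x - Y2 x", OF _ P_le s l _ x])
      show "((\<lambda>x. Y1 x - Y2 x) has_real_derivative P y + s y * (Y1 y - Y2 y)) (at y within {..T})"
        if "y \<in> {..T}" for y
        unfolding P_def s_def
        by (rule derivative_eq_intros d1[OF that] d2[OF that] refl)+ (simp add: power2_eq_square field_simps)
    qed (use eq in auto)
    have D2: "Y2 x - Y1 x \<le> W / 5 / l"
    proof (rule drift_bound[where T = T and p = "\<lambda>x. - P x" and s = s and d = "\<lambda>x. Y2 x - Y1 x", OF _ _ s l _ x])
      show "((\<lambda>x. Y2 x - Y1 x) has_real_derivative - P y + s y * (Y2 y - Y1 y)) (at y within {..T})"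
        if "y \<in> {..T}" for y
        unfolding P_def s_def
        by (rule derivative_eq_intros d1[OF that] d2[OF that] refl)+ (simp add: power2_eq_square field_simps)
    qed (use eq P_le in auto)
    show ?thesis using D1 D2 J_le[OF x] P_le[OF x] by auto
  qed
  have A0: "A1 x - A2 x = 0" if "x \<in> {..T}" for x
  proof (rule zero_if_halving[where S = "{..T}" and g = "\<lambda>x. A1 x - A2 x", OF _ _ that])
    show "\<bar>A1 x - A2 x\<bar> \<le> A1 T + A2 T" if "x \<in> {..T}" for x
      using low1[of x] low2[of x] A1[of x] A2[of x] that by auto
    fix W x assume W: "\<And>x. x \<in> {..T} \<Longrightarrow> \<bar>A1 x - A2 x\<bar> \<le> W" and "x \<in> {..T}"
    then have x: "x \<le> T" by simp
    have b: "\<bar>P x\<bar> \<le> W / 5" "\<bar>Y1 x - Y2 x\<bar> \<le> W / 5 / l"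
      using bounds[of W x, OF W x] by auto
    have "(Y1 x + Y2 x) / 2 \<le> 41 / 40 * l" "0 \<le> (Y1 x + Y2 x) / 2"
      using low1[OF x] low2[OF x] eq close l by auto
    then have "\<bar>(Y1 x + Y2 x) / 2 * (Y1 x - Y2 x)\<bar> \<le> 41 / 40 * l * (W / 5 / l)"
      unfolding abs_mult using b l by (intro mult_mono) auto
    also have "\<dots> = 41 / 200 * W" using l by simp
    finally have "\<bar>(Y1 x + Y2 x) / 2 * (Y1 x - Y2 x)\<bar> \<le> 41 / 200 * W" .
    moreover have "A1 x - A2 x = P x + (Y1 x + Y2 x) / 2 * (Y1 x - Y2 x)"
      unfolding P_def by (simp add: power2_eq_square field_simps)
    \<comment> \<open>The two contributions add up to 1/5 + 41/200 = 81/200 of \<open>W\<close>; the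
      closeness \<open>l / 40\<close> keeps this below one half.\<close>
    ultimately show "\<bar>A1 x - A2 x\<bar> \<le> W / 2"
      using b(1) by linarith
  qed
  have "\<bar>J x\<bar> \<le> (1 + \<mu>) * 0 * (Y1 x + Y2 x - 2 * l) \<and> \<bar>P x\<bar> \<le> 0 / 5 \<and> \<bar>Y1 x - Y2 x\<bar> \<le> 0 / 5 / l"
    by (rule bounds[OF _ x]) (use A0 in auto)
  then show ?thesis using A0[of x] x unfolding J_def by auto
qed

section \<open>Signs, monotonicity and limits of a solution on the half-line\<close>

locale halfline = exponent +
  fixes Y A B :: "real \<Rightarrow> real"
  assumes sol: "sol \<mu> {..0} Y A B" and Y0: "0 < Y 0" and A0: "0 < A 0" and A_lim: "(A \<longlongrightarrow> 0) at_bot"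
begin

lemma sub: "x \<le> 0 \<Longrightarrow> {..x} \<subseteq> {..0::real}" "y \<le> 0 \<Longrightarrow> {x..y} \<subseteq> {..0::real}"
  by auto

text \<open>Once \<open>B\<close> is 0, the term \<open>- \<mu> * A^2\<close> prevents it from
  becoming positive again: \<open>exp (- M * z) * B z\<close> does not increase while
  \<open>B\<close> is nonnegative. The bound \<open>M\<close> of \<open>Y\<close> comes from
  compactness, since the sign of \<open>Y\<close> is not yet available.\<close>

lemma B_pos_left:
  assumes "x < y" "y \<le> 0" "0 < B y"
  shows "0 < B x"
proof (rule ccontr)
  assume "\<not> 0 < B x"
  then have Bx: "B x \<le> 0" by simp
  have "continuous_on {x..y} B"
    by (rule continuous_on_subset[OF sol_continuous(3)[OF sol] sub(2)[OF assms(2)]])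
  then obtain c where c: "x \<le> c" "c < y" "B c = 0" "\<And>z. c < z \<Longrightarrow> z \<le> y \<Longrightarrow> 0 < B z"
    by (rule last_zero[OF _ less_imp_le[OF assms(1)] Bx assms(3)]) (rule that; assumption)
  have "compact (Y ` {c..y})"
    by (intro compact_continuous_image continuous_on_subset[OF sol_continuous(1)[OF sol] sub(2)[OF assms(2)]]) simp
  then have "bounded (Y ` {c..y})" by (rule compact_imp_bounded)
  then obtain M where M: "\<forall>v\<in>Y ` {c..y}. \<bar>v\<bar> \<le> M" unfolding bounded_iff by auto
  define g where "g z = - (exp (- M * z) * B z)" for z
  have "g c \<le> g y"
  proof (rule deriv_nonneg_mono[where S = "{..0}" and g = g])
    show "(g has_real_derivative exp (- M * z) * ((M - Y z) * B z + \<mu> * (A z)\<^sup>2)) (at z within {..0})"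
      if "z \<in> {..0}" for z
      unfolding g_def[abs_def] using solD(3)[OF sol that]
      by (auto intro!: derivative_eq_intros simp: algebra_simps)
    fix z assume z: "c < z" "z < y"
    then have "Y z \<le> M" using M by (auto simp: abs_le_iff)
    then show "0 \<le> exp (- M * z) * ((M - Y z) * B z + \<mu> * (A z)\<^sup>2)"
      using c(4)[of z] z mu_pos by simp
  qed (use c assms in auto)
  then show False unfolding g_def using c(3) assms(3) by (simp add: mult_le_0_iff)
qed

lemma ex_B_pos: "\<exists>x0\<le>0. \<forall>x\<le>x0. 0 < B x"
proof -
  have "\<exists>x\<le>0. 0 < B x"
  proof (rule ccontr)
    assume "\<not> ?thesis"
    then have B: "B x \<le> 0" if "x \<le> 0" for x using that by (meson not_less)
    have "A 0 \<le> A x" if "x \<le> 0" for x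
    proof -
      have "- A x \<le> - A 0"
      proof (rule deriv_nonneg_mono[where g = "\<lambda>x. - A x"])
        show "((\<lambda>x. - A x) has_real_derivative - B z) (at z within {..0})" if "z \<in> {..0}" for z
          by (rule DERIV_minus[OF solD(2)[OF sol that]])
      qed (use that B in auto)
      then show ?thesis by simp
    qed
    then have "\<forall>\<^sub>F x in at_bot. A 0 \<le> A x"
      by (intro eventually_mono[OF eventually_le_at_bot[of 0]])
    then have "A 0 \<le> 0"
      using tendsto_lowerbound[OF A_lim] by simp
    then show False using A0 by simp
  qed
  then obtain x where x: "x \<le> 0" "0 < B x" by blast
  have "0 < B z" if "z \<le> x" for z
    using B_pos_left[of z x] x that by (cases "z = x") auto
  then show ?thesis using x(1) by blast
qed

lemma A_pos:
  assumes "x \<le> 0"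
  shows "0 < A x"
proof (cases "0 < B x")
  case True
  have "0 < B z" if "z \<le> x" for z
    using B_pos_left[of z x] True assms that by (cases "z = x") auto
  then show ?thesis
    by (intro deriv_at_bot_less[OF A_lim solD(2)[OF sol] sub(1)[OF assms]]) auto
next
  case False
  have B: "B z \<le> 0" if "x \<le> z" "z \<le> 0" for z
    using B_pos_left[of x z] False that by (cases "z = x") (auto simp: not_less[symmetric])
  have "- A x \<le> - A 0"
  proof (rule deriv_nonneg_mono[where g = "\<lambda>x. - A x"])
    show "((\<lambda>x. - A x) has_real_derivative - B z) (at z within {..0})" if "z \<in> {..0}" for z
      by (rule DERIV_minus[OF solD(2)[OF sol that]])
  qed (use assms B in auto)
  then show ?thesis using A0 by simp
qed

text \<open>Going left, \<open>A\<close> would decrease at least linearly with slope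
  \<open>b\<close> and be at most 0 at \<open>x - A x / b\<close>.\<close>

lemma B_no_floor:
  assumes "x \<le> 0" "0 < b" "\<And>z. z \<le> x \<Longrightarrow> b \<le> B z"
  shows False
proof -
  define z where "z = x - A x / b"
  have zx: "z \<le> x" unfolding z_def using A_pos[OF assms(1)] assms(2) by simp
  have "A z - b * z \<le> A x - b * x"
  proof (rule deriv_nonneg_mono[where g = "\<lambda>z. A z - b * z"])
    show "((\<lambda>z. A z - b * z) has_real_derivative B y - b) (at y within {..0})" if "y \<in> {..0}" for y
      using solD(2)[OF sol that] by (auto intro!: derivative_eq_intros)
  qed (use zx assms in auto)
  then have "A z \<le> 0" unfolding z_def using assms(2) by (simp add: algebra_simps)
  then show False using A_pos[of z] zx assms(1) by simp
qed

lemma Y_less: "x < y \<Longrightarrow> y \<le> 0 \<Longrightarrow> Y x < Y y"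
  by (rule deriv_pos_strict_mono[OF solD(1)[OF sol] sub(2)]) (use A_pos in auto)

lemma Y_le: "x \<le> y \<Longrightarrow> y \<le> 0 \<Longrightarrow> Y x \<le> Y y"
  using Y_less[of x y] by (cases "x = y") auto

text \<open>If \<open>Y\<close> were nonpositive at some point, it would be so everywhere to the
  left. Where moreover \<open>B\<close> is positive, \<open>B\<close> cannot increase with time, so
  its value at one point would be a positive floor towards -\<infinity>.\<close>

lemma Y_pos:
  assumes "x \<le> 0"
  shows "0 < Y x"
proof (rule ccontr)
  assume Yx: "\<not> 0 < Y x"
  obtain x0 where x0: "x0 \<le> 0" "\<And>x. x \<le> x0 \<Longrightarrow> 0 < B x" using ex_B_pos by blast
  define x1 where "x1 = min x0 x"
  have Y: "Y z \<le> 0" if "z \<le> x1" for z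
    using Y_le[of z x] Yx that assms unfolding x1_def by simp
  show False
  proof (rule B_no_floor[of x1 "B x1"])
    fix z assume z: "z \<le> x1"
    have "- B z \<le> - B x1"
    proof (rule deriv_nonneg_mono[where g = "\<lambda>x. - B x"])
      show "((\<lambda>x. - B x) has_real_derivative - (Y y * B y - \<mu> * (A y)\<^sup>2)) (at y within {..0})" if "y \<in> {..0}" for y
        by (rule DERIV_minus[OF solD(3)[OF sol that]])
      fix y assume y: "z < y" "y < x1"
      then have "Y y * B y \<le> 0"
        using Y[of y] x0(2)[of y] by (simp add: mult_nonpos_nonneg x1_def)
      moreover have "0 \<le> \<mu> * (A y)\<^sup>2" using mu_pos by simp
      ultimately show "0 \<le> - (Y y * B y - \<mu> * (A y)\<^sup>2)" by linarith
    qed (use z x0(1) in \<open>auto simp: x1_def\<close>)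
    then show "B x1 \<le> B z" by simp
  qed (use x0 in \<open>auto simp: x1_def\<close>)
qed

text \<open>A quantity whose derivative is a multiple of the single square \<open>A^2\<close>. It
  stands in for \<open>B\<close> in estimates integrated from -\<infinity>, where it
  vanishes.\<close>

definition J :: "real \<Rightarrow> real" where "J x = Y x * A x - B x"

lemma J_deriv: "x \<in> {..0} \<Longrightarrow> (J has_real_derivative (1 + \<mu>) * (A x)\<^sup>2) (at x within {..0})"
  unfolding J_def[abs_def] using solD[OF sol, of x]
  by (auto intro!: derivative_eq_intros simp: power2_eq_square algebra_simps)

lemma J_less: "x < y \<Longrightarrow> y \<le> 0 \<Longrightarrow> J x < J y"
  by (rule deriv_pos_strict_mono[OF J_deriv sub(2)])
    (auto intro!: mult_pos_pos add_pos_pos zero_less_power simp: mu_pos A_pos)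

text \<open>A negative value would persist to the left, and as \<open>Y * A\<close> is positive it
  would provide \<open>B\<close> with a positive floor.\<close>

lemma J_nonneg:
  assumes "x \<le> 0"
  shows "0 \<le> J x"
proof (rule ccontr)
  assume "\<not> 0 \<le> J x"
  then show False
  proof (intro B_no_floor[OF assms, of "- J x"])
    fix z assume z: "z \<le> x"
    have "J z \<le> J x" using J_less[of z x] z assms by (cases "z = x") auto
    moreover have "0 < Y z * A z" using Y_pos[of z] A_pos[of z] z assms by simp
    ultimately show "- J x \<le> B z" unfolding J_def by linarith
  qed simp
qed

lemma J_pos: "x \<le> 0 \<Longrightarrow> 0 < J x"
  using J_less[of "x - 1" x] J_nonneg[of "x - 1"] by simp

abbreviation "r \<equiv> rho Y A"
abbreviation "ch \<equiv> chi Y A B"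
abbreviation "de \<equiv> dlt Y A B"

lemma ch_less_1: "x \<le> 0 \<Longrightarrow> ch x < 1"
  using J_pos[of x] Y_pos[of x] A_pos[of x] unfolding J_def chi_def by (simp add: field_simps)

lemma r_pos: "x \<le> 0 \<Longrightarrow> 0 < r x"
  using Y_pos[of x] A_pos[of x] unfolding rho_def by simp

definition lam :: real where "lam = (INF x\<in>{..0}. Y x)"

lemma lam_le: "x \<le> 0 \<Longrightarrow> lam \<le> Y x"
  unfolding lam_def
  by (rule cINF_lower) (auto intro!: bdd_belowI2[of _ 0] order_less_imp_le[OF Y_pos])

lemma lam_nonneg: "0 \<le> lam"
  unfolding lam_def by (rule cINF_greatest) (auto intro: order_less_imp_le[OF Y_pos])

lemma Y_lim: "(Y \<longlongrightarrow> lam) at_bot"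
proof (rule order_tendstoI)
  fix a assume "a < lam"
  then show "\<forall>\<^sub>F x in at_bot. a < Y x"
    using lam_le by (intro eventually_mono[OF eventually_le_at_bot[of 0]]) force
next
  fix a assume "lam < a"
  then obtain x where x: "x \<le> 0" "Y x < a"
    unfolding lam_def using cInf_lessD[of "Y ` {..0}" a] by auto
  show "\<forall>\<^sub>F x in at_bot. Y x < a"
  proof (intro eventually_mono[OF eventually_le_at_bot[of x]])
    fix z assume "z \<le> x"
    then show "Y z < a" using Y_le[of z x] x by simp
  qed
qed

lemma B_lim: "(B \<longlongrightarrow> 0) at_bot"
proof (rule tendsto_sandwich[where f = "\<lambda>_. 0" and h = "\<lambda>x. Y x * A x"])
  obtain x0 where x0: "x0 \<le> 0" "\<And>x. x \<le> x0 \<Longrightarrow> 0 < B x" using ex_B_pos by blast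
  show "\<forall>\<^sub>F x in at_bot. 0 \<le> B x"
    by (intro eventually_mono[OF eventually_le_at_bot[of x0]] order_less_imp_le[OF x0(2)])
  show "\<forall>\<^sub>F x in at_bot. B x \<le> Y x * A x"
    using J_nonneg by (intro eventually_mono[OF eventually_le_at_bot[of 0]]) (simp add: J_def)
  show "((\<lambda>x. Y x * A x) \<longlongrightarrow> 0) at_bot"
    using tendsto_mult[OF Y_lim A_lim] by simp
qed simp

lemma J_lim: "(J \<longlongrightarrow> 0) at_bot"
  unfolding J_def[abs_def] using tendsto_diff[OF tendsto_mult[OF Y_lim A_lim] B_lim] by simp

text \<open>At this end \<open>B\<close> tends to 0, so its ratio to the fixed value
  \<open>B x\<close> supplies the unbounded oscillation of \<open>ln B\<close>.\<close>

lemma orbit_left: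
  assumes x: "x \<le> 0" and B: "\<And>z. z \<le> x \<Longrightarrow> 0 < B z"
  shows "orbit \<mu> {..x} Y A B"
proof
  show "sol \<mu> {..x} Y A B" by (rule sol_subset[OF sol sub(1)[OF x]])
  fix K
  have "0 < B x / (\<bar>K\<bar> + 1)" using B[OF order_refl] by (simp add: add_nonneg_pos)
  from order_tendstoD(2)[OF B_lim this]
  have "\<forall>\<^sub>F z in at_bot. B z < B x / (\<bar>K\<bar> + 1) \<and> z \<le> x"
    by (rule eventually_conj) (rule eventually_le_at_bot)
  from eventually_happens'[OF trivial_limit_at_bot_linorder this]
  obtain z where z: "B z < B x / (\<bar>K\<bar> + 1)" "z \<le> x" by (elim exE conjE)
  have "K * B z \<le> (\<bar>K\<bar> + 1) * B z" using B[OF z(2)] by (intro mult_right_mono) auto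
  also have "\<dots> < B x" using z(1) by (simp add: field_simps add_nonneg_pos)
  finally show "\<exists>z\<in>{..x}. \<exists>y\<in>{..x}. z \<le> y \<and> K * B z < B y"
    using z(2) by (intro bexI[of _ z] bexI[of _ x]) auto
qed (use x Y_pos A_pos B in \<open>auto simp: is_interval_ic\<close>)

lemma r_less:
  "x < y \<Longrightarrow> y \<le> 0 \<Longrightarrow> (\<And>z. x < z \<Longrightarrow> z < y \<Longrightarrow> 0 < de z) \<Longrightarrow> r x < r y"
  by (rule rho_less[OF sol sub(2)]) (use Y_pos A_pos in auto)

lemma r_greater:
  "x < y \<Longrightarrow> y \<le> 0 \<Longrightarrow> (\<And>z. x < z \<Longrightarrow> z < y \<Longrightarrow> de z < 0) \<Longrightarrow> r y < r x"
  by (rule rho_greater[OF sol sub(2)]) (use Y_pos A_pos in auto)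

lemma r_continuous:
  assumes "y \<le> 0"
  shows "continuous_on {x..y} r" "continuous_on {x..y} ch" "continuous_on {x..y} de"
  using rho_chi_continuous[OF sol] Y_pos A_pos continuous_on_subset[OF _ sub(2)[OF assms]] by auto

end

section \<open>Solutions tending to 0: oscillation and trapping\<close>

locale vanishing = halfline +
  assumes lam0: "lam = 0"
begin

lemma Y_lim0: "(Y \<longlongrightarrow> 0) at_bot"
  using Y_lim lam0 by simp

text \<open>If \<open>A / Y\<^sup>2\<close> is monotone near \<open>-\<infinity>\<close>, it can be compared with its equilibrium value by integrating
  \<open>J' = (1 + \<mu>) A\<^sup>2\<close> from \<open>-\<infinity>\<close>.\<close>

lemma rising_imp_high:
  assumes x: "x \<le> 0" and mono: "\<And>w z. w \<le> z \<Longrightarrow> z \<le> x \<Longrightarrow> r w \<le> r z"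
  shows "rs \<le> r x"
proof -
  have B: "2 * rs * (Y z * A z) \<le> B z" if z: "z \<le> x" for z
  proof -
    \<comment> \<open>\<open>k * Y^3\<close> is the integral from -\<infinity> of
      \<open>(1 + \<mu>) * r z * Y^2 * A\<close>, which majorises the derivative of
      \<open>J\<close>. As \<open>(1 + \<mu>) / 3 = 1 - 2 * rs\<close>, the resulting bound on
      \<open>J\<close> reads \<open>B \<ge> 2 * rs * Y * A\<close>, and this integrates once more to
      \<open>A \<ge> rs * Y^2\<close>.\<close>
    define k where "k = (1 + \<mu>) * r z / 3"
    have "((\<lambda>w. k * Y w ^ 3 - J w) \<longlongrightarrow> k * 0 ^ 3 - 0) at_bot"
      by (intro tendsto_intros Y_lim0 J_lim)
    then have "k * 0 ^ 3 - 0 \<le> k * Y z ^ 3 - J z"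
    proof (rule deriv_at_bot_le)
      show "((\<lambda>w. k * Y w ^ 3 - J w) has_real_derivative k * (3 * (Y w)\<^sup>2 * A w) - (1 + \<mu>) * (A w)\<^sup>2) (at w within {..0})"
        if "w \<in> {..0}" for w
        using solD(1)[OF sol that] J_deriv[OF that] by (auto intro!: derivative_eq_intros)
      fix w assume w: "w < z"
      then have w0: "w \<le> 0" using z x by simp
      have "A w = r w * (Y w)\<^sup>2" unfolding rho_def using Y_pos[OF w0] by simp
      also have "\<dots> \<le> r z * (Y w)\<^sup>2" using mono[of w z] w z by (intro mult_right_mono) auto
      finally have "(1 + \<mu>) * A w * A w \<le> (1 + \<mu>) * A w * (r z * (Y w)\<^sup>2)"
        using mu_pos A_pos[OF w0] by (intro mult_left_mono) auto
      then show "0 \<le> k * (3 * (Y w)\<^sup>2 * A w) - (1 + \<mu>) * (A w)\<^sup>2"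
        unfolding k_def by (simp add: power2_eq_square mult_ac)
    qed (use z x in auto)
    moreover have "A z = r z * (Y z)\<^sup>2" unfolding rho_def using Y_pos[of z] z x by simp
    then have "k * Y z ^ 3 = (1 + \<mu>) / 3 * (Y z * A z)"
      unfolding k_def by (simp add: power2_eq_square power3_eq_cube)
    ultimately have "J z \<le> (1 + \<mu>) / 3 * (Y z * A z)" by simp
    moreover have "2 * rs * (Y z * A z) = Y z * A z - (1 + \<mu>) / 3 * (Y z * A z)"
      unfolding rs_def by (simp add: field_simps)
    ultimately show ?thesis unfolding J_def by linarith
  qed
  have "((\<lambda>w. A w - rs * (Y w)\<^sup>2) \<longlongrightarrow> 0 - rs * 0\<^sup>2) at_bot"
    by (intro tendsto_intros Y_lim0 A_lim)
  then have "0 - rs * 0\<^sup>2 \<le> A x - rs * (Y x)\<^sup>2"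
  proof (rule deriv_at_bot_le)
    show "((\<lambda>w. A w - rs * (Y w)\<^sup>2) has_real_derivative B w - 2 * rs * (Y w * A w)) (at w within {..0})"
      if "w \<in> {..0}" for w
      using solD[OF sol that] by (auto intro!: derivative_eq_intros)
  qed (use B x in auto)
  then show ?thesis unfolding rho_def using Y_pos[OF x] by (simp add: field_simps)
qed

lemma falling_imp_low:
  assumes x: "x \<le> 0" and mono: "\<And>w z. w \<le> z \<Longrightarrow> z \<le> x \<Longrightarrow> r z \<le> r w"
  shows "r x \<le> rs"
proof -
  have B: "B z \<le> 2 * rs * (Y z * A z)" if z: "z \<le> x" for z
  proof -
    define k where "k = (1 + \<mu>) * r z / 3"
    have "((\<lambda>w. J w - k * Y w ^ 3) \<longlongrightarrow> 0 - k * 0 ^ 3) at_bot"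
      by (intro tendsto_intros Y_lim0 J_lim)
    then have "0 - k * 0 ^ 3 \<le> J z - k * Y z ^ 3"
    proof (rule deriv_at_bot_le)
      show "((\<lambda>w. J w - k * Y w ^ 3) has_real_derivative (1 + \<mu>) * (A w)\<^sup>2 - k * (3 * (Y w)\<^sup>2 * A w)) (at w within {..0})"
        if "w \<in> {..0}" for w
        using solD(1)[OF sol that] J_deriv[OF that] by (auto intro!: derivative_eq_intros)
      fix w assume w: "w < z"
      then have w0: "w \<le> 0" using z x by simp
      have "r z * (Y w)\<^sup>2 \<le> r w * (Y w)\<^sup>2" using mono[of w z] w z by (intro mult_right_mono) auto
      also have "\<dots> = A w" unfolding rho_def using Y_pos[OF w0] by simp
      finally have "(1 + \<mu>) * A w * (r z * (Y w)\<^sup>2) \<le> (1 + \<mu>) * A w * A w"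
        using mu_pos A_pos[OF w0] by (intro mult_left_mono) auto
      then show "0 \<le> (1 + \<mu>) * (A w)\<^sup>2 - k * (3 * (Y w)\<^sup>2 * A w)"
        unfolding k_def by (simp add: power2_eq_square mult_ac)
    qed (use z x in auto)
    moreover have "A z = r z * (Y z)\<^sup>2" unfolding rho_def using Y_pos[of z] z x by simp
    then have "k * Y z ^ 3 = (1 + \<mu>) / 3 * (Y z * A z)"
      unfolding k_def by (simp add: power2_eq_square power3_eq_cube)
    ultimately have "(1 + \<mu>) / 3 * (Y z * A z) \<le> J z" by simp
    moreover have "2 * rs * (Y z * A z) = Y z * A z - (1 + \<mu>) / 3 * (Y z * A z)"
      unfolding rs_def by (simp add: field_simps)
    ultimately show ?thesis unfolding J_def by linarith
  qed
  have "((\<lambda>w. rs * (Y w)\<^sup>2 - A w) \<longlongrightarrow> rs * 0\<^sup>2 - 0) at_bot"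
    by (intro tendsto_intros Y_lim0 A_lim)
  then have "rs * 0\<^sup>2 - 0 \<le> rs * (Y x)\<^sup>2 - A x"
  proof (rule deriv_at_bot_le)
    show "((\<lambda>w. rs * (Y w)\<^sup>2 - A w) has_real_derivative 2 * rs * (Y w * A w) - B w) (at w within {..0})"
      if "w \<in> {..0}" for w
      using solD[OF sol that] by (auto intro!: derivative_eq_intros)
  qed (use B x in auto)
  then show ?thesis unfolding rho_def using Y_pos[OF x] by (simp add: field_simps)
qed

text \<open>By \<open>rising_imp_high\<close> a \<open>rho\<close> rising from -\<infinity> lies
  above \<open>rs\<close> from the start. If it takes a value up to 2/5, the angle excludes it on
  the half-line to the left; otherwise it stays away from \<open>rs\<close> and the energy
  does.\<close>

lemma not_rising:
  assumes x: "x \<le> 0" and de: "\<And>z. z \<le> x \<Longrightarrow> 0 < de z"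
  shows False
proof -
  obtain x0 where x0: "x0 \<le> 0" "\<And>z. z \<le> x0 \<Longrightarrow> 0 < B z" using ex_B_pos by blast
  define w where "w = min x x0"
  have w: "w \<le> 0" "w \<le> x" "w \<le> x0" unfolding w_def using x by auto
  have inc: "r y < r z" if "y < z" "z \<le> w" for y z
    by (rule r_less[OF that(1)]) (use that w de in auto)
  have inc': "r y \<le> r z" if "y \<le> z" "z \<le> w" for y z
    using inc[of y z] that by (cases "y = z") auto
  have high: "rs < r z" if "z \<le> w" for z
  proof -
    have "rs \<le> r (z - 1)"
      by (rule rising_imp_high) (use that w inc' in auto)
    also have "\<dots> < r z" by (rule inc) (use that in auto)
    finally show ?thesis .
  qed
  show False
  proof (cases "\<exists>z\<le>w. r z \<le> 2 / 5")
    case True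
    then obtain z where z: "z \<le> w" "r z \<le> 2 / 5" by blast
    interpret o: orbit \<mu> "{..z}" Y A B by (rule orbit_left) (use z w x0 in auto)
    show False
    proof (rule o.not_one_sided)
      fix y assume "y \<in> {..z}"
      then have y: "y \<le> z" "y \<le> w" using z(1) by auto
      show "1 / 7 \<le> r y" using high[OF y(2)] rs_bounds by linarith
      show "r y \<le> 2 / 5" using inc'[OF y(1) z(1)] z(2) by linarith
      show "r y \<noteq> rs" using high[OF y(2)] by simp
    qed
  next
    case False
    interpret o: orbit \<mu> "{..w}" Y A B by (rule orbit_left) (use w x0 in auto)
    show False
    proof (rule o.not_above[of "r w" "2 / 5 - 1 / 3"])
      fix y assume "y \<in> {..w}"
      then have y: "y \<le> w" by simp
      show "r y \<le> r w" by (rule inc'[OF y order_refl])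
      show "ch y < 1" by (rule ch_less_1) (use y w in simp)
      have "2 / 5 < r y" using False y by force
      then show "rs + (2 / 5 - 1 / 3) \<le> r y" using rs_bounds by linarith
    qed simp
  qed
qed

lemma not_falling:
  assumes x: "x \<le> 0" and de: "\<And>z. z \<le> x \<Longrightarrow> de z < 0"
  shows False
proof -
  obtain x0 where x0: "x0 \<le> 0" "\<And>z. z \<le> x0 \<Longrightarrow> 0 < B z" using ex_B_pos by blast
  define w where "w = min x x0"
  have w: "w \<le> 0" "w \<le> x" "w \<le> x0" unfolding w_def using x by auto
  have dec: "r z < r y" if "y < z" "z \<le> w" for y z
    by (rule r_greater[OF that(1)]) (use that w de in auto)
  have dec': "r z \<le> r y" if "y \<le> z" "z \<le> w" for y z
    using dec[of y z] that by (cases "y = z") auto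
  have low: "r z < rs" if "z \<le> w" for z
  proof -
    have "r z < r (z - 1)" by (rule dec) (use that in auto)
    also have "r (z - 1) \<le> rs"
      by (rule falling_imp_low) (use that w dec' in auto)
    finally show ?thesis .
  qed
  show False
  proof (cases "\<exists>z\<le>w. 1 / 7 \<le> r z")
    case True
    then obtain z where z: "z \<le> w" "1 / 7 \<le> r z" by blast
    interpret o: orbit \<mu> "{..z}" Y A B by (rule orbit_left) (use z w x0 in auto)
    show False
    proof (rule o.not_one_sided)
      fix y assume "y \<in> {..z}"
      then have y: "y \<le> z" "y \<le> w" using z(1) by auto
      show "r y \<le> 2 / 5" using low[OF y(2)] rs_bounds by linarith
      show "1 / 7 \<le> r y" using dec'[OF y(1) z(1)] z(2) by linarith
      show "r y \<noteq> rs" using low[OF y(2)] by simp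
    qed
  next
    case False
    interpret o: orbit \<mu> "{..w}" Y A B by (rule orbit_left) (use w x0 in auto)
    show False
    proof (rule o.not_below[of "1 / 7" "min (r w) (1 / 42)"])
      fix y assume "y \<in> {..w}"
      then have y: "y \<le> w" by simp
      have r7: "r y < 1 / 7" using False y by force
      then show "r y \<le> 1 / 7" by simp
      show "ch y < 1" by (rule ch_less_1) (use y w in simp)
      show "min (r w) (1 / 42) \<le> r y" using dec'[OF y order_refl] by simp
      show "r y \<le> rs - min (r w) (1 / 42)" using r7 rs_bounds by auto
    qed (use r_pos[OF w(1)] in auto)
  qed
qed

text \<open>A rise cannot extend back to -\<infinity>, so it begins at a zero of \<open>dlt\<close>,
  which cannot be one above \<open>rs\<close> because there \<open>rho\<close> would begin to
  fall.\<close>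

lemma rise_start:
  assumes x: "x \<le> 0" "0 < de x"
  obtains c where "c < x" "de c = 0" "\<And>z. c < z \<Longrightarrow> z \<le> x \<Longrightarrow> 0 < de z" "r c \<le> rs"
proof -
  obtain a where a: "a \<le> x" "de a \<le> 0" using not_rising[OF x(1)] by (meson not_less)
  obtain c where c: "a \<le> c" "c < x" "de c = 0" "\<And>z. c < z \<Longrightarrow> z \<le> x \<Longrightarrow> 0 < de z"
    by (rule last_zero[OF r_continuous(3)[OF x(1)] a(1,2) x(2)]) (rule that; assumption)
  have c0: "c \<in> {..0}" "0 < Y c" "0 < A c" using c(2) x(1) Y_pos[of c] A_pos[of c] by auto
  have rc: "r c \<le> rs"
  proof (rule ccontr)
    assume "\<not> r c \<le> rs"
    then have "rs < r c" by simp
    from dlt_zero_high[OF sol c0 c(3) this] obtain d where d: "0 < d"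
      "\<And>y. y \<in> {..0} \<Longrightarrow> c < y \<Longrightarrow> y < c + d \<Longrightarrow> de y < 0" by metis
    define y where "y = min x (c + d / 2)"
    have "c < y" "y \<le> x" "y < c + d" unfolding y_def using d(1) c(2) by auto
    then show False using d(2)[of y] c(4)[of y] x(1) by auto
  qed
  show ?thesis by (rule that[OF c(2,3) _ rc]) (rule c(4))
qed

lemma fall_start:
  assumes x: "x \<le> 0" "de x < 0"
  obtains c where "c < x" "de c = 0" "\<And>z. c < z \<Longrightarrow> z \<le> x \<Longrightarrow> de z < 0" "rs \<le> r c"
proof -
  obtain a where a: "a \<le> x" "0 \<le> de a" using not_falling[OF x(1)] by (meson not_less)
  have "continuous_on {a..x} (\<lambda>z. - de z)"
    by (intro continuous_intros r_continuous(3)[OF x(1)])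
  then obtain c where "a \<le> c" "c < x" "- de c = 0" "\<And>z. c < z \<Longrightarrow> z \<le> x \<Longrightarrow> 0 < - de z"
    by (rule last_zero[OF _ a(1)]) (use a(2) x(2) that in auto)
  then have c: "a \<le> c" "c < x" "de c = 0" "\<And>z. c < z \<Longrightarrow> z \<le> x \<Longrightarrow> de z < 0" by auto
  have c0: "c \<in> {..0}" "0 < Y c" "0 < A c" using c(2) x(1) Y_pos[of c] A_pos[of c] by auto
  have rc: "rs \<le> r c"
  proof (rule ccontr)
    assume "\<not> rs \<le> r c"
    then have "r c < rs" by simp
    from dlt_zero_low[OF sol c0 c(3) this] obtain d where d: "0 < d"
      "\<And>y. y \<in> {..0} \<Longrightarrow> c < y \<Longrightarrow> y < c + d \<Longrightarrow> 0 < de y" by metis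
    define y where "y = min x (c + d / 2)"
    have "c < y" "y \<le> x" "y < c + d" unfolding y_def using d(1) c(2) by auto
    then show False using d(2)[of y] c(4)[of y] x(1) by auto
  qed
  show ?thesis by (rule that[OF c(2,3) _ rc]) (rule c(4))
qed

text \<open>A common point of the two orbits would give the solution the positive limit
  \<open>Y x / F y\<close> at -\<infinity>.\<close>

lemma off_F:
  assumes "x \<le> 0" "y \<in> I" "R y = r x" "X y = ch x"
  shows False
proof -
  have "(Y \<longlongrightarrow> Y x / F y) at_bot"
    by (rule meets_F[OF sol_subset[OF sol sub(1)[OF assms(1)]]])
      (use assms Y_pos[OF assms(1)] A_pos[OF assms(1)] in auto)
  then have "Y x / F y = 0" by (rule tendsto_unique[OF trivial_limit_at_bot_linorder _ Y_lim0])
  then show False using Y_pos[OF assms(1)] FYA_pos(1)[OF assms(2)] by simp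
qed

context
  fixes t1 t2 :: real
  assumes tt: "turns t1 t2"
begin

text \<open>The preceding minimum lies on the line chi = 2 rho below the level \<open>R t1\<close>,
  and the level is reached while rising, that is above the tip of the arc. The path in between would
  cross the rising arc.\<close>

lemma below_max_rising:
  assumes x: "x \<le> 0" "0 < de x" "R t1 \<le> r x"
  shows False
proof -
  obtain c where c: "c < x" "de c = 0" "\<And>z. c < z \<Longrightarrow> z \<le> x \<Longrightarrow> 0 < de z" "r c \<le> rs"
    using rise_start[OF x(1,2)] by metis
  have rc: "r c < R t1" using c(4) turnsD(8)[OF tt] by simp
  obtain y where y: "c \<le> y" "y \<le> x" "r y = R t1"
    using IVT'[of r c "R t1" x] rc x(3) c(1) r_continuous(1)[OF x(1), of c] by auto
  have cy: "c < y" using y rc by (cases "c = y") auto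
  have y0: "y \<le> 0" using y(2) x(1) by simp
  have bd: "0 < r z \<and> r z \<le> R t1" if "z \<in> {c..y}" for z
  proof -
    have "r z \<le> r y"
      using r_less[of z y] y0 c(3) that y(2) by (cases "z = y") auto
    then show ?thesis using r_pos[of z] that y0 y(3) by simp
  qed
  have "r c = R t1 \<and> 2 * R t1 \<le> ch c \<and> ch y \<le> 2 * r y \<or>
      r y = R t1 \<and> 2 * R t1 \<le> ch y \<and> ch c \<le> 2 * r c"
    using c(3)[OF cy y(2)] c(2) y(3) unfolding dlt_def by simp
  from cross_up[OF tt r_continuous(1,2)[OF y0] y(1) bd this]
  obtain z w where "z \<in> {c..y}" "w \<in> I" "R w = r z" "X w = ch z" by metis
  then show False using off_F[of z w] y0 by simp
qed

text \<open>Just to the left the solution is rising, and unless \<open>x\<close> is exactly the tip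
  of the arc it is already at the level \<open>R t1\<close> or attains it before \<open>x\<close>.
  The tip itself is excluded by \<open>off_F\<close>.\<close>

lemma below_max_still:
  assumes x: "x \<le> 0" "de x = 0" "R t1 \<le> r x"
  shows False
proof -
  have "rs < r x" using x(3) turnsD(8)[OF tt] by simp
  moreover have x0: "x \<in> {..0}" using x by simp
  ultimately obtain d where d: "0 < d" "\<And>y. y \<in> {..0} \<Longrightarrow> x - d < y \<Longrightarrow> y < x \<Longrightarrow> 0 < de y"
    using dlt_zero_high[OF sol x0 Y_pos[OF x(1)] A_pos[OF x(1)] x(2)] by metis
  define y where "y = x - d / 2"
  have y: "x - d < y" "y < x" unfolding y_def using d(1) by auto
  have dy: "0 < de z" if "y \<le> z" "z < x" for z using d(2)[of z] that y x(1) by simp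
  show False
  proof (cases "R t1 \<le> r y")
    case True
    then show False using below_max_rising[of y] dy[of y] y x(1) by simp
  next
    case False
    have "R t1 \<noteq> r x"
    proof
      assume "R t1 = r x"
      then show False
        using off_F[OF x(1) turnsD(1)[OF tt]] turnsD(5)[OF tt] x(2) unfolding dlt_def by simp
    qed
    obtain z where z: "y \<le> z" "z \<le> x" "r z = R t1"
      using IVT'[of r y "R t1" x] False x(3) y(2) r_continuous(1)[OF x(1), of y] by auto
    have "z < x" using z \<open>R t1 \<noteq> r x\<close> by (cases "z = x") auto
    then show False using below_max_rising[of z] dy[OF z(1)] z(3) x(1) by simp
  qed
qed

lemma below_max:
  assumes x: "x \<le> 0"
  shows "r x < R t1"
proof (rule ccontr)
  assume "\<not> r x < R t1"
  then have ge: "R t1 \<le> r x" by simp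
  consider "0 < de x" | "de x = 0" | "de x < 0" by linarith
  then show False
  proof cases
    case 3
    obtain c where c: "c < x" "de c = 0" "\<And>z. c < z \<Longrightarrow> z \<le> x \<Longrightarrow> de z < 0" "rs \<le> r c"
      using fall_start[OF x 3] by metis
    have "r x < r c" by (rule r_greater[OF c(1) x]) (use c(3) in auto)
    then show False using below_max_still[of c] c(1,2) x ge by simp
  qed (use below_max_rising below_max_still x ge in auto)
qed

lemma no_crossing_down:
  assumes e: "e < y" "y \<le> 0" "de e = 0" "\<And>z. e < z \<Longrightarrow> z \<le> y \<Longrightarrow> de z < 0" and r: "R t2 \<le> r y"
    and end_y: "ch y \<le> 0 \<or> r y = R t2"
  shows False
proof -
  have bd: "R t2 \<le> r z \<and> r z \<le> R t1" if "z \<in> {e..y}" for z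
  proof -
    have "r y \<le> r z"
      using r_greater[of z y] e that by (cases "z = y") auto
    then show ?thesis using below_max[of z] that e(2) r by simp
  qed
  have "2 * r e \<le> ch e \<and> (ch y \<le> 0 \<or> r y = R t2 \<and> ch y \<le> 2 * R t2)"
    using e(4)[OF e(1) order_refl] e(3) end_y unfolding dlt_def by auto
  from cross_down[OF tt r_continuous(1,2)[OF e(2)] less_imp_le[OF e(1)] bd this]
  obtain z w where "z \<in> {e..y}" "w \<in> I" "R w = r z" "X w = ch z" by metis
  then show False using off_F[of z w] e(2) by simp
qed

lemma above_min_falling:
  assumes x: "x \<le> 0" "de x < 0" "r x \<le> R t2"
  shows False
proof -
  obtain c where c: "c < x" "de c = 0" "\<And>z. c < z \<Longrightarrow> z \<le> x \<Longrightarrow> de z < 0" "rs \<le> r c"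
    using fall_start[OF x(1,2)] by metis
  have rc: "R t2 < r c" using c(4) turnsD(9)[OF tt] by simp
  obtain y where y: "c \<le> y" "y \<le> x" "r y = R t2"
    using IVT2'[of r x "R t2" c] rc x(3) c(1) r_continuous(1)[OF x(1), of c] by auto
  have cy: "c < y" using y rc by (cases "c = y") auto
  show False
    by (rule no_crossing_down[OF cy _ c(2)]) (use y x(1) c(3) in auto)
qed

lemma above_min_still:
  assumes x: "x \<le> 0" "de x = 0" "r x \<le> R t2"
  shows False
proof -
  have "r x < rs" using x(3) turnsD(9)[OF tt] by simp
  moreover have x0: "x \<in> {..0}" using x by simp
  ultimately obtain d where d: "0 < d" "\<And>y. y \<in> {..0} \<Longrightarrow> x - d < y \<Longrightarrow> y < x \<Longrightarrow> de y < 0"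
    using dlt_zero_low[OF sol x0 Y_pos[OF x(1)] A_pos[OF x(1)] x(2)] by metis
  define y where "y = x - d / 2"
  have y: "x - d < y" "y < x" unfolding y_def using d(1) by auto
  have dy: "de z < 0" if "y \<le> z" "z < x" for z using d(2)[of z] that y x(1) by simp
  show False
  proof (cases "r y \<le> R t2")
    case True
    then show False using above_min_falling[of y] dy[of y] y x(1) by simp
  next
    case False
    have "R t2 \<noteq> r x"
    proof
      assume "R t2 = r x"
      then show False
        using off_F[OF x(1) turnsD(2)[OF tt]] turnsD(7)[OF tt] x(2) unfolding dlt_def by simp
    qed
    obtain z where z: "y \<le> z" "z \<le> x" "r z = R t2"
      using IVT2'[of r x "R t2" y] False x(3) y(2) r_continuous(1)[OF x(1), of y] by auto
    have "z < x" using z \<open>R t2 \<noteq> r x\<close> by (cases "z = x") auto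
    then show False using above_min_falling[of z] dy[OF z(1)] z(3) x(1) by simp
  qed
qed

lemma above_min:
  assumes x: "x \<le> 0"
  shows "R t2 < r x"
proof (rule ccontr)
  assume "\<not> R t2 < r x"
  then have ge: "r x \<le> R t2" by simp
  consider "0 < de x" | "de x = 0" | "de x < 0" by linarith
  then show False
  proof cases
    case 1
    obtain c where c: "c < x" "de c = 0" "\<And>z. c < z \<Longrightarrow> z \<le> x \<Longrightarrow> 0 < de z" "r c \<le> rs"
      using rise_start[OF x 1] by metis
    have "r c < r x" by (rule r_less[OF c(1) x]) (use c(3) in auto)
    then show False using above_min_still[of c] c(1,2) x ge by simp
  qed (use above_min_falling above_min_still x ge in auto)
qed

text \<open>A point with \<open>B \<le> 0\<close> has chi \<le> 0, hence is falling, and the path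
  from the last maximum down to it stays over the range of the falling arc of the series. On that
  arc chi is positive, so the path would cross it.\<close>

lemma B_pos:
  assumes x: "x \<le> 0"
  shows "0 < B x"
proof (rule ccontr)
  assume "\<not> 0 < B x"
  then have ch: "ch x \<le> 0"
    using A_pos[OF x] Y_pos[OF x] unfolding chi_def by (simp add: divide_nonpos_pos)
  then have "de x < 0" using r_pos[OF x] unfolding dlt_def by simp
  then obtain c where c: "c < x" "de c = 0" "\<And>z. c < z \<Longrightarrow> z \<le> x \<Longrightarrow> de z < 0" "rs \<le> r c"
    using fall_start[OF x] by metis
  show False
    by (rule no_crossing_down[OF c(1) x c(2)]) (use c(3) above_min[OF x] ch in auto)
qed

end

end

section \<open>Solutions with a positive limit\<close>

context halfline
begin

text \<open>To the left of \<open>x\<close> the function \<open>A\<close> is at most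
  \<open>A x\<close>, so integrating the derivative of \<open>J\<close> gives
  \<open>J x \<le> (1 + \<mu>) * A x * (Y x - lam)\<close>. Near the limit this is too small to make
  \<open>B = Y A - J\<close> drop below half of \<open>lam * A\<close>.\<close>

lemma B_ge_A:
  assumes x: "x \<le> 0" "0 < B x" "Y x \<le> 3 / 2 * lam"
  shows "lam / 2 * A x \<le> B x"
proof -
  have A_le: "A y \<le> A x" if "y \<le> x" for y
  proof (rule deriv_nonneg_mono[OF solD(2)[OF sol] sub(2)[OF x(1)] _ that])
    fix z assume "y < z" "z < x"
    then show "0 \<le> B z" using B_pos_left[of z x] x by simp
  qed auto
  have "((\<lambda>w. (1 + \<mu>) * A x * (Y w - lam) - J w) \<longlongrightarrow> (1 + \<mu>) * A x * (lam - lam) - 0) at_bot"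
    by (intro tendsto_intros Y_lim J_lim)
  then have "(1 + \<mu>) * A x * (lam - lam) - 0 \<le> (1 + \<mu>) * A x * (Y x - lam) - J x"
  proof (rule deriv_at_bot_le)
    show "((\<lambda>w. (1 + \<mu>) * A x * (Y w - lam) - J w) has_real_derivative
        (1 + \<mu>) * A x * A w - (1 + \<mu>) * (A w)\<^sup>2) (at w within {..0})" if "w \<in> {..0}" for w
      using solD(1)[OF sol that] J_deriv[OF that] by (auto intro!: derivative_eq_intros)
    fix w assume w: "w < x"
    have "(1 + \<mu>) * A w * A w \<le> (1 + \<mu>) * A w * A x"
      using A_le[of w] A_pos[of w] w x(1) mu_pos by (intro mult_left_mono) auto
    then show "0 \<le> (1 + \<mu>) * A x * A w - (1 + \<mu>) * (A w)\<^sup>2"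
      by (simp add: power2_eq_square mult_ac)
  qed (use x in auto)
  then have J: "J x \<le> (1 + \<mu>) * A x * (Y x - lam)" by simp
  have "\<mu> * (Y x - lam) \<le> 1 * (lam / 2)"
    using x(3) lam_le[OF x(1)] mu_pos mu_less by (intro mult_mono) auto
  then have "A x * (lam / 2) \<le> A x * (lam - \<mu> * (Y x - lam))"
    using A_pos[OF x(1)] by (intro mult_left_mono) auto
  also have "\<dots> = Y x * A x - (1 + \<mu>) * A x * (Y x - lam)" by (simp add: algebra_simps)
  finally show ?thesis using J unfolding J_def by (simp add: mult.commute)
qed

text \<open>Matching one value close to the limit selects the translate of the series. Uniqueness
  from -\<infinity> gives agreement up to that point, and ordinary uniqueness continues it. The
  continuation reaches 0 because otherwise \<open>B\<close> would follow the unbounded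
  \<open>FB\<close> inside a compact interval.\<close>

lemma positive_limit:
  assumes l: "0 < lam"
  shows "\<exists>e\<in>I. \<forall>x\<le>0. Y x = lam * F (lam * x + e) \<and> A x = lam\<^sup>2 * FA (lam * x + e) \<and> B x = lam ^ 3 * FB (lam * x + e)"
proof -
  have n1: "-1 \<in> I" by (rule neg_in_I) simp
  obtain x0 where x0: "x0 \<le> 0" "\<And>z. z \<le> x0 \<Longrightarrow> 0 < B z" using ex_B_pos by blast
  \<comment> \<open>41/40 is the closeness demanded by \<open>asymptotic_unique\<close>; the bound
    by \<open>lam * F (-1)\<close> ensures that the value at \<open>T\<close> is attained by the
    scaled series in the region where convergence is known.\<close>
  have "lam < lam * (41 / 40)" "lam < lam * F (-1)"
    using l F_gt_1[OF n1] by simp_all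
  then have "\<forall>\<^sub>F x in at_bot. Y x < lam * (41 / 40) \<and> Y x < lam * F (-1) \<and> x \<le> x0"
    by (intro eventually_conj order_tendstoD(2)[OF Y_lim] eventually_le_at_bot)
  from eventually_happens'[OF trivial_limit_at_bot_linorder this]
  obtain T where T: "Y T < lam * (41 / 40)" "Y T < lam * F (-1)" "T \<le> x0" by (elim exE conjE)
  have T0: "T \<le> 0" using T(3) x0(1) by simp
  have YT: "lam < Y T" using Y_less[of "T - 1" T] lam_le[of "T - 1"] T0 by simp
  obtain s where s: "s \<in> I" "lam * F s = Y T"
  proof -
    have "1 < Y T / lam" using YT l by simp
    then have "\<forall>\<^sub>F x in at_bot. F x < Y T / lam \<and> x \<le> -1"
      by (intro eventually_conj order_tendstoD(2)[OF F_lim] eventually_le_at_bot)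
    from eventually_happens'[OF trivial_limit_at_bot_linorder this]
    obtain u where u: "F u < Y T / lam" "u \<le> -1" by (elim exE conjE)
    have "continuous_on {u..-1} F"
      by (rule continuous_on_subset[OF sol_continuous(1)[OF F_sol] I_Icc[OF n1]])
    moreover have "Y T / lam \<le> F (-1)" using T(2) l by (simp add: pos_divide_le_eq mult.commute less_imp_le)
    ultimately obtain s where s: "u \<le> s" "s \<le> -1" "F s = Y T / lam"
      using IVT'[of F u "Y T / lam" "-1"] u by auto
    show ?thesis by (rule that[OF I_down[OF n1 s(2)]]) (use s(3) l in simp)
  qed
  define e where "e = s - lam * T"
  define Y2 A2 B2 where d2: "Y2 = (\<lambda>x. lam * F (lam * x + e))" "A2 = (\<lambda>x. lam\<^sup>2 * FA (lam * x + e))"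
    "B2 = (\<lambda>x. lam ^ 3 * FB (lam * x + e))"
  have sol2: "sol \<mu> {..x} Y2 A2 B2" if "lam * x + e \<in> I" for x
    unfolding d2
  proof (rule sol_scale[OF F_sol])
    fix z assume "z \<in> {..x}"
    then have "lam * z + e \<le> lam * x + e" using l by simp
    then show "lam * z + e \<in> I" by (rule I_down[OF that])
  qed
  have eT: "lam * T + e = s" unfolding e_def by simp
  have inI: "lam * z + e \<in> I" if "z \<le> T" for z
  proof (rule I_down[OF s(1)])
    have "lam * z \<le> lam * T" using that l by simp
    then show "lam * z + e \<le> s" using eT by linarith
  qed
  have lin: "LIM z at_bot. lam * z + e :> at_bot" by (rule affine_at_bot[OF l])
  have lim2: "(Y2 \<longlongrightarrow> lam) at_bot" "(A2 \<longlongrightarrow> 0) at_bot" "(B2 \<longlongrightarrow> 0) at_bot"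
    unfolding d2
    using tendsto_mult_left[OF filterlim_compose[OF F_lim lin], of lam]
      tendsto_mult_left[OF filterlim_compose[OF FA_lim lin], of "lam\<^sup>2"]
      tendsto_mult_left[OF filterlim_compose[OF FB_lim lin], of "lam ^ 3"] by simp_all
  have match: "Y x = Y2 x \<and> A x = A2 x \<and> B x = B2 x" if x: "x \<le> T" for x
  proof (rule asymptotic_unique[OF _ _ l sol_subset[OF sol sub(1)[OF T0]] sol2[OF inI[OF order_refl]]
        _ _ _ _ Y_lim lim2(1) A_lim lim2(2) B_lim lim2(3) _ _ x])
    show "0 \<le> \<mu>" "\<mu> \<le> 1" using mu_pos mu_less by auto
    show "Y T = Y2 T" unfolding d2 eT using s(2) by simp
    show "Y T - lam \<le> lam / 40" using T(1) by simp
    fix z assume z: "z \<le> T"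
    then have z0: "z \<le> 0" using T0 by simp
    show "0 < A z" by (rule A_pos[OF z0])
    show "0 < A2 z" unfolding d2 using FYA_pos(2)[OF inI[OF z]] l by simp
    show "lam / 2 * A z \<le> B z"
      by (rule B_ge_A[OF z0 x0(2)]) (use z T Y_le[OF z T0] l in auto)
    have "lam / 2 * (lam\<^sup>2 * FA (lam * z + e)) \<le> lam * (lam\<^sup>2 * FB (lam * z + e))"
      using FA_le_FB[OF inI[OF z]] FYA_pos(2)[OF inI[OF z]] l by (intro mult_mono) auto
    then show "lam / 2 * A2 z \<le> B2 z" unfolding d2 by (simp add: power2_eq_square power3_eq_cube)
  qed
  have extend: "Y z = Y2 z \<and> A z = A2 z \<and> B z = B2 z"
    if x: "x \<le> 0" "T \<le> x" "lam * x + e \<in> I" and z: "z \<le> x" for x z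
    using sol_unique[OF sol_subset[OF sol sub(1)[OF x(1)]] sol2[OF x(3)], of T z] match[OF order_refl] x(2) z
    by (simp add: is_interval_ic)
  have "e \<in> I"
  proof (rule ccontr)
    assume "e \<notin> I"
    then have less: "y < e" if "y \<in> I" for y using I_down[OF that, of e] by force
    have "continuous_on {T..0} B"
      by (rule continuous_on_subset[OF sol_continuous(3)[OF sol]]) auto
    then have "bounded (B ` {T..0})"
      by (intro compact_imp_bounded compact_continuous_image) simp_all
    then obtain M where "\<forall>v\<in>B ` {T..0}. \<bar>v\<bar> \<le> M" unfolding bounded_iff by auto
    then have M: "\<bar>B z\<bar> \<le> M" if "z \<in> {T..0}" for z using that by simp
    obtain y where y: "y \<in> I" "max (FB s) (M / lam ^ 3) < FB y" using T2_unbounded by blast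
    have sy: "s < y" using FB_mono[OF y(1) s(1)] y(2) by force
    define x where "x = (y - e) / lam"
    have xy: "lam * x + e = y" unfolding x_def using l by simp
    have "lam * T < lam * x" using sy eT xy by linarith
    then have Tx: "T \<le> x" using l by simp
    have x0: "x \<le> 0" unfolding x_def using less[OF y(1)] l by (simp add: divide_nonpos_pos)
    have "B x = lam ^ 3 * FB y" using extend[OF x0 Tx _ order_refl] xy y(1) unfolding d2 by simp
    then have "lam ^ 3 * FB y \<le> M" using M[of x] Tx x0 by simp
    then have "FB y \<le> M / lam ^ 3" using l by (simp add: pos_le_divide_eq mult.commute)
    then show False using y(2) by simp
  qed
  then show ?thesis using extend[OF order_refl T0] unfolding d2 by auto
qed

end

section \<open>Counting the solutions of the boundary value problem\<close>

text \<open>The tangent-line criterion is used with derivatives within \<open>S\<close>, which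
  covers the closed end point 0 of the half-line.\<close>

lemma convex_on_if_deriv2_nonneg:
  fixes f f1 f2 :: "real \<Rightarrow> real"
  assumes S: "convex S"
    and f: "\<And>x. x \<in> S \<Longrightarrow> (f has_real_derivative f1 x) (at x within S)"
    and f1: "\<And>x. x \<in> S \<Longrightarrow> (f1 has_real_derivative f2 x) (at x within S)"
    and f2: "\<And>x. x \<in> S \<Longrightarrow> 0 \<le> f2 x"
  shows "convex_on S f"
proof (rule pos_convex_function[OF S])
  have iv: "is_interval S" using S by (simp add: is_interval_convex_1)
  have sub: "{x..y} \<subseteq> S" if "x \<in> S" "y \<in> S" for x y
    using mem_is_interval_1_I[OF iv that] by auto
  have mono: "f1 x \<le> f1 y" if "x \<in> S" "y \<in> S" "x \<le> y" for x y
  proof (rule deriv_nonneg_mono[OF f1 sub[OF that(1,2)] _ that(3)])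
    fix z assume "x < z" "z < y"
    then have "z \<in> S" by (intro subsetD[OF sub[OF that(1,2)], of z]) simp
    then show "0 \<le> f2 z" by (rule f2)
  qed
  fix x y assume xy: "x \<in> S" "y \<in> S"
  have d: "((\<lambda>z. f z - f1 x * z) has_real_derivative f1 z - f1 x) (at z within S)"
    "((\<lambda>z. f1 x * z - f z) has_real_derivative f1 x - f1 z) (at z within S)" if "z \<in> S" for z
    using f[OF that] by (auto intro!: derivative_eq_intros)
  show "f1 x * (y - x) \<le> f y - f x"
  proof (cases "x \<le> y")
    case True
    have "f x - f1 x * x \<le> f y - f1 x * y"
    proof (rule deriv_nonneg_mono[where g = "\<lambda>z. f z - f1 x * z", OF d(1) sub[OF xy] _ True])
      fix z assume z: "x < z" "z < y"
      then have "z \<in> S" by (intro subsetD[OF sub[OF xy], of z]) simp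
      then show "0 \<le> f1 z - f1 x" using mono[OF xy(1), of z] z by simp
    qed
    then show ?thesis by (simp add: algebra_simps)
  next
    case False
    have "f1 x * y - f y \<le> f1 x * x - f x"
    proof (rule deriv_nonneg_mono[where g = "\<lambda>z. f1 x * z - f z", OF d(2) sub[OF xy(2,1)]])
      fix z assume z: "y < z" "z < x"
      then have "z \<in> S" by (intro subsetD[OF sub[OF xy(2,1)], of z]) simp
      then show "0 \<le> f1 x - f1 z" using mono[OF _ xy(1), of z] z by simp
    qed (use False in auto)
    then show ?thesis by (simp add: algebra_simps)
  qed
qed

lemma affine_at_top: "0 < k \<Longrightarrow> LIM z at_top. - k * z + e :> at_bot" for k e :: real
  by real_asymp

lemma neg_affine_at_bot: "0 < k \<Longrightarrow> LIM z at_bot. - k * z + e :> at_top" for k e :: real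
  by real_asymp

section \<open>Translation between the boundary value problem and the rescaled equation\<close>

locale problem =
  fixes m :: real
  assumes m: "0 < m" "m < 1"
begin

definition \<alpha> :: real where "\<alpha> = (m + 1) / 2"

lemma alpha_pos: "0 < \<alpha>"
  unfolding \<alpha>_def using m by simp

sublocale exponent "m / \<alpha>"
  by standard (use m in \<open>auto simp: \<alpha>_def\<close>)

text \<open>The factor \<open>a / F e\<close> produces the initial value \<open>a\<close>, and
  \<open>- \<alpha>\<close> reverses and rescales time. The remaining parameter \<open>e\<close> is
  the point of the series orbit at time 0; the slope -1 there is the condition on \<open>R e\<close>
  in \<open>fam_in\<close>.\<close>

definition fam :: "real \<Rightarrow> real \<Rightarrow> real \<Rightarrow> real" where
  "fam a e = restrict (\<lambda>t. a / F e * F (- (\<alpha> * (a / F e)) * t + e)) {0..}"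

lemma fam_in:
  assumes a: "0 < a" and e: "e \<in> I" "\<alpha> * R e * a\<^sup>2 = 1"
  shows "fam a e \<in> bvp_solutions m a"
proof -
  define k where "k = a / F e"
  have Fe: "0 < F e" using FYA_pos(1)[OF e(1)] .
  have k: "0 < k" unfolding k_def using a Fe by simp
  define q where "q = - (\<alpha> * k)"
  have inI: "q * t + e \<in> I" if "t \<in> {0..}" for t
  proof (rule I_down[OF e(1)])
    show "q * t + e \<le> e" unfolding q_def using that k alpha_pos by simp
  qed
  define f1 f2 f3 where "f1 t = k * (FA (q * t + e) * q)"
    and "f2 t = k * (FB (q * t + e) * q * q)"
    and "f3 t = k * ((F (q * t + e) * FB (q * t + e) - m / \<alpha> * (FA (q * t + e))\<^sup>2) * q * q * q)" for t
  have d: "((\<lambda>t. g (q * t + e)) has_real_derivative g' * q) (at t within {0..})"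
    if "t \<in> {0..}" "(g has_real_derivative g') (at (q * t + e) within I)" for t g g'
    by (rule deriv_affine[OF that(2) inI that(1)])
  have "(fam a e has_real_derivative f1 t) (at t within {0..})" if t: "t \<ge> 0" for t
  proof -
    have "((\<lambda>t. k * F (q * t + e)) has_real_derivative f1 t) (at t within {0..})"
      unfolding f1_def using DERIV_cmult[OF d[OF _ solD(1)[OF F_sol inI]], of t k] t by simp
    then show ?thesis
      by (rule has_field_derivative_transform_within[where d = 1])
        (use t in \<open>auto simp: fam_def k_def q_def\<close>)
  qed
  moreover have "(f1 has_real_derivative f2 t) (at t within {0..})" if t: "t \<ge> 0" for t
    unfolding f1_def[abs_def] f2_def
    using DERIV_cmult[OF DERIV_cmult_right[OF d[OF _ solD(2)[OF F_sol inI]]], of t q k] t by (simp add: mult_ac)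
  moreover have "(f2 has_real_derivative f3 t) (at t within {0..})" if t: "t \<ge> 0" for t
    unfolding f2_def[abs_def] f3_def
    using DERIV_cmult[OF DERIV_cmult_right[OF d[OF _ solD(3)[OF F_sol inI]]], of t "q * q" k] t by (simp add: mult_ac)
  moreover have "f3 t + (m + 1) / 2 * fam a e t * f2 t - m * (f1 t)\<^sup>2 = 0" if t: "t \<ge> 0" for t
  proof -
    have "fam a e t = k * F (q * t + e)" unfolding fam_def k_def q_def using t by simp
    moreover have "k * ((X * Z - m / \<alpha> * W\<^sup>2) * q * q * q) + \<alpha> * (k * X) * (k * (Z * q * q)) - m * (k * (W * q))\<^sup>2 = 0" for X Z W
      unfolding q_def using alpha_pos by (simp add: field_simps power2_eq_square)
    ultimately show ?thesis unfolding f1_def f2_def f3_def \<alpha>_def[symmetric] by simp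
  qed
  moreover have "fam a e 0 = a" unfolding fam_def using Fe by simp
  moreover have "f1 0 = -1"
  proof -
    have "f1 0 = - (\<alpha> * R e * a\<^sup>2)"
      unfolding f1_def q_def k_def rho_def using Fe by (simp add: power2_eq_square field_simps)
    then show ?thesis using e(2) by simp
  qed
  moreover have "(f1 \<longlongrightarrow> 0) at_top"
  proof -
    have "0 < \<alpha> * k" using alpha_pos k by simp
    from filterlim_compose[OF FA_lim affine_at_top[OF this, of e]]
    have "((\<lambda>t. FA (q * t + e)) \<longlongrightarrow> 0) at_top" unfolding q_def by simp
    then have "((\<lambda>t. k * (FA (q * t + e) * q)) \<longlongrightarrow> k * (0 * q)) at_top"
      by (intro tendsto_intros)
    then show ?thesis unfolding f1_def[abs_def] by simp
  qed
  moreover have "fam a e \<in> extensional {0..}" unfolding fam_def by simp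
  ultimately show ?thesis unfolding bvp_solutions_def by blast
qed

text \<open>The limit \<open>a / F e\<close> at \<infinity> can be read off the solution, and
  \<open>F\<close> is strictly increasing.\<close>

lemma fam_inj:
  assumes a: "0 < a" and e: "e \<in> I" "e' \<in> I" and eq: "fam a e = fam a e'"
  shows "e = e'"
proof -
  have lim: "(fam a e \<longlongrightarrow> a / F e) at_top" if e: "e \<in> I" for e
  proof -
    have Fe: "0 < F e" using FYA_pos(1)[OF e] .
    have "0 < \<alpha> * (a / F e)" using alpha_pos a Fe by simp
    from tendsto_mult_left[OF filterlim_compose[OF F_lim affine_at_top[OF this, of e]], of "a / F e"]
    have "((\<lambda>t. a / F e * F (- (\<alpha> * (a / F e)) * t + e)) \<longlongrightarrow> a / F e) at_top" by simp
    moreover have "\<forall>\<^sub>F t in at_top. a / F e * F (- (\<alpha> * (a / F e)) * t + e) = fam a e t"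
      by (intro eventually_mono[OF eventually_ge_at_top[of 0]]) (simp add: fam_def)
    ultimately show ?thesis by (rule Lim_transform_eventually)
  qed
  have "a / F e = a / F e'"
    using tendsto_unique[OF trivial_limit_at_top_linorder lim[OF e(1)]] lim[OF e(2)] eq by simp
  then have "F e = F e'" using a FYA_pos(1)[OF e(1)] FYA_pos(1)[OF e(2)] by (simp add: field_simps)
  then show ?thesis using F_strict_mono[OF e(1,2)] F_strict_mono[OF e(2,1)] by linarith
qed

lemma bvp_halfline:
  assumes f: "f \<in> bvp_solutions m a" and a: "0 < a"
  obtains Y A B where "halfline (m / \<alpha>) Y A B" "Y 0 = a" "A 0 = 1 / \<alpha>"
    "\<And>t. 0 \<le> t \<Longrightarrow> f t = Y (- \<alpha> * t)"
    "\<And>t. 0 \<le> t \<Longrightarrow> (f has_real_derivative - \<alpha> * A (- \<alpha> * t)) (at t within {0..})"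
    "\<And>t. 0 \<le> t \<Longrightarrow> ((\<lambda>t. - \<alpha> * A (- \<alpha> * t)) has_real_derivative \<alpha>\<^sup>2 * B (- \<alpha> * t)) (at t within {0..})"
proof -
  from f obtain f1 f2 f3 where
    d1: "\<And>t. t \<ge> 0 \<Longrightarrow> (f has_real_derivative f1 t) (at t within {0..})" and
    d2: "\<And>t. t \<ge> 0 \<Longrightarrow> (f1 has_real_derivative f2 t) (at t within {0..})" and
    d3: "\<And>t. t \<ge> 0 \<Longrightarrow> (f2 has_real_derivative f3 t) (at t within {0..})" and
    ode: "\<And>t. t \<ge> 0 \<Longrightarrow> f3 t + (m + 1) / 2 * f t * f2 t - m * (f1 t)\<^sup>2 = 0" and
    bc: "f 0 = a" "f1 0 = -1" "(f1 \<longlongrightarrow> 0) at_top"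
    unfolding bvp_solutions_def by auto
  define q where "q = - (1 / \<alpha>)"
  define Y A B where "Y x = f (q * x + 0)" and "A x = f1 (q * x + 0) * q" and "B x = f2 (q * x + 0) * q * q" for x
  have q: "q < 0" unfolding q_def using alpha_pos by simp
  have ge: "q * x + 0 \<in> {0..}" if "x \<in> {..0}" for x
    using that q by (simp add: mult_nonpos_nonpos)
  have d: "((\<lambda>x. g (q * x + 0)) has_real_derivative g' * q) (at x within {..0})"
    if "x \<in> {..0}" "(g has_real_derivative g') (at (q * x + 0) within {0..})" for x g g'
    by (rule deriv_affine[OF that(2) ge that(1)])
  have q\<alpha>: "q * (- \<alpha> * t) = t" "- \<alpha> * q = 1" for t unfolding q_def using alpha_pos by simp_all
  have "sol (m / \<alpha>) {..0} Y A B"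
    unfolding sol_def
  proof (intro ballI conjI)
    fix x :: real assume x: "x \<in> {..0}"
    have x0: "0 \<le> q * x + 0" using ge[OF x] by simp
    show "(Y has_real_derivative A x) (at x within {..0})"
      unfolding Y_def[abs_def] A_def by (rule d[OF x d1[OF x0]])
    show "(A has_real_derivative B x) (at x within {..0})"
      unfolding A_def[abs_def] B_def by (rule DERIV_cmult_right[OF d[OF x d2[OF x0]]])
    have "((\<lambda>x. f2 (q * x + 0) * q * q) has_real_derivative f3 (q * x + 0) * q * q * q) (at x within {..0})"
      by (rule DERIV_cmult_right[OF DERIV_cmult_right[OF d[OF x d3[OF x0]]]])
    moreover have "f3 (q * x + 0) * q * q * q = Y x * B x - m / \<alpha> * (A x)\<^sup>2"
    proof -
      have "f3 (q * x + 0) = m * (f1 (q * x + 0))\<^sup>2 - \<alpha> * f (q * x + 0) * f2 (q * x + 0)"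
        using ode[OF x0] unfolding \<alpha>_def by simp
      then have "f3 (q * x + 0) * q * q * q =
          (m * (f1 (q * x + 0))\<^sup>2 - \<alpha> * f (q * x + 0) * f2 (q * x + 0)) * q * q * q"
        by (simp only:)
      also have "\<dots> = m * q * (A x)\<^sup>2 + (- \<alpha> * q) * (Y x * B x)"
        unfolding Y_def A_def B_def by (simp add: power2_eq_square algebra_simps)
      also have "m * q = - (m / \<alpha>)" unfolding q_def by simp
      finally show ?thesis unfolding q\<alpha>(2) by simp
    qed
    ultimately show "(B has_real_derivative Y x * B x - m / \<alpha> * (A x)\<^sup>2) (at x within {..0})"
      unfolding B_def[abs_def] by simp
  qed
  moreover have "(A \<longlongrightarrow> 0) at_bot"
  proof -
    have "LIM x at_bot. q * x + 0 :> at_top"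
      unfolding q_def by (rule neg_affine_at_bot) (use alpha_pos in simp)
    from tendsto_mult_right[OF filterlim_compose[OF bc(3) this], of q]
    show ?thesis unfolding A_def[abs_def] by simp
  qed
  ultimately have "halfline (m / \<alpha>) Y A B"
    by unfold_locales (use a bc q in \<open>auto simp: Y_def A_def\<close>)
  moreover have "Y 0 = a" "A 0 = 1 / \<alpha>" unfolding Y_def A_def using bc by (simp_all add: q_def)
  moreover have Af: "f1 t = - \<alpha> * A (- \<alpha> * t)" and Bf: "f2 t = \<alpha>\<^sup>2 * B (- \<alpha> * t)" and "f t = Y (- \<alpha> * t)" for t
  proof -
    have e: "q * (- \<alpha> * t) + 0 = t" using q\<alpha>(1) by simp
    show "f t = Y (- \<alpha> * t)" unfolding Y_def e ..
    have "- \<alpha> * A (- \<alpha> * t) = (- \<alpha> * q) * f1 t" unfolding A_def e by (simp only: mult_ac)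
    then show "f1 t = - \<alpha> * A (- \<alpha> * t)" unfolding q\<alpha>(2) by simp
    have "\<alpha>\<^sup>2 * B (- \<alpha> * t) = (- \<alpha> * q) * (- \<alpha> * q) * f2 t" unfolding B_def e by (simp add: power2_eq_square)
    then show "f2 t = \<alpha>\<^sup>2 * B (- \<alpha> * t)" unfolding q\<alpha>(2) by simp
  qed
  moreover have "(\<lambda>t. - \<alpha> * A (- \<alpha> * t)) = f1" using Af by auto
  ultimately show ?thesis using d1 d2 that by metis
qed

section \<open>Shape and number of the solutions\<close>

context
  fixes t1 t2 :: real
  assumes tt: "turns t1 t2"
begin

text \<open>The two alternatives correspond to a positive and to a zero limit. In the second case
  nothing is known about the solution beyond its trapping between the extreme levels, applied at
  time 0.\<close>

lemma bvp_shape: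
  assumes f: "f \<in> bvp_solutions m a" and a: "0 < a"
  shows "convex_on {0..} f \<and> strict_antimono_on {0..} f \<and> (\<forall>t\<ge>0. f t > 0)"
    and "(\<exists>e\<in>I. \<alpha> * R e * a\<^sup>2 = 1 \<and> f = fam a e) \<or> R t2 * (\<alpha> * a\<^sup>2) < 1 \<and> 1 < R t1 * (\<alpha> * a\<^sup>2)"
proof -
  obtain Y A B where h: "halfline (m / \<alpha>) Y A B" and Y0: "Y 0 = a" and A0: "A 0 = 1 / \<alpha>"
    and fY: "\<And>t. 0 \<le> t \<Longrightarrow> f t = Y (- \<alpha> * t)"
    and f1: "\<And>t. 0 \<le> t \<Longrightarrow> (f has_real_derivative - \<alpha> * A (- \<alpha> * t)) (at t within {0..})"
    and f2: "\<And>t. 0 \<le> t \<Longrightarrow> ((\<lambda>t. - \<alpha> * A (- \<alpha> * t)) has_real_derivative \<alpha>\<^sup>2 * B (- \<alpha> * t)) (at t within {0..})"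
    using bvp_halfline[OF f a] by metis
  interpret h: halfline "m / \<alpha>" Y A B by (rule h)
  have neg: "- \<alpha> * t \<le> 0" if "0 \<le> t" for t using that alpha_pos by simp
  have main: "(\<forall>x\<le>0. 0 < B x) \<and>
    ((\<exists>e\<in>I. \<alpha> * R e * a\<^sup>2 = 1 \<and> f = fam a e) \<or> R t2 * (\<alpha> * a\<^sup>2) < 1 \<and> 1 < R t1 * (\<alpha> * a\<^sup>2))"
  proof (cases "h.lam = 0")
    case True
    then interpret v: vanishing "m / \<alpha>" Y A B by unfold_locales
    have "rho Y A 0 * (\<alpha> * a\<^sup>2) = 1" unfolding rho_def Y0 A0 using a alpha_pos by simp
    moreover have "R t2 * (\<alpha> * a\<^sup>2) < rho Y A 0 * (\<alpha> * a\<^sup>2)" "rho Y A 0 * (\<alpha> * a\<^sup>2) < R t1 * (\<alpha> * a\<^sup>2)"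
      using v.above_min[OF tt] v.below_max[OF tt] a alpha_pos by (auto intro!: mult_strict_right_mono)
    ultimately show ?thesis using v.B_pos[OF tt] by simp
  next
    case False
    define l where "l = h.lam"
    have l: "0 < l" unfolding l_def using False h.lam_nonneg by simp
    obtain e where e: "e \<in> I" and rep: "\<forall>x\<le>0. Y x = l * F (l * x + e) \<and> A x = l\<^sup>2 * FA (l * x + e) \<and> B x = l ^ 3 * FB (l * x + e)"
      using h.positive_limit l unfolding l_def by blast
    have le: "l = a / F e" using rep Y0 FYA_pos(1)[OF e] by (auto simp: field_simps)
    have "\<alpha> * R e * a\<^sup>2 = \<alpha> * (l\<^sup>2 * FA e)"
      unfolding le rho_def using FYA_pos(1)[OF e] by (simp add: field_simps power2_eq_square)
    also have "l\<^sup>2 * FA e = A 0" using rep by simp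
    also have "\<alpha> * A 0 = 1" unfolding A0 using alpha_pos by simp
    finally have Re: "\<alpha> * R e * a\<^sup>2 = 1" .
    have "f = fam a e"
    proof (rule extensionalityI[where A = "{0..}"])
      show "f \<in> extensional {0..}" using f unfolding bvp_solutions_def by simp
      show "fam a e \<in> extensional {0..}" unfolding fam_def by simp
      fix t :: real assume "t \<in> {0..}"
      then show "f t = fam a e t"
        using fY[of t] rep neg[of t] unfolding fam_def le[symmetric] by (simp add: mult_ac)
    qed
    moreover have "0 < B x" if "x \<le> 0" for x
    proof -
      have "l * x + e \<in> I"
        by (rule I_down[OF e]) (use that l in \<open>simp add: mult_nonneg_nonpos\<close>)
      then show ?thesis using rep that l FYA_pos(3) by simp
    qed
    ultimately show ?thesis using e Re by blast
  qed
  have "convex_on {0..} f"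
  proof (rule convex_on_if_deriv2_nonneg[OF _ f1 f2])
    fix t :: real assume "t \<in> {0..}"
    then have "0 < B (- \<alpha> * t)" using main neg[of t] by blast
    then show "0 \<le> \<alpha>\<^sup>2 * B (- \<alpha> * t)" by simp
  qed simp_all
  moreover have "strict_antimono_on {0..} f"
    by (rule monotone_onI) (use fY h.Y_less alpha_pos neg in auto)
  moreover have "\<forall>t\<ge>0. f t > 0" using fY h.Y_pos neg by simp
  ultimately show "convex_on {0..} f \<and> strict_antimono_on {0..} f \<and> (\<forall>t\<ge>0. f t > 0)" by blast
  show "(\<exists>e\<in>I. \<alpha> * R e * a\<^sup>2 = 1 \<and> f = fam a e) \<or> R t2 * (\<alpha> * a\<^sup>2) < 1 \<and> 1 < R t1 * (\<alpha> * a\<^sup>2)"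
    using main by blast
qed

text \<open>Outside the open interval between \<open>R t2\<close> and \<open>R t1\<close> a solution
  with limit 0 cannot have the prescribed starting level, so solutions correspond exactly to points
  of the series orbit at this level. Inside the interval there may be others, and only a lower bound
  on their number is derived.\<close>

lemma bvp_eq:
  assumes a: "0 < a" and w: "w * (\<alpha> * a\<^sup>2) = 1" and out: "w \<le> R t2 \<or> R t1 \<le> w"
  shows "bvp_solutions m a = fam a ` {e \<in> I. R e = w}"
proof -
  have q: "0 < \<alpha> * a\<^sup>2" using a alpha_pos by simp
  have iff: "\<alpha> * R e * a\<^sup>2 = 1 \<longleftrightarrow> R e = w" for e
  proof -
    have "\<alpha> * R e * a\<^sup>2 = 1 \<longleftrightarrow> R e * (\<alpha> * a\<^sup>2) = w * (\<alpha> * a\<^sup>2)" using w by (simp only: mult_ac)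
    also have "\<dots> \<longleftrightarrow> R e = w" using a alpha_pos by (intro mult_right_cancel) simp
    finally show ?thesis .
  qed
  show ?thesis
  proof (intro equalityI subsetI)
    fix f assume f: "f \<in> bvp_solutions m a"
    have "\<not> (R t2 * (\<alpha> * a\<^sup>2) < 1 \<and> 1 < R t1 * (\<alpha> * a\<^sup>2))"
      using out unfolding w[symmetric] mult_less_cancel_right_pos[OF q] by linarith
    then show "f \<in> fam a ` {e \<in> I. R e = w}" using bvp_shape(2)[OF f a] iff by auto
  next
    fix f assume "f \<in> fam a ` {e \<in> I. R e = w}"
    then show "f \<in> bvp_solutions m a" using fam_in[OF a] iff by auto
  qed
qed

lemma R_le_max: "x \<in> I \<Longrightarrow> x \<noteq> t1 \<Longrightarrow> R x < R t1"
  using R_inc[OF tt, of x t1] R_dec[OF tt, of t1 x] R_trapped[OF tt, of x]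
  by (cases "x < t1"; cases "x \<le> t2") auto

lemma R_ge_min: "x \<in> I \<Longrightarrow> t1 \<le> x \<Longrightarrow> x \<noteq> t2 \<Longrightarrow> R t2 < R x"
  using R_dec[OF tt, of x t2] R_trapped[OF tt, of x]
  by (cases "x < t2") auto

lemma ex_level_up:
  assumes "0 < w" "w < R t1"
  obtains e where "e \<in> I" "e < t1" "R e = w"
proof -
  obtain u where u: "u \<le> t1" "{w..R t1} \<subseteq> R ` {u..t1}" using R_cover_up[OF tt assms(1)] by blast
  then have "w \<in> R ` {u..t1}" using assms(2) by auto
  then obtain e where e: "e \<le> t1" "R e = w" by auto
  then have "e < t1" using assms(2) by (cases "e = t1") auto
  then show ?thesis using that e I_down[OF turnsD(1)[OF tt] e(1)] by blast
qed

lemma level_up_unique: "e \<le> t1 \<Longrightarrow> e' \<le> t1 \<Longrightarrow> R e = R e' \<Longrightarrow> e = e'"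
  using R_inc[OF tt, of e e'] R_inc[OF tt, of e' e] by (cases e e' rule: linorder_cases) auto

end

lemma solution_counts:
  "\<exists>a1 a2 :: real. 0 < a1 \<and> a1 < a2 \<and>
    (\<forall>a. 0 < a \<and> a < a1 \<longrightarrow> bvp_solutions m a = {}) \<and>
    (\<exists>!f. f \<in> bvp_solutions m a1) \<and>
    (\<forall>a. a1 < a \<and> a < a2 \<longrightarrow>
      (\<exists>f \<in> bvp_solutions m a. \<exists>g \<in> bvp_solutions m a. f \<noteq> g)) \<and>
    card (bvp_solutions m a2) = 2 \<and>
    (\<forall>a. a2 < a \<longrightarrow> (\<exists>!f. f \<in> bvp_solutions m a)) \<and>
    (\<forall>a>0. \<forall>f \<in> bvp_solutions m a.
      convex_on {0..} f \<and> strict_antimono_on {0..} f \<and> (\<forall>t\<ge>0. f t > 0))"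
proof -
  obtain t1 t2 where tt: "turns t1 t2" using ex_turns by blast
  note t = turnsD[OF tt]
  have Rp: "0 < R t1" "0 < R t2" using R_pos t(1,2) by auto
  have R12: "R t2 < R t1" using t(8,9) by linarith
  \<comment> \<open>\<open>b\<close> is the inverse of \<open>lev\<close> below. Both are
    decreasing, so the higher level \<open>R t1\<close> yields the smaller threshold.\<close>
  define b where "b w = 1 / sqrt (\<alpha> * w)" for w
  have b_pos: "0 < b w" if "0 < w" for w unfolding b_def using that alpha_pos by simp
  have b_eq: "w * (\<alpha> * (b w)\<^sup>2) = 1" if "0 < w" for w
    unfolding b_def using that alpha_pos by (simp add: power_divide)
  define lev where "lev a = 1 / (\<alpha> * a\<^sup>2)" for a :: real
  have lev: "lev a * (\<alpha> * a\<^sup>2) = 1" "0 < lev a" if "0 < a" for a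
    unfolding lev_def using that alpha_pos by auto
  have lev_less: "lev a < w" if "0 < w" "b w < a" for a w
  proof -
    have a: "0 < a" using b_pos[OF that(1)] that(2) by linarith
    have "(b w)\<^sup>2 < a\<^sup>2" using that(2) b_pos[OF that(1)] by (intro power_strict_mono) auto
    then have "w * (\<alpha> * (b w)\<^sup>2) < w * (\<alpha> * a\<^sup>2)" using that(1) alpha_pos by simp
    then have "lev a * (\<alpha> * a\<^sup>2) < w * (\<alpha> * a\<^sup>2)" unfolding b_eq[OF that(1)] lev(1)[OF a] .
    then show ?thesis using a alpha_pos by simp
  qed
  have less_lev: "w < lev a" if "0 < w" "0 < a" "a < b w" for a w
  proof -
    have "a\<^sup>2 < (b w)\<^sup>2" using that by (intro power_strict_mono) auto
    then have "w * (\<alpha> * a\<^sup>2) < w * (\<alpha> * (b w)\<^sup>2)" using that(1) alpha_pos by simp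
    then have "w * (\<alpha> * a\<^sup>2) < lev a * (\<alpha> * a\<^sup>2)" unfolding b_eq[OF that(1)] lev(1)[OF that(2)] .
    then show ?thesis using that alpha_pos by simp
  qed
  define a1 a2 where "a1 = b (R t1)" and "a2 = b (R t2)"
  have a12: "0 < a1" "0 < a2" unfolding a1_def a2_def using b_pos Rp by auto
  have lt: "a1 < a2"
    unfolding a1_def a2_def b_def using Rp R12 alpha_pos by (simp add: divide_strict_left_mono)
  have c1: "bvp_solutions m a = {}" if "0 < a" "a < a1" for a
  proof -
    have w: "R t1 < lev a" using less_lev[OF Rp(1) that(1)] that(2) unfolding a1_def by simp
    then have "{e \<in> I. R e = lev a} = {}" using R_le_max[OF tt] by force
    then show ?thesis using bvp_eq[OF tt that(1) lev(1)[OF that(1)]] w by simp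
  qed
  have c2: "\<exists>!f. f \<in> bvp_solutions m a1"
  proof -
    have "{e \<in> I. R e = R t1} = {t1}" using R_le_max[OF tt] t(1) by force
    then have "bvp_solutions m a1 = {fam a1 t1}"
      using bvp_eq[OF tt a12(1), of "R t1"] b_eq[OF Rp(1)] unfolding a1_def by simp
    then show ?thesis by simp
  qed
  \<comment> \<open>Levels strictly between the two extremes are taken once before \<open>t1\<close>
    and once between \<open>t1\<close> and \<open>t2\<close>, which gives two different
    parameters.\<close>
  have c3: "\<exists>f \<in> bvp_solutions m a. \<exists>g \<in> bvp_solutions m a. f \<noteq> g" if "a1 < a" "a < a2" for a
  proof -
    have a: "0 < a" using a12 that by linarith
    have w: "lev a < R t1" "R t2 < lev a"
      using lev_less[OF Rp(1)] less_lev[OF Rp(2) a] that unfolding a1_def a2_def by auto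
    obtain e where e: "e \<in> I" "e < t1" "R e = lev a"
      using ex_level_up[OF tt lev(2)[OF a] w(1)] by blast
    have "lev a \<in> R ` {t1..t2}" using R_cover_down[OF tt] w by auto
    then obtain e' where e': "t1 \<le> e'" "e' \<le> t2" "R e' = lev a" by auto
    have e'I: "e' \<in> I" using I_down[OF t(2) e'(2)] .
    have in_b: "fam a x \<in> bvp_solutions m a" if "x \<in> I" "R x = lev a" for x
      by (rule fam_in[OF a that(1)]) (use lev(1)[OF a] that(2) in \<open>simp add: mult_ac\<close>)
    have "fam a e \<noteq> fam a e'" using fam_inj[OF a e(1) e'I] e(2) e'(1) by auto
    then show ?thesis using in_b[OF e(1,3)] in_b[OF e'I e'(3)] by blast
  qed
  have c4: "card (bvp_solutions m a2) = 2"
  proof -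
    obtain e where e: "e \<in> I" "e < t1" "R e = R t2"
      using ex_level_up[OF tt Rp(2) R12] by blast
    \<comment> \<open>The level of the minimum is met on the rising arc and at \<open>t2\<close>
      itself; between \<open>t1\<close> and \<open>t2\<close>, and by the trapping also after
      \<open>t2\<close>, the values are strictly larger.\<close>
    have "{x \<in> I. R x = R t2} = {e, t2}"
    proof (intro equalityI subsetI)
      fix x assume x: "x \<in> {x \<in> I. R x = R t2}"
      show "x \<in> {e, t2}"
      proof (cases "t1 \<le> x")
        case True
        then show ?thesis using R_ge_min[OF tt, of x] x by auto
      next
        case False
        then show ?thesis using level_up_unique[OF tt, of x e] x e by auto
      qed
    qed (use e t(2) in auto)
    then have "bvp_solutions m a2 = {fam a2 e, fam a2 t2}"
      using bvp_eq[OF tt a12(2), of "R t2"] b_eq[OF Rp(2)] unfolding a2_def by simp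
    moreover have "fam a2 e \<noteq> fam a2 t2"
      using fam_inj[OF a12(2) e(1) t(2)] e(2) t(3) by auto
    ultimately show ?thesis by simp
  qed
  have c5: "\<exists>!f. f \<in> bvp_solutions m a" if "a2 < a" for a
  proof -
    have a: "0 < a" using a12 that by linarith
    have w: "lev a < R t2" using lev_less[OF Rp(2)] that unfolding a2_def by simp
    obtain e where e: "e \<in> I" "e < t1" "R e = lev a"
      using ex_level_up[OF tt lev(2)[OF a]] w R12 by (metis less_trans)
    have "{x \<in> I. R x = lev a} = {e}"
    proof (intro equalityI subsetI)
      fix x assume x: "x \<in> {x \<in> I. R x = lev a}"
      have "x < t1"
      proof (rule ccontr)
        assume "\<not> x < t1"
        then have "R t2 \<le> R x" using R_ge_min[OF tt, of x] x by (cases "x = t2") auto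
        then show False using x w by simp
      qed
      then show "x \<in> {e}" using level_up_unique[OF tt, of x e] x e by simp
    qed (use e in auto)
    then have "bvp_solutions m a = {fam a e}"
      using bvp_eq[OF tt a lev(1)[OF a]] w by simp
    then show ?thesis by simp
  qed
  show ?thesis
    by (rule exI[of _ a1], rule exI[of _ a2],
        intro conjI allI impI ballI a12(1) lt c2 c4 c3 c5 bvp_shape(1)[OF tt, THEN conjunct1]
          bvp_shape(1)[OF tt, THEN conjunct2, THEN conjunct1]
          bvp_shape(1)[OF tt, THEN conjunct2, THEN conjunct2, THEN spec, THEN mp])
      (auto simp: c1)
qed

end

theorem theorem4:
  fixes m :: real
  assumes "0 < m" and "m < 1"
  shows "\<exists>a1 a2 :: real. 0 < a1 \<and> a1 < a2 \<and>
    (\<forall>a. 0 < a \<and> a < a1 \<longrightarrow> bvp_solutions m a = {}) \<and>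
    (\<exists>!f. f \<in> bvp_solutions m a1) \<and>
    (\<forall>a. a1 < a \<and> a < a2 \<longrightarrow>
      (\<exists>f \<in> bvp_solutions m a. \<exists>g \<in> bvp_solutions m a. f \<noteq> g)) \<and>
    card (bvp_solutions m a2) = 2 \<and>
    (\<forall>a. a2 < a \<longrightarrow> (\<exists>!f. f \<in> bvp_solutions m a)) \<and>
    (\<forall>a>0. \<forall>f \<in> bvp_solutions m a.
      convex_on {0..} f \<and> strict_antimono_on {0..} f \<and> (\<forall>t\<ge>0. f t > 0))"
  by (rule problem.solution_counts, unfold_locales) (fact assms)+

end
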